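(* Assume that there is a countable transitive model of $\mathsf{ZFC}$. Let $T \subseteq \mathsf{IKP}^+ + \mathsf{MP} + \mathsf{AC}$ be a set theory. Then $T$ has the de Jongh property with respect to every Kripke-complete intermediate propositional logic $J$, i.e., $\mathbf{L}(T(J)) = J$.
   Context: Set theories. $\mathcal{L}_\in$ is the first-order language with $\in$ and $=$; a set theory is a theory in $\mathcal{L}_\in$ based on intuitionistic first-order logic. A $\Delta_0$-formula (bounded formula) is one all of whose quantifiers are of the form $\forall x \in a$ or $\exists x \in a$. $\mathsf{IKP}$ consists of intuitionistic first-order logic for $\mathcal{L}_\in$ plus: Empty Set $\exists a\, \forall x \in a\, \bot$; Pairing $\forall a \forall b \exists y \forall x (x \in y \leftrightarrow (x = a \vee x = b))$; Union $\forall a \exists y \forall x (x \in y \leftrightarrow \exists u (u \in a \wedge x \in u))$; Extensionality $\forall a \forall b (\forall x (x \in a \leftrightarrow x \in b) \rightarrow a = b)$; Infinity $\exists x (\emptyset \in x \wedge \forall y (y \in x \rightarrow y \cup \{y\} \in x) \wedge \forall y (y \in x \rightarrow (y = \emptyset \vee \exists z \in y\; y = z \cup \{z\})))$; Set Induction $(\forall a (\forall x \in a\, \varphi(x) \rightarrow \varphi(a))) \rightarrow \forall a\, \varphi(a)$ for all formulas $\varphi$; $\Delta_0$-Separation $\forall a \exists y \forall x (x \in y \leftrightarrow x \in a \wedge \varphi(x))$ and $\Delta_0$-Collection $\forall a (\forall x \in a \exists y\, \varphi(x,y) \rightarrow \exists b \forall x \in a \exists y \in b\, \varphi(x,y))$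 for $\Delta_0$-formulas $\varphi$. $\mathsf{IKP}^+$ is $\mathsf{IKP}$ plus Bounded Strong Collection, $\forall a (\forall x \in a \exists y\, \varphi(x,y) \rightarrow \exists b (\forall x \in a \exists y \in b\, \varphi(x,y) \wedge \forall y \in b \exists x \in a\, \varphi(x,y)))$ for $\Delta_0$-formulas $\varphi$, and Set-bounded Subset Collection, $\forall a \forall b \exists c \forall z (\forall x \in a \exists y \in b\, \psi(x,y,z) \rightarrow \exists d \in c (\forall x \in a \exists y \in d\, \psi(x,y,z) \wedge \forall y \in d \exists x \in a\, \psi(x,y,z)))$ for $\Delta_0$-formulas $\psi$ in which $z$ is set-bounded (i.e. from $\psi(x,y,z)$ one can intuitionistically derive $z \in t$ for some term $t$ appearing in $\psi$). $\mathsf{MP}$ (Markov's principle) is $\forall \alpha : \mathbb{N} \to 2\, (\neg \forall n \in \mathbb{N}\; \alpha(n) = 0 \rightarrow \exists n \in \mathbb{N}\; \alpha(n) = 1)$. $\mathsf{AC}$ is $\forall a ((\forall x \in a \forall y \in a\, (x \neq y \rightarrow x \cap y = \emptyset)) \rightarrow \exists b \forall x \in a \exists! z \in b\; z \in x)$. Propositional logics. $\mathbf{IPC}$ and $\mathbf{CPC}$ are intuitionistic and classical propositional logic; logics are identified with their sets of consequences. A propositional logic $J$ is intermediate if $\mathbf{IPC} \subseteq J \subseteq \mathbf{CPC}$. A Kripke frame is a set $K$ with a partial order $\leq$; a formula is valid in it if it is forced at all nodes under all persistent valuations (usual intuitionistic Kripke semantics). $J$ is Kripke-complete if there is a class $\mathcal{C}$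 of Kripke frames such that $J$ is the set of all propositional formulas valid in every frame in $\mathcal{C}$. Translations. A propositional translation $\sigma$ maps propositional letters to sentences of the language of the theory and is extended to all propositional formulas by commuting with the connectives, $\varphi \mapsto \varphi^\sigma$. $\mathbf{L}(T)$ is the set of propositional formulas $\varphi$ such that $T \vdash \varphi^\sigma$ for all propositional translations $\sigma$. $T(J)$ is the theory obtained from $T$ by adding all sentences $A^\sigma$ for $A \in J$ and propositional translations $\sigma$.
   Formalization: AC is taken with the extra premise that every member of the family a is inhabited; as printed, AC is refuted by a = {∅}, so IKP⁺ + MP + AC would be inconsistent and the claim would fail for T equal to that theory. *)

theory Defs
  imports "HOL-Library.Countable_Set_Type"
begin

section \<open>First-order formulas over membership and equality\<close>

text \<open>Variables are de Bruijn indices: an atom refers to index \<open>i\<close> for the \<open>i\<close>-th enclosing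
  quantifier counted from the inside; indices beyond all quantifiers are free. The language has no
  function symbols, so variables are the only terms.\<close>

datatype fm =
    Mem nat nat
  | Eq nat nat
  | Fls
  | Conj fm fm
  | Disj fm fm
  | Impl fm fm
  | All fm
  | Ex fm

definition Neg :: "fm \<Rightarrow> fm" where
  "Neg \<phi> = Impl \<phi> Fls"

definition Iff :: "fm \<Rightarrow> fm \<Rightarrow> fm" where
  "Iff \<phi> \<psi> = Conj (Impl \<phi> \<psi>) (Impl \<psi> \<phi>)"

text \<open>In \<open>BAll a \<phi>\<close> and \<open>BEx a \<phi>\<close> the bound \<open>a\<close> is an index of the surrounding context,
  while \<open>\<phi>\<close> lives below the new binder, where that bound has become \<open>Suc a\<close>.\<close>

definition BAll :: "nat \<Rightarrow> fm \<Rightarrow> fm" where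
  "BAll a \<phi> = All (Impl (Mem 0 (Suc a)) \<phi>)"

definition BEx :: "nat \<Rightarrow> fm \<Rightarrow> fm" where
  "BEx a \<phi> = Ex (Conj (Mem 0 (Suc a)) \<phi>)"

primrec fv :: "fm \<Rightarrow> nat set" where
  "fv (Mem i j) = {i, j}"
| "fv (Eq i j) = {i, j}"
| "fv Fls = {}"
| "fv (Conj \<phi> \<psi>) = fv \<phi> \<union> fv \<psi>"
| "fv (Disj \<phi> \<psi>) = fv \<phi> \<union> fv \<psi>"
| "fv (Impl \<phi> \<psi>) = fv \<phi> \<union> fv \<psi>"
| "fv (All \<phi>) = {i. Suc i \<in> fv \<phi>}"
| "fv (Ex \<phi>) = {i. Suc i \<in> fv \<phi>}"

definition sentence :: "fm \<Rightarrow> bool" where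
  "sentence \<phi> \<longleftrightarrow> fv \<phi> = {}"

inductive delta0 :: "fm \<Rightarrow> bool" where
  "delta0 (Mem i j)"
| "delta0 (Eq i j)"
| "delta0 Fls"
| "delta0 \<phi> \<Longrightarrow> delta0 \<psi> \<Longrightarrow> delta0 (Conj \<phi> \<psi>)"
| "delta0 \<phi> \<Longrightarrow> delta0 \<psi> \<Longrightarrow> delta0 (Disj \<phi> \<psi>)"
| "delta0 \<phi> \<Longrightarrow> delta0 \<psi> \<Longrightarrow> delta0 (Impl \<phi> \<psi>)"
| "delta0 \<phi> \<Longrightarrow> delta0 (BAll a \<phi>)"
| "delta0 \<phi> \<Longrightarrow> delta0 (BEx a \<phi>)"

text \<open>Simultaneous capture-avoiding renaming of the free variables.\<close>

primrec ren :: "(nat \<Rightarrow> nat) \<Rightarrow> fm \<Rightarrow> fm" where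
  "ren r (Mem i j) = Mem (r i) (r j)"
| "ren r (Eq i j) = Eq (r i) (r j)"
| "ren r Fls = Fls"
| "ren r (Conj \<phi> \<psi>) = Conj (ren r \<phi>) (ren r \<psi>)"
| "ren r (Disj \<phi> \<psi>) = Disj (ren r \<phi>) (ren r \<psi>)"
| "ren r (Impl \<phi> \<psi>) = Impl (ren r \<phi>) (ren r \<psi>)"
| "ren r (All \<phi>) = All (ren (case_nat 0 (\<lambda>i. Suc (r i))) \<phi>)"
| "ren r (Ex \<phi>) = Ex (ren (case_nat 0 (\<lambda>i. Suc (r i))) \<phi>)"

text \<open>\<open>inst t \<phi>\<close> replaces variable \<open>0\<close> by the variable \<open>t\<close> and lowers all others by one, so that
  \<open>inst t \<phi>\<close> is the instance of \<open>All \<phi>\<close> at \<open>t\<close>. \<open>shift k \<phi>\<close> makes room for a new variable at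
  index \<open>k\<close>, which does not occur free in the result; it replaces side conditions of the form
  ``\<open>b\<close> is not free in \<open>\<phi>\<close>''.\<close>

definition inst :: "nat \<Rightarrow> fm \<Rightarrow> fm" where
  "inst t \<phi> = ren (case_nat t (\<lambda>i. i)) \<phi>"

definition shift :: "nat \<Rightarrow> fm \<Rightarrow> fm" where
  "shift k \<phi> = ren (\<lambda>i. if i < k then i else Suc i) \<phi>"

definition swap :: "fm \<Rightarrow> fm" where
  "swap \<phi> = ren (id(0 := 1, 1 := 0)) \<phi>"

definition Ex1 :: "fm \<Rightarrow> fm" where
  "Ex1 \<phi> = Ex (Conj \<phi> (All (Impl (shift 1 \<phi>) (Eq 0 1))))"

section \<open>Intuitionistic first-order logic with equality\<close>

inductive proves :: "fm set \<Rightarrow> fm \<Rightarrow> bool" (infix \<open>\<turnstile>\<close> 50) where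
  Hyp: "\<phi> \<in> \<Gamma> \<Longrightarrow> \<Gamma> \<turnstile> \<phi>"
| FlsE: "\<Gamma> \<turnstile> Fls \<Longrightarrow> \<Gamma> \<turnstile> \<phi>"
| ConjI: "\<Gamma> \<turnstile> \<phi> \<Longrightarrow> \<Gamma> \<turnstile> \<psi> \<Longrightarrow> \<Gamma> \<turnstile> Conj \<phi> \<psi>"
| ConjE1: "\<Gamma> \<turnstile> Conj \<phi> \<psi> \<Longrightarrow> \<Gamma> \<turnstile> \<phi>"
| ConjE2: "\<Gamma> \<turnstile> Conj \<phi> \<psi> \<Longrightarrow> \<Gamma> \<turnstile> \<psi>"
| DisjI1: "\<Gamma> \<turnstile> \<phi> \<Longrightarrow> \<Gamma> \<turnstile> Disj \<phi> \<psi>"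
| DisjI2: "\<Gamma> \<turnstile> \<psi> \<Longrightarrow> \<Gamma> \<turnstile> Disj \<phi> \<psi>"
| DisjE: "\<Gamma> \<turnstile> Disj \<phi> \<psi> \<Longrightarrow> insert \<phi> \<Gamma> \<turnstile> \<chi> \<Longrightarrow> insert \<psi> \<Gamma> \<turnstile> \<chi> \<Longrightarrow> \<Gamma> \<turnstile> \<chi>"
| ImplI: "insert \<phi> \<Gamma> \<turnstile> \<psi> \<Longrightarrow> \<Gamma> \<turnstile> Impl \<phi> \<psi>"
| ImplE: "\<Gamma> \<turnstile> Impl \<phi> \<psi> \<Longrightarrow> \<Gamma> \<turnstile> \<phi> \<Longrightarrow> \<Gamma> \<turnstile> \<psi>"
| AllI: "shift 0 ` \<Gamma> \<turnstile> \<phi> \<Longrightarrow> \<Gamma> \<turnstile> All \<phi>"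
| AllE: "\<Gamma> \<turnstile> All \<phi> \<Longrightarrow> \<Gamma> \<turnstile> inst t \<phi>"
| ExI: "\<Gamma> \<turnstile> inst t \<phi> \<Longrightarrow> \<Gamma> \<turnstile> Ex \<phi>"
| ExE: "\<Gamma> \<turnstile> Ex \<phi> \<Longrightarrow> insert \<phi> (shift 0 ` \<Gamma>) \<turnstile> shift 0 \<psi> \<Longrightarrow> \<Gamma> \<turnstile> \<psi>"
| EqI: "\<Gamma> \<turnstile> Eq t t"
| EqE: "\<Gamma> \<turnstile> Eq s t \<Longrightarrow> \<Gamma> \<turnstile> inst s \<phi> \<Longrightarrow> \<Gamma> \<turnstile> inst t \<phi>"

text \<open>A set theory is given by a set of non-logical axioms, which are sentences.\<close>

definition set_theory :: "fm set \<Rightarrow> bool" where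
  "set_theory T \<longleftrightarrow> (\<forall>\<phi>\<in>T. sentence \<phi>)"

definition theorems :: "fm set \<Rightarrow> fm set" where
  "theorems T = {\<phi>. sentence \<phi> \<and> T \<turnstile> \<phi>}"

section \<open>Set-theoretic axioms\<close>

text \<open>Parameters of the axiom schemes are universally quantified.\<close>

definition closures :: "fm set \<Rightarrow> fm set" where
  "closures C = {(All ^^ n) \<phi> | n \<phi>. \<phi> \<in> C \<and> sentence ((All ^^ n) \<phi>)}"

definition is_empty :: "nat \<Rightarrow> fm" where
  "is_empty x = BAll x Fls"

definition is_one :: "nat \<Rightarrow> fm" where \<comment> \<open>\<open>x = {\<emptyset>}\<close>\<close>
  "is_one x = All (Iff (Mem 0 (Suc x)) (is_empty 0))"

definition is_succ :: "nat \<Rightarrow> nat \<Rightarrow> fm" where \<comment> \<open>\<open>y = z \<union> {z}\<close>\<close>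
  "is_succ y z = All (Iff (Mem 0 (Suc y)) (Disj (Mem 0 (Suc z)) (Eq 0 (Suc z))))"

definition is_upair :: "nat \<Rightarrow> nat \<Rightarrow> nat \<Rightarrow> fm" where \<comment> \<open>\<open>p = {a, b}\<close>\<close>
  "is_upair p a b = All (Iff (Mem 0 (Suc p)) (Disj (Eq 0 (Suc a)) (Eq 0 (Suc b))))"

definition is_pair :: "nat \<Rightarrow> nat \<Rightarrow> nat \<Rightarrow> fm" where \<comment> \<open>\<open>p = {{a}, {a, b}}\<close>\<close>
  "is_pair p a b = Ex (Ex (Conj (is_upair 1 (a + 2) (a + 2))
     (Conj (is_upair 0 (a + 2) (b + 2)) (is_upair (p + 2) 1 0))))"

definition is_omega :: "nat \<Rightarrow> fm" where
  "is_omega w = Conj (BEx w (is_empty 0))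
    (Conj (BAll w (BEx (Suc w) (is_succ 0 1)))
      (BAll w (Disj (is_empty 0) (BEx 0 (is_succ 1 0)))))"

definition empty_ax :: fm where
  "empty_ax = Ex (is_empty 0)"

definition pairing_ax :: fm where
  "pairing_ax = All (All (Ex (All (Iff (Mem 0 1) (Disj (Eq 0 3) (Eq 0 2))))))"

definition union_ax :: fm where
  "union_ax = All (Ex (All (Iff (Mem 0 1) (Ex (Conj (Mem 0 3) (Mem 1 0))))))"

definition extensionality_ax :: fm where
  "extensionality_ax = All (All (Impl (All (Iff (Mem 0 2) (Mem 0 1))) (Eq 1 0)))"

definition infinity_ax :: fm where
  "infinity_ax = Ex (is_omega 0)"

text \<open>Index layouts for the scheme formulas below; higher indices are parameters.
  Set induction: \<open>0 = a\<close>. Separation: \<open>0 = x\<close>, \<open>1 = a\<close>.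
  Collection and replacement: \<open>0 = y\<close>, \<open>1 = x\<close>, \<open>2 = a\<close>.
  Subset collection: \<open>0 = y\<close>, \<open>1 = x\<close>, \<open>2 = z\<close>, \<open>3 = b\<close>, \<open>4 = a\<close>.\<close>

definition set_induction :: "fm \<Rightarrow> fm" where
  "set_induction \<phi> = Impl (All (Impl (BAll 0 (shift 1 \<phi>)) \<phi>)) (All \<phi>)"

definition separation :: "fm \<Rightarrow> fm" where
  "separation \<phi> = All (Ex (All (Iff (Mem 0 1) (Conj (Mem 0 2) (shift 1 \<phi>)))))"

definition collection :: "fm \<Rightarrow> fm" where
  "collection \<phi> = All (Impl (BAll 0 (Ex \<phi>)) (Ex (BAll 1 (BEx 1 (shift 2 \<phi>)))))"

definition strong_collection :: "fm \<Rightarrow> fm" where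
  "strong_collection \<phi> = All (Impl (BAll 0 (Ex \<phi>))
     (Ex (Conj (BAll 1 (BEx 1 (shift 2 \<phi>))) (BAll 0 (BEx 2 (swap (shift 2 \<phi>)))))))"

definition subset_collection :: "fm \<Rightarrow> fm" where
  "subset_collection \<psi> = All (All (Ex (All (Impl (BAll 3 (BEx 3 (shift 3 \<psi>)))
     (BEx 1 (Conj (BAll 4 (BEx 1 (shift 2 (shift 3 \<psi>))))
                  (BAll 0 (BEx 5 (swap (shift 2 (shift 3 \<psi>)))))))))))"

definition set_bounded :: "nat \<Rightarrow> fm \<Rightarrow> bool" where
  "set_bounded z \<psi> \<longleftrightarrow> (\<exists>t\<in>fv \<psi>. {\<psi>} \<turnstile> Mem z t)"

definition IKP :: "fm set" where
  "IKP = {empty_ax, pairing_ax, union_ax, extensionality_ax, infinity_ax}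
    \<union> closures (range set_induction)
    \<union> closures (separation ` {\<phi>. delta0 \<phi>})
    \<union> closures (collection ` {\<phi>. delta0 \<phi>})"

definition IKP_plus :: "fm set" where
  "IKP_plus = IKP
    \<union> closures (strong_collection ` {\<phi>. delta0 \<phi>})
    \<union> closures (subset_collection ` {\<psi>. delta0 \<psi> \<and> set_bounded 2 \<psi>})"

text \<open>Markov's principle. The language has no constant for the set of natural numbers, so it is
  quantified over as any \<open>w\<close> satisfying the defining condition in the axiom of infinity, which
  determines \<open>w\<close> uniquely by extensionality and set induction.\<close>

definition pair_in :: "nat \<Rightarrow> nat \<Rightarrow> nat \<Rightarrow> fm" where
  "pair_in n i f = BEx f (is_pair 0 (Suc n) (Suc i))"

definition is_binary_seq :: "nat \<Rightarrow> nat \<Rightarrow> fm" where \<comment> \<open>\<open>f\<close> is a function from \<open>w\<close> to \<open>{0, 1}\<close>\<close>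
  "is_binary_seq f w = Conj
     (BAll f (BEx (Suc w) (Ex (Conj (Disj (is_empty 0) (is_one 0)) (is_pair 2 1 0)))))
     (BAll w (Ex1 (pair_in 1 0 (f + 2))))"

definition Markov :: fm where
  "Markov = All (Impl (is_omega 0) (All (Impl (is_binary_seq 0 1)
     (Impl (Neg (BAll 1 (Ex (Conj (is_empty 0) (pair_in 1 0 2)))))
           (BEx 1 (Ex (Conj (is_one 0) (pair_in 1 0 2))))))))"

text \<open>The axiom of choice for disjoint families. The members of the family \<open>a\<close> are required to be
  inhabited; without this, the axiom would be refuted by \<open>a = {\<emptyset>}\<close>.\<close>

definition choice_ax :: fm where
  "choice_ax = All (Impl
     (Conj (BAll 0 (Ex (Mem 0 1)))
           (BAll 0 (BAll 1 (Impl (Neg (Eq 1 0)) (Neg (Ex (Conj (Mem 0 2) (Mem 0 1))))))))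
     (Ex (BAll 1 (Ex1 (Conj (Mem 0 2) (Mem 0 1))))))"

section \<open>Countable transitive models of ZFC\<close>

definition foundation_ax :: fm where
  "foundation_ax = All (Impl (Ex (Mem 0 1)) (BEx 0 (Neg (Ex (Conj (Mem 0 1) (Mem 0 2))))))"

definition powerset_ax :: fm where
  "powerset_ax = All (Ex (All (Iff (Mem 0 1) (BAll 0 (Mem 0 3)))))"

definition replacement :: "fm \<Rightarrow> fm" where
  "replacement \<phi> = All (Impl (BAll 0 (Ex1 \<phi>))
     (Ex (All (Iff (Mem 0 1) (BEx 2 (swap (shift 2 \<phi>)))))))"

definition ZFC :: "fm set" where
  "ZFC = {empty_ax, extensionality_ax, foundation_ax, pairing_ax, union_ax, powerset_ax,
      infinity_ax, choice_ax}
    \<union> closures (range separation)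
    \<union> closures (range replacement)"

text \<open>The hereditarily countable sets, with their true membership relation. Every countable
  transitive set is a set of hereditarily countable sets, so this type is a sufficient universe for
  countable transitive models.\<close>

datatype hc = HC (elts: "hc cset")

definition hmem :: "hc \<Rightarrow> hc \<Rightarrow> bool" where
  "hmem x y \<longleftrightarrow> cin x (elts y)"

primrec sat :: "hc set \<Rightarrow> fm \<Rightarrow> (nat \<Rightarrow> hc) \<Rightarrow> bool" where
  "sat M (Mem i j) e \<longleftrightarrow> hmem (e i) (e j)"
| "sat M (Eq i j) e \<longleftrightarrow> e i = e j"
| "sat M Fls e \<longleftrightarrow> False"
| "sat M (Conj \<phi> \<psi>) e \<longleftrightarrow> sat M \<phi> e \<and> sat M \<psi> e"
| "sat M (Disj \<phi> \<psi>) e \<longleftrightarrow> sat M \<phi> e \<or> sat M \<psi> e"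
| "sat M (Impl \<phi> \<psi>) e \<longleftrightarrow> (sat M \<phi> e \<longrightarrow> sat M \<psi> e)"
| "sat M (All \<phi>) e \<longleftrightarrow> (\<forall>x\<in>M. sat M \<phi> (case_nat x e))"
| "sat M (Ex \<phi>) e \<longleftrightarrow> (\<exists>x\<in>M. sat M \<phi> (case_nat x e))"

text \<open>Only sentences are evaluated here, so the choice of the assignment \<open>e\<close> is irrelevant.\<close>

definition is_ctm :: "hc set \<Rightarrow> fm set \<Rightarrow> bool" where
  "is_ctm M T \<longleftrightarrow> M \<noteq> {} \<and> countable M \<and> (\<forall>x\<in>M. \<forall>y. hmem y x \<longrightarrow> y \<in> M)
    \<and> (\<forall>\<phi>\<in>T. \<forall>e. sat M \<phi> e)"

section \<open>Propositional logics\<close>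

datatype pfm =
    Letter nat
  | PFls
  | PConj pfm pfm
  | PDisj pfm pfm
  | PImpl pfm pfm

inductive pproves :: "pfm set \<Rightarrow> pfm \<Rightarrow> bool" (infix \<open>\<turnstile>\<^sub>p\<close> 50) where
  PHyp: "A \<in> \<Gamma> \<Longrightarrow> \<Gamma> \<turnstile>\<^sub>p A"
| PFlsE: "\<Gamma> \<turnstile>\<^sub>p PFls \<Longrightarrow> \<Gamma> \<turnstile>\<^sub>p A"
| PConjI: "\<Gamma> \<turnstile>\<^sub>p A \<Longrightarrow> \<Gamma> \<turnstile>\<^sub>p B \<Longrightarrow> \<Gamma> \<turnstile>\<^sub>p PConj A B"
| PConjE1: "\<Gamma> \<turnstile>\<^sub>p PConj A B \<Longrightarrow> \<Gamma> \<turnstile>\<^sub>p A"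
| PConjE2: "\<Gamma> \<turnstile>\<^sub>p PConj A B \<Longrightarrow> \<Gamma> \<turnstile>\<^sub>p B"
| PDisjI1: "\<Gamma> \<turnstile>\<^sub>p A \<Longrightarrow> \<Gamma> \<turnstile>\<^sub>p PDisj A B"
| PDisjI2: "\<Gamma> \<turnstile>\<^sub>p B \<Longrightarrow> \<Gamma> \<turnstile>\<^sub>p PDisj A B"
| PDisjE: "\<Gamma> \<turnstile>\<^sub>p PDisj A B \<Longrightarrow> insert A \<Gamma> \<turnstile>\<^sub>p C \<Longrightarrow> insert B \<Gamma> \<turnstile>\<^sub>p C \<Longrightarrow> \<Gamma> \<turnstile>\<^sub>p C"
| PImplI: "insert A \<Gamma> \<turnstile>\<^sub>p B \<Longrightarrow> \<Gamma> \<turnstile>\<^sub>p PImpl A B"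
| PImplE: "\<Gamma> \<turnstile>\<^sub>p PImpl A B \<Longrightarrow> \<Gamma> \<turnstile>\<^sub>p A \<Longrightarrow> \<Gamma> \<turnstile>\<^sub>p B"

definition IPC :: "pfm set" where
  "IPC = {A. {} \<turnstile>\<^sub>p A}"

definition CPC :: "pfm set" where
  "CPC = {A. {PDisj B (PImpl B PFls) | B. True} \<turnstile>\<^sub>p A}"

definition intermediate :: "pfm set \<Rightarrow> bool" where
  "intermediate J \<longleftrightarrow> IPC \<subseteq> J \<and> J \<subseteq> CPC"

type_synonym 'w frame = "'w set \<times> ('w \<times> 'w) set"

definition kripke_frame :: "'w frame \<Rightarrow> bool" where
  "kripke_frame F \<longleftrightarrow> partial_order_on (fst F) (snd F)"

definition persistent :: "'w frame \<Rightarrow> (nat \<Rightarrow> 'w set) \<Rightarrow> bool" where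
  "persistent F V \<longleftrightarrow>
    (\<forall>p. V p \<subseteq> fst F \<and> (\<forall>v w. (v, w) \<in> snd F \<longrightarrow> v \<in> V p \<longrightarrow> w \<in> V p))"

primrec forces :: "'w frame \<Rightarrow> (nat \<Rightarrow> 'w set) \<Rightarrow> pfm \<Rightarrow> 'w \<Rightarrow> bool" where
  "forces F V (Letter p) v \<longleftrightarrow> v \<in> V p"
| "forces F V PFls v \<longleftrightarrow> False"
| "forces F V (PConj A B) v \<longleftrightarrow> forces F V A v \<and> forces F V B v"
| "forces F V (PDisj A B) v \<longleftrightarrow> forces F V A v \<or> forces F V B v"
| "forces F V (PImpl A B) v \<longleftrightarrow>
    (\<forall>w\<in>fst F. (v, w) \<in> snd F \<longrightarrow> forces F V A w \<longrightarrow> forces F V B w)"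

definition valid_in :: "'w frame \<Rightarrow> pfm \<Rightarrow> bool" where
  "valid_in F A \<longleftrightarrow> (\<forall>V. persistent F V \<longrightarrow> (\<forall>v\<in>fst F. forces F V A v))"

text \<open>The type argument bounds the size of the frames. A class of frames can always be cut down to a
  set characterising the same logic (choose one refuting frame for each of the countably many
  invalid formulas), so a theorem that is polymorphic in the type covers all Kripke-complete
  logics.\<close>

definition kripke_complete :: "'w itself \<Rightarrow> pfm set \<Rightarrow> bool" where
  "kripke_complete _ J \<longleftrightarrow> (\<exists>\<C> :: 'w frame set.
    (\<forall>F\<in>\<C>. kripke_frame F) \<and> J = {A. \<forall>F\<in>\<C>. valid_in F A})"

section \<open>Translations and the de Jongh property\<close>

definition translation :: "(nat \<Rightarrow> fm) \<Rightarrow> bool" where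
  "translation \<sigma> \<longleftrightarrow> (\<forall>p. sentence (\<sigma> p))"

primrec translate :: "(nat \<Rightarrow> fm) \<Rightarrow> pfm \<Rightarrow> fm" where
  "translate \<sigma> (Letter p) = \<sigma> p"
| "translate \<sigma> PFls = Fls"
| "translate \<sigma> (PConj A B) = Conj (translate \<sigma> A) (translate \<sigma> B)"
| "translate \<sigma> (PDisj A B) = Disj (translate \<sigma> A) (translate \<sigma> B)"
| "translate \<sigma> (PImpl A B) = Impl (translate \<sigma> A) (translate \<sigma> B)"

definition prop_logic :: "fm set \<Rightarrow> pfm set" where \<comment> \<open>\<open>\<^bold>L(T)\<close>\<close>
  "prop_logic T = {A. \<forall>\<sigma>. translation \<sigma> \<longrightarrow> T \<turnstile> translate \<sigma> A}"

definition extend :: "fm set \<Rightarrow> pfm set \<Rightarrow> fm set" where \<comment> \<open>\<open>T(J)\<close>\<close>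
  "extend T J = T \<union> {translate \<sigma> A | \<sigma> A. translation \<sigma> \<and> A \<in> J}"

definition de_jongh_property :: "fm set \<Rightarrow> pfm set \<Rightarrow> bool" where
  "de_jongh_property T J \<longleftrightarrow> prop_logic (extend T J) = J"

end

theory Submission
  imports Defs "HOL-Library.Nat_Bijection"
begin

text \<open>Consider Kripke models on a frame whose node \<open>v\<close> carries a transitive set \<open>D v\<close> of
  hereditarily countable sets, with \<open>D v \<subseteq> D w\<close> for \<open>v \<le> w\<close>. Bounded formulas are decided there
  and mean what they say, so all axioms in question are forced as soon as every \<open>D v\<close> satisfies
  bounded separation, bounded collection and choice. Forced sentences of the form \<open>translate \<sigma> A\<close> obey the
  logic of the frame, so a valuation refuting \<open>A\<close> on a frame for \<open>J\<close> only has to be imitated by sentences.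

  A linear chain \<open>M\<^sub>0 \<in> M\<^sub>1 \<in> \<dots> \<in> M\<^sub>m\<close> of such sets with \<open>\<Sigma>\<^sub>1\<close> sentences \<open>\<tau>\<^sub>j\<close> true in \<open>M\<^sub>i\<close> exactly
  for \<open>j \<le> i\<close> suffices, although the valuation need not be linear. Number the subsets of
  \<open>{0, \<dots>, n-1}\<close> monotonically by binary expansion and put \<open>D v = M\<^sub>k\<close> where \<open>k\<close> is the number of
  \<open>{i. v \<in> V i}\<close>. Then \<open>\<tau>\<^sub>k \<longrightarrow> \<tau>\<^sub>k\<^sub>+\<^sub>1\<close> is forced at \<open>v\<close> iff no \<open>w \<ge> v\<close> has number exactly \<open>k\<close>, and
  \<open>v \<in> V i\<close> iff this holds for every \<open>k\<close> that numbers a set without \<open>i\<close>.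

  For the chain, closure of \<open>t\<close> under separation and collection is witnessed by a single set: a family
  of relations on \<open>t\<close> closed under enough operations to contain all definable ones. Being so
  certified is a bounded property. Countable elementary submodels of the universe provide chains of
  certified sets of every length, and an \<open>\<in>\<close>-minimal certified set with a chain of length \<open>m\<close> below it has
  no longer one, which makes the length of the chain below a set expressible by \<open>\<tau>\<^sub>j\<close>.\<close>

section \<open>Kripke models with classical domains\<close>

lemma case_nat_ren:
  "(\<lambda>i. case_nat x e (case_nat 0 (\<lambda>i. Suc (r i)) i)) = case_nat x (\<lambda>i. e (r i))"
  by (rule ext) (simp split: nat.split)

lemma range_case_nat [simp]: "range (case_nat x e) \<subseteq> A \<longleftrightarrow> x \<in> A \<and> range e \<subseteq> A"
  by (auto simp: image_subset_iff split: nat.splits)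

locale kripke =
  fixes K :: "'w set" and R :: "('w \<times> 'w) set" and D :: "'w \<Rightarrow> hc set"
  assumes R_refl: "v \<in> K \<Longrightarrow> (v, v) \<in> R"
    and R_trans: "(u, v) \<in> R \<Longrightarrow> (v, w) \<in> R \<Longrightarrow> (u, w) \<in> R"
    and D_mono: "v \<in> K \<Longrightarrow> w \<in> K \<Longrightarrow> (v, w) \<in> R \<Longrightarrow> D v \<subseteq> D w"
begin

text \<open>Atoms are evaluated as true membership and equality of hereditarily countable sets, so
  they do not depend on the node; only the domains grow. Assignments may leave the domain, and
  \<open>range e \<subseteq> D v\<close> is assumed separately where it matters.\<close>

primrec forced :: "fm \<Rightarrow> 'w \<Rightarrow> (nat \<Rightarrow> hc) \<Rightarrow> bool" where
  "forced (Mem i j) v e \<longleftrightarrow> hmem (e i) (e j)"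
| "forced (Eq i j) v e \<longleftrightarrow> e i = e j"
| "forced Fls v e \<longleftrightarrow> False"
| "forced (Conj \<phi> \<psi>) v e \<longleftrightarrow> forced \<phi> v e \<and> forced \<psi> v e"
| "forced (Disj \<phi> \<psi>) v e \<longleftrightarrow> forced \<phi> v e \<or> forced \<psi> v e"
| "forced (Impl \<phi> \<psi>) v e \<longleftrightarrow>
    (\<forall>w\<in>K. (v, w) \<in> R \<longrightarrow> forced \<phi> w e \<longrightarrow> forced \<psi> w e)"
| "forced (All \<phi>) v e \<longleftrightarrow>
    (\<forall>w\<in>K. (v, w) \<in> R \<longrightarrow> (\<forall>x\<in>D w. forced \<phi> w (case_nat x e)))"
| "forced (Ex \<phi>) v e \<longleftrightarrow> (\<exists>x\<in>D v. forced \<phi> v (case_nat x e))"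

lemma forced_mono:
  "forced \<phi> v e \<Longrightarrow> v \<in> K \<Longrightarrow> w \<in> K \<Longrightarrow> (v, w) \<in> R \<Longrightarrow> forced \<phi> w e"
proof (induction \<phi> arbitrary: v w e)
  case (Impl \<phi> \<psi>)
  then show ?case by (auto dest: R_trans)
next
  case (All \<phi>)
  then show ?case by (auto dest: R_trans)
next
  case (Ex \<phi>)
  then show ?case by simp (meson D_mono subsetD)
qed auto

lemma forced_ren: "forced (ren r \<phi>) v e \<longleftrightarrow> forced \<phi> v (\<lambda>i. e (r i))"
  by (induction \<phi> arbitrary: r v e) (simp_all add: case_nat_ren)

lemma forced_inst: "forced (inst t \<phi>) v e \<longleftrightarrow> forced \<phi> v (case_nat (e t) e)"
proof -
  have "(\<lambda>i. e (case_nat t (\<lambda>i. i) i)) = case_nat (e t) e"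
    by (rule ext) (simp split: nat.split)
  then show ?thesis by (simp add: inst_def forced_ren)
qed

lemma forced_shift0: "forced (shift 0 \<phi>) v (case_nat x e) \<longleftrightarrow> forced \<phi> v e"
  by (simp add: shift_def forced_ren)

lemma forced_cong_fv: "(\<And>i. i \<in> fv \<phi> \<Longrightarrow> e i = e' i) \<Longrightarrow> forced \<phi> v e \<longleftrightarrow> forced \<phi> v e'"
proof (induction \<phi> arbitrary: v e e')
  case (Conj \<phi> \<psi>)
  have "forced \<phi> v e = forced \<phi> v e'" "forced \<psi> v e = forced \<psi> v e'"
    using Conj.prems by (auto intro!: Conj.IH)
  then show ?case by simp
next
  case (Disj \<phi> \<psi>)
  have "forced \<phi> v e = forced \<phi> v e'" "forced \<psi> v e = forced \<psi> v e'"
    using Disj.prems by (auto intro!: Disj.IH)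
  then show ?case by simp
next
  case (Impl \<phi> \<psi>)
  have "forced \<phi> w e = forced \<phi> w e'" "forced \<psi> w e = forced \<psi> w e'" for w
    using Impl.prems by (auto intro!: Impl.IH)
  then show ?case by simp
next
  case (All \<phi>)
  have "forced \<phi> w (case_nat x e) = forced \<phi> w (case_nat x e')" for w x
    by (rule All.IH) (use All.prems in \<open>auto split: nat.split\<close>)
  then show ?case by simp
next
  case (Ex \<phi>)
  have "forced \<phi> w (case_nat x e) = forced \<phi> w (case_nat x e')" for w x
    by (rule Ex.IH) (use Ex.prems in \<open>auto split: nat.split\<close>)
  then show ?case by simp
qed simp_all

text \<open>The assignment must stay in \<open>D v\<close> because \<open>AllE\<close> and
  \<open>ExI\<close> instantiate at an arbitrary variable, whose value then has to belong to the
  domain. \<open>ImplI\<close> and \<open>AllI\<close> move to a later node, where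
  \<open>forced_mono\<close> preserves the hypotheses.\<close>

lemma soundness:
  "\<Gamma> \<turnstile> \<phi> \<Longrightarrow> v \<in> K \<Longrightarrow> range e \<subseteq> D v \<Longrightarrow> \<forall>\<gamma>\<in>\<Gamma>. forced \<gamma> v e \<Longrightarrow> forced \<phi> v e"
proof (induction arbitrary: v e rule: proves.induct)
  case (DisjE \<Gamma> \<phi> \<psi> \<chi>)
  then show ?case by (metis forced.simps(5) insert_iff)
next
  case (ImplI \<phi> \<Gamma> \<psi>)
  show ?case unfolding forced.simps
  proof (intro ballI impI)
    fix w assume w: "w \<in> K" "(v, w) \<in> R" "forced \<phi> w e"
    then have "\<forall>\<gamma>\<in>\<Gamma>. forced \<gamma> w e" using ImplI.prems forced_mono by blast
    moreover have "range e \<subseteq> D w" using ImplI.prems w D_mono by blast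
    ultimately show "forced \<psi> w e" using ImplI.IH[of w e] w by auto
  qed
next
  case (ImplE \<Gamma> \<phi> \<psi>)
  then show ?case by (simp add: R_refl)
next
  case (AllI \<Gamma> \<phi>)
  show ?case unfolding forced.simps
  proof (intro ballI impI)
    fix w x assume w: "w \<in> K" "(v, w) \<in> R" "x \<in> D w"
    then have "\<forall>\<gamma>\<in>\<Gamma>. forced \<gamma> w e" using AllI.prems forced_mono by blast
    moreover have "range e \<subseteq> D w" using AllI.prems w D_mono by blast
    ultimately show "forced \<phi> w (case_nat x e)"
      using AllI.IH[of w "case_nat x e"] w by (auto simp: forced_shift0)
  qed
next
  case (AllE \<Gamma> \<phi> t)
  then have "e t \<in> D v" by auto
  with AllE show ?case by (simp add: forced_inst R_refl)
next
  case (ExI \<Gamma> t \<phi>)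
  then have "e t \<in> D v" by auto
  with ExI show ?case by (auto simp: forced_inst)
next
  case (ExE \<Gamma> \<phi> \<psi>)
  have "\<exists>x\<in>D v. forced \<phi> v (case_nat x e)"
    using ExE.IH(1)[OF ExE.prems] by simp
  then obtain x where x: "x \<in> D v" "forced \<phi> v (case_nat x e)" by blast
  have "\<forall>\<gamma>\<in>insert \<phi> (shift 0 ` \<Gamma>). forced \<gamma> v (case_nat x e)"
    using x ExE.prems by (auto simp: forced_shift0)
  then have "forced (shift 0 \<psi>) v (case_nat x e)"
    using ExE.IH(2)[of v "case_nat x e"] ExE.prems x by simp
  then show ?case by (simp add: forced_shift0)
next
  case (EqE \<Gamma> s t \<phi>)
  show ?case
    using EqE.IH(1)[OF EqE.prems] EqE.IH(2)[OF EqE.prems] by (simp add: forced_inst)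
qed auto

end

lemma kripke_point: "kripke {()} {((), ())} (\<lambda>_. M)"
  by unfold_locales auto

text \<open>Makes the lemmas on forcing available for classical truth in a single set.\<close>

lemma sat_conv_forced: "sat M \<phi> e \<longleftrightarrow> kripke.forced {()} {((), ())} (\<lambda>_. M) \<phi> () e"
  by (induction \<phi> arbitrary: e) (simp_all add: kripke.forced.simps[OF kripke_point])

lemma sat_ren: "sat M (ren r \<phi>) e \<longleftrightarrow> sat M \<phi> (\<lambda>i. e (r i))"
  unfolding sat_conv_forced by (rule kripke.forced_ren[OF kripke_point])

lemma sat_cong_fv: "(\<And>i. i \<in> fv \<phi> \<Longrightarrow> e i = e' i) \<Longrightarrow> sat M \<phi> e \<longleftrightarrow> sat M \<phi> e'"
  unfolding sat_conv_forced by (rule kripke.forced_cong_fv[OF kripke_point])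

lemma sat_soundness:
  "\<Gamma> \<turnstile> \<phi> \<Longrightarrow> range e \<subseteq> M \<Longrightarrow> \<forall>\<gamma>\<in>\<Gamma>. sat M \<gamma> e \<Longrightarrow> sat M \<phi> e"
  unfolding sat_conv_forced by (rule kripke.soundness[OF kripke_point]) auto

section \<open>Hereditarily countable sets\<close>

definition helts :: "hc \<Rightarrow> hc set" where
  "helts x = rcset (elts x)"

text \<open>Meaningful for countable \<open>A\<close> only, since \<open>acset\<close> is the
  abstraction function of countable sets.\<close>

definition hset :: "hc set \<Rightarrow> hc" where
  "hset A = HC (acset A)"

lemma hmem_iff: "hmem x y \<longleftrightarrow> x \<in> helts y"
  unfolding hmem_def helts_def by (rule cin.rep_eq)

lemma countable_helts [simp, intro]: "countable (helts x)"
  by (simp add: helts_def)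

lemma helts_hset [simp]: "countable A \<Longrightarrow> helts (hset A) = A"
  unfolding helts_def hset_def hc.sel by (rule acset_inverse) simp

lemma helts_inject: "helts x = helts y \<longleftrightarrow> x = y"
  unfolding helts_def using hc.expand[of x y] rcset_inject[of "elts x" "elts y"] by auto

lemma hc_eqI: "(\<And>z. z \<in> helts x \<longleftrightarrow> z \<in> helts y) \<Longrightarrow> x = y"
  using helts_inject[of x y] by blast

text \<open>Well-foundedness of membership is the datatype induction for \<open>HC\<close>, which
  nests \<open>hc\<close> inside countable sets.\<close>

lemma hc_induct [case_names step]:
  assumes "\<And>x. (\<And>y. y \<in> helts x \<Longrightarrow> P y) \<Longrightarrow> P x"
  shows "P x"
proof (induction x)
  case (HC A)
  show ?case
  proof (rule assms)
    fix y assume "y \<in> helts (HC A)"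
    then have "y \<in> rcset A" by (simp add: helts_def)
    then show "P y" by (rule HC)
  qed
qed

lemma helts_irrefl: "x \<notin> helts x"
proof (induction x rule: hc_induct)
  case (step x)
  show ?case
  proof
    assume "x \<in> helts x"
    with step[OF this] show False by contradiction
  qed
qed

definition hempty :: hc where
  "hempty = hset {}"

lemma helts_hempty [simp]: "helts hempty = {}"
  by (simp add: hempty_def)

definition hpair :: "hc \<Rightarrow> hc \<Rightarrow> hc" where
  "hpair x y = hset {hset {x}, hset {x, y}}"

lemma hset_inject: "countable A \<Longrightarrow> countable B \<Longrightarrow> hset A = hset B \<longleftrightarrow> A = B"
proof -
  assume "countable A" "countable B"
  then have "helts (hset A) = A" "helts (hset B) = B" by simp_all
  then show ?thesis by (metis (no_types))
qed

lemma hpair_inject [simp]: "hpair x y = hpair x' y' \<longleftrightarrow> x = x' \<and> y = y'"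
proof
  assume "hpair x y = hpair x' y'"
  then have "{hset {x}, hset {x, y}} = {hset {x'}, hset {x', y'}}"
    by (simp add: hpair_def hset_inject)
  then consider "hset {x} = hset {x'}" "hset {x, y} = hset {x', y'}"
    | "hset {x} = hset {x', y'}" "hset {x, y} = hset {x'}"
    by (auto simp: doubleton_eq_iff)
  then show "x = x' \<and> y = y'"
    by cases (auto simp: hset_inject doubleton_eq_iff)
qed simp

lemma hpair_neq_hempty [simp]: "hpair x y \<noteq> hempty" "hempty \<noteq> hpair x y"
  by (simp_all add: hpair_def hempty_def hset_inject)

definition htrans :: "hc set \<Rightarrow> bool" where
  "htrans M \<longleftrightarrow> (\<forall>x\<in>M. helts x \<subseteq> M)"

section \<open>Definability by bounded formulas\<close>

text \<open>The formula is hidden behind the predicate that it defines in the full universe.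
  Boundedness of a long condition is then proved by closure rules applied to its HOL statement,
  without ever writing down the formula.\<close>

definition dfn :: "((nat \<Rightarrow> hc) \<Rightarrow> bool) \<Rightarrow> bool" where
  "dfn P \<longleftrightarrow> (\<exists>\<phi>. delta0 \<phi> \<and> (\<forall>e. sat UNIV \<phi> e \<longleftrightarrow> P e))"

named_theorems dfn_intros

lemma dfn_Mem [dfn_intros]: "dfn (\<lambda>e. e i \<in> helts (e j))"
  unfolding dfn_def by (rule exI[of _ "Mem i j"]) (simp add: hmem_iff delta0.intros)

lemma dfn_Eq [dfn_intros]: "dfn (\<lambda>e. e i = e j)"
  unfolding dfn_def by (rule exI[of _ "Eq i j"]) (simp add: delta0.intros)

lemma dfn_conj [dfn_intros]: "dfn P \<Longrightarrow> dfn Q \<Longrightarrow> dfn (\<lambda>e. P e \<and> Q e)"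
proof -
  assume "dfn P" "dfn Q"
  then obtain \<phi> \<psi> where "delta0 \<phi>" "\<And>e. sat UNIV \<phi> e \<longleftrightarrow> P e" "delta0 \<psi>" "\<And>e. sat UNIV \<psi> e \<longleftrightarrow> Q e"
    unfolding dfn_def by blast
  then show ?thesis unfolding dfn_def by (intro exI[of _ "Conj \<phi> \<psi>"]) (simp add: delta0.intros)
qed

lemma dfn_disj [dfn_intros]: "dfn P \<Longrightarrow> dfn Q \<Longrightarrow> dfn (\<lambda>e. P e \<or> Q e)"
proof -
  assume "dfn P" "dfn Q"
  then obtain \<phi> \<psi> where "delta0 \<phi>" "\<And>e. sat UNIV \<phi> e \<longleftrightarrow> P e" "delta0 \<psi>" "\<And>e. sat UNIV \<psi> e \<longleftrightarrow> Q e"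
    unfolding dfn_def by blast
  then show ?thesis unfolding dfn_def by (intro exI[of _ "Disj \<phi> \<psi>"]) (simp add: delta0.intros)
qed

lemma dfn_impl [dfn_intros]: "dfn P \<Longrightarrow> dfn Q \<Longrightarrow> dfn (\<lambda>e. P e \<longrightarrow> Q e)"
proof -
  assume "dfn P" "dfn Q"
  then obtain \<phi> \<psi> where "delta0 \<phi>" "\<And>e. sat UNIV \<phi> e \<longleftrightarrow> P e" "delta0 \<psi>" "\<And>e. sat UNIV \<psi> e \<longleftrightarrow> Q e"
    unfolding dfn_def by blast
  then show ?thesis unfolding dfn_def by (intro exI[of _ "Impl \<phi> \<psi>"]) (simp add: delta0.intros)
qed

lemma dfn_False [dfn_intros]: "dfn (\<lambda>e. False)"
  unfolding dfn_def by (rule exI[of _ Fls]) (simp add: delta0.intros)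

lemma dfn_True [dfn_intros]: "dfn (\<lambda>e. True)"
  using dfn_impl[OF dfn_False dfn_False] by simp

lemma dfn_not [dfn_intros]: "dfn P \<Longrightarrow> dfn (\<lambda>e. \<not> P e)"
  using dfn_impl[OF _ dfn_False] by simp

lemma dfn_iff [dfn_intros]: "dfn P \<Longrightarrow> dfn Q \<Longrightarrow> dfn (\<lambda>e. P e \<longleftrightarrow> Q e)"
  using dfn_conj[OF dfn_impl[of P Q] dfn_impl[of Q P]] by (simp add: iff_conv_conj_imp)

text \<open>The premise is the body in de Bruijn form: below the new binder the bound variable is
  \<open>e 0\<close> and the old context is the shifted assignment.\<close>

lemma dfn_ball [dfn_intros]:
  assumes "dfn (\<lambda>e. P (e 0) (\<lambda>i. e (Suc i)))"
  shows "dfn (\<lambda>e. \<forall>x\<in>helts (e k). P x e)"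
proof -
  obtain \<phi> where "delta0 \<phi>" "\<And>e. sat UNIV \<phi> e \<longleftrightarrow> P (e 0) (\<lambda>i. e (Suc i))"
    using assms unfolding dfn_def by auto
  then show ?thesis unfolding dfn_def
    by (intro exI[of _ "BAll k \<phi>"]) (auto simp: BAll_def hmem_iff intro: delta0.intros(7)[unfolded BAll_def])
qed

lemma dfn_bex [dfn_intros]:
  assumes "dfn (\<lambda>e. P (e 0) (\<lambda>i. e (Suc i)))"
  shows "dfn (\<lambda>e. \<exists>x\<in>helts (e k). P x e)"
proof -
  obtain \<phi> where "delta0 \<phi>" "\<And>e. sat UNIV \<phi> e \<longleftrightarrow> P (e 0) (\<lambda>i. e (Suc i))"
    using assms unfolding dfn_def by auto
  then show ?thesis unfolding dfn_def
    by (intro exI[of _ "BEx k \<phi>"]) (auto simp: BEx_def hmem_iff intro: delta0.intros(8)[unfolded BEx_def])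
qed

lemma delta0_ren: "delta0 \<phi> \<Longrightarrow> delta0 (ren r \<phi>)"
proof (induction arbitrary: r rule: delta0.induct)
  case (7 \<phi> a)
  have "ren r (BAll a \<phi>) = BAll (r a) (ren (case_nat 0 (\<lambda>i. Suc (r i))) \<phi>)"
    by (simp add: BAll_def)
  then show ?case using 7 by (simp add: delta0.intros)
next
  case (8 \<phi> a)
  have "ren r (BEx a \<phi>) = BEx (r a) (ren (case_nat 0 (\<lambda>i. Suc (r i))) \<phi>)"
    by (simp add: BEx_def)
  then show ?case using 8 by (simp add: delta0.intros)
qed (auto intro: delta0.intros)

lemma dfn_sat_UNIV: "delta0 \<phi> \<Longrightarrow> dfn (\<lambda>e. sat UNIV \<phi> (\<lambda>i. e (r i)))"
  unfolding dfn_def by (rule exI[of _ "ren r \<phi>"]) (simp add: delta0_ren sat_ren)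

text \<open>Relativizing to the set \<open>e k\<close> bounds every quantifier, so truth of an
  arbitrary formula in a set is a bounded property of that set. The induction needs \<open>k\<close>
  and \<open>r\<close> arbitrary, since both shift below a quantifier.\<close>

lemma dfn_relativized [dfn_intros]: "dfn (\<lambda>e. sat (helts (e k)) \<phi> (\<lambda>i. e (r i)))"
proof (induction \<phi> arbitrary: k r)
  case (All \<phi>)
  have *: "(\<lambda>i. case i of 0 \<Rightarrow> e 0 | Suc i \<Rightarrow> e (Suc (r i))) = (\<lambda>i. e (case_nat 0 (\<lambda>i. Suc (r i)) i))"
    for e :: "nat \<Rightarrow> hc" by (rule ext) (simp split: nat.split)
  show ?case unfolding sat.simps by (rule dfn_ball) (simp only: * All)
next
  case (Ex \<phi>)
  have *: "(\<lambda>i. case i of 0 \<Rightarrow> e 0 | Suc i \<Rightarrow> e (Suc (r i))) = (\<lambda>i. e (case_nat 0 (\<lambda>i. Suc (r i)) i))"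
    for e :: "nat \<Rightarrow> hc" by (rule ext) (simp split: nat.split)
  show ?case unfolding sat.simps by (rule dfn_bex) (simp only: * Ex)
qed (simp_all add: hmem_iff dfn_intros)

definition is_hpair :: "hc \<Rightarrow> hc \<Rightarrow> hc \<Rightarrow> bool" where
  "is_hpair p x y \<longleftrightarrow> p = hpair x y"

text \<open>Spells out the Kuratowski pair with quantifiers bounded by \<open>p\<close> and its
  members, the form to which the closure rules for \<open>dfn\<close> apply.\<close>

lemma is_hpair_iff:
  "is_hpair p x y \<longleftrightarrow>
    (\<exists>u\<in>helts p. x \<in> helts u \<and> (\<forall>z\<in>helts u. z = x)) \<and>
    (\<exists>u\<in>helts p. x \<in> helts u \<and> y \<in> helts u \<and> (\<forall>z\<in>helts u. z = x \<or> z = y)) \<and>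
    (\<forall>u\<in>helts p. x \<in> helts u \<and> (\<forall>z\<in>helts u. z = x) \<or>
       x \<in> helts u \<and> y \<in> helts u \<and> (\<forall>z\<in>helts u. z = x \<or> z = y))"
proof -
  have a: "u = hset {x} \<longleftrightarrow> x \<in> helts u \<and> (\<forall>z\<in>helts u. z = x)" for u
    by (auto intro!: hc_eqI)
  have b: "u = hset {x, y} \<longleftrightarrow> x \<in> helts u \<and> y \<in> helts u \<and> (\<forall>z\<in>helts u. z = x \<or> z = y)" for u
    by (auto intro!: hc_eqI)
  have "is_hpair p x y \<longleftrightarrow> helts p = {hset {x}, hset {x, y}}"
    unfolding is_hpair_def hpair_def helts_inject[symmetric] by simp
  also have "\<dots> \<longleftrightarrow> (\<exists>u\<in>helts p. u = hset {x}) \<and> (\<exists>u\<in>helts p. u = hset {x, y}) \<and>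
      (\<forall>u\<in>helts p. u = hset {x} \<or> u = hset {x, y})"
    by blast
  finally show ?thesis unfolding a b .
qed

lemma dfn_is_hpair [dfn_intros]: "dfn (\<lambda>e. is_hpair (e i) (e j) (e k))"
  unfolding is_hpair_iff by (intro dfn_intros)

lemma sat_delta0_trans:
  "delta0 \<phi> \<Longrightarrow> htrans M \<Longrightarrow> range e \<subseteq> M \<Longrightarrow> sat M \<phi> e \<longleftrightarrow> sat UNIV \<phi> e"
proof (induction arbitrary: e rule: delta0.induct)
  case (7 \<phi> a)
  have m: "x \<in> M" if "x \<in> helts (e a)" for x
    using 7 that unfolding htrans_def by (meson range_subsetD subsetD)
  have "sat M \<phi> (case_nat x e) = sat UNIV \<phi> (case_nat x e)" if "x \<in> M" for x
    using 7 that by simp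
  then show ?case using m by (auto simp: BAll_def hmem_iff)
next
  case (8 \<phi> a)
  have m: "x \<in> M" if "x \<in> helts (e a)" for x
    using 8 that unfolding htrans_def by (meson range_subsetD subsetD)
  have "sat M \<phi> (case_nat x e) = sat UNIV \<phi> (case_nat x e)" if "x \<in> M" for x
    using 8 that by simp
  then show ?case using m by (auto simp: BEx_def hmem_iff)
qed auto

section \<open>Admissible sets\<close>

lemma sat_Iff [simp]: "sat M (Iff \<phi> \<psi>) e \<longleftrightarrow> (sat M \<phi> e \<longleftrightarrow> sat M \<psi> e)"
  by (auto simp: Iff_def)

definition hsep :: "hc \<Rightarrow> (hc \<Rightarrow> bool) \<Rightarrow> hc" where
  "hsep a P = hset {x \<in> helts a. P x}"

lemma helts_hsep [simp]: "helts (hsep a P) = {x \<in> helts a. P x}"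
  unfolding hsep_def by (rule helts_hset) (rule countable_subset[OF _ countable_helts[of a]], blast)

definition hunion :: "hc \<Rightarrow> hc" where
  "hunion a = hset (\<Union> (helts ` helts a))"

lemma helts_hunion [simp]: "helts (hunion a) = \<Union> (helts ` helts a)"
  unfolding hunion_def by (rule helts_hset) (intro countable_UN countable_helts)

text \<open>This condition and the next refer to truth in the full universe; for transitive
  \<open>N\<close> it agrees with truth in \<open>N\<close> by
  \<open>sat_delta0_trans\<close>.\<close>

definition separating :: "hc set \<Rightarrow> bool" where
  "separating N \<longleftrightarrow> (\<forall>P e a. dfn P \<longrightarrow> range e \<subseteq> N \<longrightarrow> a \<in> N \<longrightarrow> hsep a (\<lambda>x. P (case_nat x e)) \<in> N)"

definition collecting :: "hc set \<Rightarrow> bool" where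
  "collecting N \<longleftrightarrow> (\<forall>P e a. dfn P \<longrightarrow> range e \<subseteq> N \<longrightarrow> a \<in> N \<longrightarrow>
    (\<forall>x\<in>helts a. \<exists>y\<in>N. P (case_nat y (case_nat x e))) \<longrightarrow>
    (\<exists>b\<in>N. \<forall>x\<in>helts a. \<exists>y\<in>helts b. P (case_nat y (case_nat x e))))"

text \<open>What a domain must provide. Extensionality will come from transitivity and set induction
  from well-foundedness of \<open>hc\<close>.\<close>

definition adm :: "hc set \<Rightarrow> bool" where
  "adm N \<longleftrightarrow> htrans N \<and> separating N \<and> collecting N
    \<and> (\<forall>e. sat N empty_ax e \<and> sat N pairing_ax e \<and> sat N union_ax e \<and> sat N infinity_ax e
        \<and> sat N choice_ax e)"

lemma adm_trans: "adm N \<Longrightarrow> x \<in> helts y \<Longrightarrow> y \<in> N \<Longrightarrow> x \<in> N"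
  unfolding adm_def htrans_def by blast

lemma adm_hsep: "adm N \<Longrightarrow> dfn P \<Longrightarrow> range e \<subseteq> N \<Longrightarrow> a \<in> N \<Longrightarrow> hsep a (\<lambda>x. P (case_nat x e)) \<in> N"
  unfolding adm_def separating_def by simp

lemma adm_collection:
  assumes "adm N" "dfn P" "range e \<subseteq> N" "a \<in> N"
    "\<And>x. x \<in> helts a \<Longrightarrow> \<exists>y\<in>N. P (case_nat y (case_nat x e))"
  obtains b where "b \<in> N" "\<And>x. x \<in> helts a \<Longrightarrow> \<exists>y\<in>helts b. P (case_nat y (case_nat x e))"
proof -
  have "collecting N" using assms(1) by (simp add: adm_def)
  note this[unfolded collecting_def, rule_format, OF assms(2-5)]
  then show ?thesis using that by blast
qed

text \<open>Here and in the next lemmas the witness found in \<open>N\<close> is identified with the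
  true set by extensionality, because transitivity puts all of its elements into
  \<open>N\<close>.\<close>

lemma adm_hempty: "adm N \<Longrightarrow> hempty \<in> N"
proof -
  assume a: "adm N"
  then have "sat N empty_ax (\<lambda>_. hempty)" by (simp add: adm_def)
  then obtain x where x: "x \<in> N" "\<And>y. y \<in> N \<Longrightarrow> y \<notin> helts x"
    by (auto simp: empty_ax_def is_empty_def BAll_def hmem_iff)
  have "x = hempty"
    by (rule hc_eqI) (use x adm_trans[OF a] in auto)
  with x show ?thesis by simp
qed

lemma adm_upair:
  assumes a: "adm N" and "x \<in> N" "y \<in> N"
  shows "hset {x, y} \<in> N"
proof -
  have "sat N pairing_ax (\<lambda>_. hempty)" using a by (simp add: adm_def)
  then have "\<forall>x\<in>N. \<forall>y\<in>N. \<exists>z\<in>N. \<forall>u\<in>N. u \<in> helts z \<longleftrightarrow> u = x \<or> u = y"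
    by (simp add: pairing_ax_def hmem_iff)
  then obtain z where z: "z \<in> N" "\<forall>u\<in>N. u \<in> helts z \<longleftrightarrow> u = x \<or> u = y"
    using assms by blast
  have "z = hset {x, y}"
    by (rule hc_eqI) (use z adm_trans[OF a] assms in auto)
  with z show ?thesis by simp
qed

lemma adm_singleton: "adm N \<Longrightarrow> x \<in> N \<Longrightarrow> hset {x} \<in> N"
  using adm_upair[of N x x] by simp

lemma adm_hunion:
  assumes a: "adm N" and "x \<in> N"
  shows "hunion x \<in> N"
proof -
  have "sat N union_ax (\<lambda>_. hempty)" using a by (simp add: adm_def)
  then have "\<forall>x\<in>N. \<exists>z\<in>N. \<forall>u\<in>N. u \<in> helts z \<longleftrightarrow> (\<exists>w\<in>N. w \<in> helts x \<and> u \<in> helts w)"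
    by (simp add: union_ax_def hmem_iff)
  then obtain z where z: "z \<in> N" "\<forall>u\<in>N. u \<in> helts z \<longleftrightarrow> (\<exists>w\<in>N. w \<in> helts x \<and> u \<in> helts w)"
    using assms by blast
  have "z = hunion x"
    by (rule hc_eqI) (use z adm_trans[OF a] assms in \<open>simp; blast\<close>)
  with z show ?thesis by simp
qed

section \<open>Set-theoretic notions in the true universe\<close>

lemma case_nat_shift1 [simp]:
  "(\<lambda>i. case_nat x (case_nat y e) (if i = 0 then i else Suc i)) = case_nat x e"
  by (rule ext) (auto split: nat.split)

lemma case_nat_shift2 [simp]:
  "(\<lambda>i. case_nat x (case_nat y (case_nat z e)) (if i < 2 then i else Suc i)) = case_nat x (case_nat y e)"
  by (rule ext) (auto split: nat.split)

lemma case_nat_shift3 [simp]: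
  "(\<lambda>i. case_nat x (case_nat y (case_nat z (case_nat u e))) (if i < 3 then i else Suc i))
    = case_nat x (case_nat y (case_nat z e))"
  by (rule ext) (auto split: nat.split)

lemma case_nat_swap [simp]:
  "(\<lambda>i. case_nat x (case_nat y e) (if i = Suc 0 then 0 else (id(0 := Suc 0)) i)) = case_nat y (case_nat x e)"
  by (rule ext) (auto split: nat.split)

lemma sat_shift1: "sat M (shift 1 \<phi>) (case_nat x (case_nat y e)) \<longleftrightarrow> sat M \<phi> (case_nat x e)"
  by (simp add: shift_def sat_ren)

lemma sat_shift2:
  "sat M (shift 2 \<phi>) (case_nat x (case_nat y (case_nat z e))) \<longleftrightarrow> sat M \<phi> (case_nat x (case_nat y e))"
  by (simp add: shift_def sat_ren)

lemma sat_shift3: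
  "sat M (shift 3 \<phi>) (case_nat x (case_nat y (case_nat z (case_nat u e))))
    \<longleftrightarrow> sat M \<phi> (case_nat x (case_nat y (case_nat z e)))"
  by (simp add: shift_def sat_ren)

lemma sat_swap: "sat M (swap \<phi>) (case_nat x (case_nat y e)) \<longleftrightarrow> sat M \<phi> (case_nat y (case_nat x e))"
  by (simp add: swap_def sat_ren)

lemma sat_Neg [simp]: "sat M (Neg \<phi>) e \<longleftrightarrow> \<not> sat M \<phi> e"
  by (auto simp: Neg_def)

lemma sat_BAll [simp]: "sat UNIV (BAll a \<phi>) e \<longleftrightarrow> (\<forall>x\<in>helts (e a). sat UNIV \<phi> (case_nat x e))"
  by (auto simp: BAll_def hmem_iff)

lemma sat_BEx [simp]: "sat UNIV (BEx a \<phi>) e \<longleftrightarrow> (\<exists>x\<in>helts (e a). sat UNIV \<phi> (case_nat x e))"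
  by (auto simp: BEx_def hmem_iff)

lemma sat_is_empty [simp]: "sat UNIV (is_empty x) e \<longleftrightarrow> e x = hempty"
  by (auto simp: is_empty_def intro: hc_eqI)

lemma sat_is_one [simp]: "sat UNIV (is_one x) e \<longleftrightarrow> e x = hset {hempty}"
  by (auto simp: is_one_def hmem_iff intro: hc_eqI)

lemma sat_is_succ [simp]:
  "sat UNIV (is_succ y z) e \<longleftrightarrow> e y = hset (insert (e z) (helts (e z)))"
  by (auto simp: is_succ_def hmem_iff intro: hc_eqI)

lemma sat_is_upair [simp]: "sat UNIV (is_upair p a b) e \<longleftrightarrow> e p = hset {e a, e b}"
  by (auto simp: is_upair_def hmem_iff intro: hc_eqI)

lemma sat_is_pair [simp]: "sat UNIV (is_pair p a b) e \<longleftrightarrow> e p = hpair (e a) (e b)"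
  by (simp add: is_pair_def hpair_def numeral_2_eq_2)

lemma sat_Ex1 [simp]: "sat UNIV (Ex1 \<phi>) e \<longleftrightarrow> (\<exists>!x. sat UNIV \<phi> (case_nat x e))"
  unfolding Ex1_def sat.simps sat_shift1 by auto

lemma sat_pair_in [simp]: "sat UNIV (pair_in n i f) e \<longleftrightarrow> hpair (e n) (e i) \<in> helts (e f)"
  by (auto simp: pair_in_def)

section \<open>Kripke models over admissible sets\<close>

locale kripke_adm = kripke +
  assumes D_adm: "v \<in> K \<Longrightarrow> adm (D v)"
begin

lemma D_trans: "v \<in> K \<Longrightarrow> x \<in> helts y \<Longrightarrow> y \<in> D v \<Longrightarrow> x \<in> D v"
  using D_adm adm_trans by blast

lemma D_helts: "v \<in> K \<Longrightarrow> range e \<subseteq> D v \<Longrightarrow> x \<in> helts (e i) \<Longrightarrow> x \<in> D v"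
  by (rule D_trans) auto

lemma D_range: "range e \<subseteq> D v \<Longrightarrow> e i \<in> D v"
  by auto

lemma D_singleton: "v \<in> K \<Longrightarrow> range e \<subseteq> D v \<Longrightarrow> hset {e i} \<in> D v"
  by (rule adm_singleton[OF D_adm]) auto

lemma D_upair: "v \<in> K \<Longrightarrow> range e \<subseteq> D v \<Longrightarrow> hset {e i, e j} \<in> D v"
  by (rule adm_upair[OF D_adm]) auto

lemma range_D_mono: "range e \<subseteq> D v \<Longrightarrow> v \<in> K \<Longrightarrow> w \<in> K \<Longrightarrow> (v, w) \<in> R \<Longrightarrow> range e \<subseteq> D w"
  using D_mono by blast

text \<open>Forcing of such a formula neither depends on the node nor differs from classical truth,
  so what remains to be shown about it takes place in the universe.\<close>

definition absolute :: "fm \<Rightarrow> bool" where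
  "absolute \<phi> \<longleftrightarrow> (\<forall>v\<in>K. \<forall>e. range e \<subseteq> D v \<longrightarrow> (forced \<phi> v e \<longleftrightarrow> sat UNIV \<phi> e))"

lemma absoluteD: "absolute \<phi> \<Longrightarrow> v \<in> K \<Longrightarrow> range e \<subseteq> D v \<Longrightarrow> forced \<phi> v e \<longleftrightarrow> sat UNIV \<phi> e"
  by (simp add: absolute_def)

named_theorems abs_intros

lemma absolute_atomic [abs_intros]: "absolute (Mem i j)" "absolute (Eq i j)" "absolute Fls"
  by (simp_all add: absolute_def)

lemma absolute_Conj [abs_intros]: "absolute \<phi> \<Longrightarrow> absolute \<psi> \<Longrightarrow> absolute (Conj \<phi> \<psi>)"
  by (simp add: absolute_def)

lemma absolute_Disj [abs_intros]: "absolute \<phi> \<Longrightarrow> absolute \<psi> \<Longrightarrow> absolute (Disj \<phi> \<psi>)"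
  by (simp add: absolute_def)

text \<open>At each later node both sides have the truth value they have in the universe, so the
  quantification over nodes collapses; reflexivity shows that it is not vacuous.\<close>

lemma absolute_Impl [abs_intros]:
  assumes "absolute \<phi>" "absolute \<psi>"
  shows "absolute (Impl \<phi> \<psi>)"
  unfolding absolute_def
proof (intro ballI allI impI)
  fix v and e :: "nat \<Rightarrow> hc" assume v: "v \<in> K" "range e \<subseteq> D v"
  have "forced \<phi> w e \<longleftrightarrow> sat UNIV \<phi> e" "forced \<psi> w e \<longleftrightarrow> sat UNIV \<psi> e"
    if "w \<in> K" "(v, w) \<in> R" for w
    using absoluteD[OF assms(1) that(1)] absoluteD[OF assms(2) that(1)]
      range_D_mono[OF v(2,1) that] by simp_all
  then have "forced (Impl \<phi> \<psi>) v e \<longleftrightarrow>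
      (\<forall>w\<in>K. (v, w) \<in> R \<longrightarrow> sat UNIV \<phi> e \<longrightarrow> sat UNIV \<psi> e)"
    by simp
  then show "forced (Impl \<phi> \<psi>) v e \<longleftrightarrow> sat UNIV (Impl \<phi> \<psi>) e"
    using v(1) R_refl[OF v(1)] by auto
qed

lemma absolute_Neg [abs_intros]: "absolute \<phi> \<Longrightarrow> absolute (Neg \<phi>)"
  unfolding Neg_def by (intro abs_intros)

lemma absolute_Iff [abs_intros]: "absolute \<phi> \<Longrightarrow> absolute \<psi> \<Longrightarrow> absolute (Iff \<phi> \<psi>)"
  unfolding Iff_def by (intro abs_intros)

text \<open>Premise \<open>out\<close> says that counterexamples in the universe already lie in the
  domain; for a bounded quantifier this is transitivity. The next lemma is the dual statement about
  witnesses.\<close>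

lemma absolute_All:
  assumes "absolute \<phi>"
    and out: "\<And>v e x. v \<in> K \<Longrightarrow> range e \<subseteq> D v \<Longrightarrow> x \<notin> D v \<Longrightarrow> sat UNIV \<phi> (case_nat x e)"
  shows "absolute (All \<phi>)"
  unfolding absolute_def
proof (intro ballI allI impI)
  fix v and e :: "nat \<Rightarrow> hc" assume v: "v \<in> K" "range e \<subseteq> D v"
  have *: "forced \<phi> w (case_nat x e) \<longleftrightarrow> sat UNIV \<phi> (case_nat x e)"
    if "w \<in> K" "(v, w) \<in> R" "x \<in> D w" for w x
    using absoluteD[OF assms(1) that(1), of "case_nat x e"] range_D_mono[OF v(2,1) that(1,2)] that(3)
    by simp
  have "sat UNIV \<phi> (case_nat x e)" if "\<forall>x\<in>D v. sat UNIV \<phi> (case_nat x e)" for x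
    using that out[OF v] by blast
  then show "forced (All \<phi>) v e \<longleftrightarrow> sat UNIV (All \<phi>) e"
    using * v R_refl by auto
qed

lemma absolute_Ex:
  assumes "absolute \<phi>"
    and "\<And>v e x. v \<in> K \<Longrightarrow> range e \<subseteq> D v \<Longrightarrow> sat UNIV \<phi> (case_nat x e) \<Longrightarrow> x \<in> D v"
  shows "absolute (Ex \<phi>)"
  unfolding absolute_def
proof (intro ballI allI impI)
  fix v and e :: "nat \<Rightarrow> hc" assume v: "v \<in> K" "range e \<subseteq> D v"
  have "forced \<phi> v (case_nat x e) \<longleftrightarrow> sat UNIV \<phi> (case_nat x e)" if "x \<in> D v" for x
    using that v assms(1) absoluteD[of \<phi> v "case_nat x e"] by simp
  then show "forced (Ex \<phi>) v e \<longleftrightarrow> sat UNIV (Ex \<phi>) e"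
    using assms(2)[OF v] by auto
qed

lemma absolute_BAll [abs_intros]: "absolute \<phi> \<Longrightarrow> absolute (BAll a \<phi>)"
  unfolding BAll_def
  by (intro absolute_All abs_intros) (auto simp: hmem_iff intro: D_helts)

lemma absolute_BEx [abs_intros]: "absolute \<phi> \<Longrightarrow> absolute (BEx a \<phi>)"
  unfolding BEx_def
  by (intro absolute_Ex abs_intros) (auto simp: hmem_iff intro: D_helts)

lemma absolute_delta0: "delta0 \<phi> \<Longrightarrow> absolute \<phi>"
  by (induction rule: delta0.induct) (auto intro: abs_intros)

lemma absolute_ren: "absolute \<phi> \<Longrightarrow> absolute (ren r \<phi>)"
  unfolding absolute_def forced_ren sat_ren by (auto simp: image_subset_iff)

lemma absolute_is_empty [abs_intros]: "absolute (is_empty x)"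
  unfolding is_empty_def by (intro abs_intros)

lemma absolute_is_one [abs_intros]: "absolute (is_one x)"
  unfolding is_one_def
  by (intro absolute_All abs_intros) (auto simp: hmem_iff adm_hempty[OF D_adm] dest: D_helts)

lemma absolute_is_succ [abs_intros]: "absolute (is_succ y z)"
  unfolding is_succ_def
  by (intro absolute_All abs_intros) (auto simp: hmem_iff dest: D_helts D_range)

lemma absolute_is_upair [abs_intros]: "absolute (is_upair p a b)"
  unfolding is_upair_def
  by (intro absolute_All abs_intros) (auto simp: hmem_iff dest: D_helts D_range)

lemma absolute_is_pair [abs_intros]: "absolute (is_pair p a b)"
  unfolding is_pair_def
  by (intro absolute_Ex abs_intros)
    (auto simp: numeral_2_eq_2 D_singleton D_upair)

lemma absolute_pair_in [abs_intros]: "absolute (pair_in n i f)"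
  unfolding pair_in_def by (intro abs_intros)

lemma absolute_is_omega [abs_intros]: "absolute (is_omega w)"
  unfolding is_omega_def by (intro abs_intros)

lemma absolute_Ex1:
  assumes "absolute \<phi>"
    and *: "\<And>v e x. v \<in> K \<Longrightarrow> range e \<subseteq> D v \<Longrightarrow> sat UNIV \<phi> (case_nat x e) \<Longrightarrow> x \<in> D v"
  shows "absolute (Ex1 \<phi>)"
  unfolding Ex1_def
proof (rule absolute_Ex[OF absolute_Conj[OF assms(1) absolute_All]])
  show "absolute (Impl (shift 1 \<phi>) (Eq 0 1))"
    unfolding shift_def by (intro abs_intros absolute_ren assms(1))
next
  fix v x and e :: "nat \<Rightarrow> hc" assume v: "v \<in> K" "range e \<subseteq> D v" "x \<notin> D v"
  \<comment> \<open>\<open>shift 1\<close> makes the antecedent ignore \<open>e 0\<close>, the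
    candidate for the unique witness. An \<open>x\<close> outside the domain therefore falsifies the
    antecedent.\<close>
  have e: "e = case_nat (e 0) (\<lambda>i. e (Suc i))" by (rule ext) (simp split: nat.split)
  have "range (\<lambda>i. e (Suc i)) \<subseteq> D v" using v by auto
  then have "\<not> sat UNIV \<phi> (case_nat x (\<lambda>i. e (Suc i)))" using * v by blast
  then show "sat UNIV (Impl (shift 1 \<phi>) (Eq 0 1)) (case_nat x e)"
    by (subst e) (simp only: sat.simps sat_shift1 simp_thms)
next
  fix v x and e :: "nat \<Rightarrow> hc" assume "v \<in> K" "range e \<subseteq> D v"
    "sat UNIV (Conj \<phi> (All (Impl (shift 1 \<phi>) (Eq 0 1)))) (case_nat x e)"
  then show "x \<in> D v" using * by auto
qed

end

section \<open>The axioms are forced\<close>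

context kripke_adm
begin

definition valid :: "fm \<Rightarrow> bool" where
  "valid \<phi> \<longleftrightarrow> (\<forall>v\<in>K. \<forall>e. range e \<subseteq> D v \<longrightarrow> forced \<phi> v e)"

lemma valid_All: "valid \<phi> \<Longrightarrow> valid (All \<phi>)"
  unfolding valid_def by (auto simp: range_D_mono)

lemma valid_Impl:
  "(\<And>v e. v \<in> K \<Longrightarrow> range e \<subseteq> D v \<Longrightarrow> forced \<phi> v e \<Longrightarrow> forced \<psi> v e) \<Longrightarrow> valid (Impl \<phi> \<psi>)"
  unfolding valid_def by (auto simp: range_D_mono)

lemma valid_absolute: "absolute \<phi> \<Longrightarrow> (\<And>e. sat UNIV \<phi> e) \<Longrightarrow> valid \<phi>"
  by (simp add: valid_def absolute_def)

lemma valid_closures: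
  assumes "\<And>\<phi>. \<phi> \<in> C \<Longrightarrow> valid \<phi>" "\<psi> \<in> closures C"
  shows "valid \<psi>"
proof -
  obtain n \<phi> where "\<psi> = (All ^^ n) \<phi>" "\<phi> \<in> C"
    using assms(2) by (auto simp: closures_def)
  moreover have "valid ((All ^^ n) \<phi>)" if "valid \<phi>" for n
    by (induction n) (simp_all add: that valid_All)
  ultimately show ?thesis using assms(1) by blast
qed

text \<open>Truth in the single set \<open>D v\<close> is forcing in the one-point model over it.
  Absoluteness there carries the axioms recorded in \<open>adm\<close> over to the universe, and
  absoluteness in the given model carries them on to forcing.\<close>

lemma sat_D_absolute:
  assumes "v \<in> K" "range e \<subseteq> D v"
    and "\<And>M. adm M \<Longrightarrow> kripke_adm.absolute {()} {((), ())} (\<lambda>_. M) \<phi>"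
  shows "sat (D v) \<phi> e \<longleftrightarrow> sat UNIV \<phi> e"
proof -
  interpret P: kripke_adm "{()}" "{((), ())}" "\<lambda>_. D v"
    by (intro kripke_adm.intro kripke_point) (unfold_locales, use assms D_adm in simp)
  show ?thesis
    unfolding sat_conv_forced[of "D v"]
    using P.absoluteD[OF assms(3)[OF D_adm[OF assms(1)]]] assms(2) by simp
qed

section \<open>Set existence axioms and extensionality\<close>

lemma valid_empty_ax: "valid empty_ax"
  unfolding valid_def
proof (intro ballI allI impI)
  fix v and e :: "nat \<Rightarrow> hc" assume v: "v \<in> K" "range e \<subseteq> D v"
  have "hempty \<in> D v" by (rule adm_hempty[OF D_adm[OF v(1)]])
  then show "forced empty_ax v e"
    unfolding empty_ax_def forced.simps
    by (intro bexI[of _ hempty]) (use v absoluteD[OF absolute_is_empty, of v] in simp_all)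
qed

lemma valid_Ex_absolute:
  assumes "absolute \<phi>"
    and "\<And>v e. v \<in> K \<Longrightarrow> range e \<subseteq> D v \<Longrightarrow> \<exists>x\<in>D v. sat UNIV \<phi> (case_nat x e)"
  shows "valid (Ex \<phi>)"
  unfolding valid_def
proof (intro ballI allI impI)
  fix v and e :: "nat \<Rightarrow> hc" assume v: "v \<in> K" "range e \<subseteq> D v"
  then obtain x where "x \<in> D v" "sat UNIV \<phi> (case_nat x e)" using assms(2) by blast
  then show "forced (Ex \<phi>) v e"
    using v absoluteD[OF assms(1), of v "case_nat x e"] by auto
qed

lemma valid_pairing_ax: "valid pairing_ax"
proof -
  have *: "pairing_ax = All (All (Ex (is_upair 0 2 1)))"
    by (simp add: pairing_ax_def is_upair_def numeral_2_eq_2 numeral_3_eq_3)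
  show ?thesis unfolding *
    by (intro valid_All valid_Ex_absolute abs_intros) (use D_upair in simp)
qed

lemma valid_union_ax: "valid union_ax"
  unfolding union_ax_def
proof (intro valid_All valid_Ex_absolute absolute_All absolute_Iff absolute_Ex abs_intros)
  show "x \<in> D v" if "v \<in> K" "range e \<subseteq> D v" "sat UNIV (Conj (Mem 0 3) (Mem 1 0)) (case_nat x e)"
    for v e x
    using that D_helts[of v e x 2] by (simp add: hmem_iff numeral_3_eq_3 numeral_2_eq_2)
next
  fix v x and e :: "nat \<Rightarrow> hc" assume v: "v \<in> K" "range e \<subseteq> D v" "x \<notin> D v"
  have "x \<notin> helts (e 0)" using D_helts[OF v(1,2)] v(3) by blast
  moreover have "x \<notin> helts z" if "z \<in> helts (e 1)" for z
    using D_helts[OF v(1,2) that] D_trans[OF v(1), of x z] v(3) by blast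
  ultimately show "sat UNIV (Iff (Mem 0 1) (Ex (Conj (Mem 0 3) (Mem 1 0)))) (case_nat x e)"
    by (auto simp: hmem_iff numeral_3_eq_3 numeral_2_eq_2)
next
  fix v and e :: "nat \<Rightarrow> hc" assume v: "v \<in> K" "range e \<subseteq> D v"
  then have "hunion (e 0) \<in> D v" by (intro adm_hunion[OF D_adm] D_range)
  then show "\<exists>x\<in>D v. sat UNIV (All (Iff (Mem 0 1) (Ex (Conj (Mem 0 3) (Mem 1 0))))) (case_nat x e)"
    by (intro bexI[of _ "hunion (e 0)"])
      (auto simp: hmem_iff numeral_3_eq_3 numeral_2_eq_2)
qed

lemma valid_extensionality_ax: "valid extensionality_ax"
  unfolding extensionality_ax_def
proof (intro valid_All valid_absolute absolute_Impl absolute_All abs_intros)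
  fix v x and e :: "nat \<Rightarrow> hc" assume v: "v \<in> K" "range e \<subseteq> D v" "x \<notin> D v"
  have "x \<notin> helts (e i)" for i using D_helts[OF v(1,2)] v(3) by blast
  then show "sat UNIV (Iff (Mem 0 2) (Mem 0 1)) (case_nat x e)"
    by (simp add: hmem_iff numeral_2_eq_2)
next
  fix e
  show "sat UNIV (Impl (All (Iff (Mem 0 2) (Mem 0 1))) (Eq 1 0)) e"
    by (auto simp: hmem_iff numeral_2_eq_2 intro: hc_eqI)
qed

lemma valid_infinity_ax: "valid infinity_ax"
  unfolding infinity_ax_def
proof (intro valid_Ex_absolute abs_intros)
  fix v and e :: "nat \<Rightarrow> hc" assume v: "v \<in> K" "range e \<subseteq> D v"
  have "sat (D v) infinity_ax e" using D_adm[OF v(1)] by (simp add: adm_def)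
  then obtain x where x: "x \<in> D v" "sat (D v) (is_omega 0) (case_nat x e)"
    by (auto simp: infinity_ax_def)
  have "kripke_adm {()} {((), ())} (\<lambda>_. M)" if "adm M" for M
    by (intro kripke_adm.intro kripke_point) (unfold_locales, use that in simp)
  then have "sat (D v) (is_omega 0) (case_nat x e) \<longleftrightarrow> sat UNIV (is_omega 0) (case_nat x e)"
    using v x kripke_adm.absolute_is_omega by (intro sat_D_absolute) (simp, simp, blast)
  with x show "\<exists>x\<in>D v. sat UNIV (is_omega 0) (case_nat x e)" by blast
qed

section \<open>Axiom schemes\<close>

lemma valid_set_induction: "valid (set_induction \<phi>)"
  unfolding set_induction_def
proof (rule valid_Impl)
  fix v and e :: "nat \<Rightarrow> hc"
  assume v: "v \<in> K" "range e \<subseteq> D v"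
    and step: "forced (All (Impl (BAll 0 (shift 1 \<phi>)) \<phi>)) v e"
  \<comment> \<open>Membership induction on \<open>x\<close> with the node kept arbitrary, because
    the bounded antecedent has to be forced at all later nodes.\<close>
  have "forced \<phi> w (case_nat x e)" if "w \<in> K" "(v, w) \<in> R" "x \<in> D w" for w x
    using that
  proof (induction x arbitrary: w rule: hc_induct)
    case (step x)
    have "forced (BAll 0 (shift 1 \<phi>)) w (case_nat x e)"
      unfolding BAll_def forced.simps hmem_iff
    proof (intro ballI impI)
      fix u y u' assume u: "u \<in> K" "(w, u) \<in> R" "y \<in> D u" "u' \<in> K" "(u, u') \<in> R"
        "case_nat y (case_nat x e) 0 \<in> helts (case_nat y (case_nat x e) (Suc 0))"
      then have "forced \<phi> u' (case_nat y e)"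
        using step.prems D_mono[of u u']
        by (intro step.IH) (auto intro: R_trans)
      then show "forced (shift 1 \<phi>) u' (case_nat y (case_nat x e))"
        by (simp add: shift_def forced_ren)
    qed
    then show ?case
      using \<open>forced (All (Impl (BAll 0 (shift 1 \<phi>)) \<phi>)) v e\<close> step.prems R_refl by auto
  qed
  then show "forced (All \<phi>) v e" by simp
qed

lemma dfn_delta0: "delta0 \<phi> \<Longrightarrow> dfn (sat UNIV \<phi>)"
  using dfn_sat_UNIV[of \<phi> "\<lambda>i. i"] by simp

lemma valid_separation:
  assumes "delta0 \<phi>"
  shows "valid (separation \<phi>)"
  unfolding separation_def
proof (intro valid_All valid_Ex_absolute absolute_All absolute_Iff absolute_Conj abs_intros)
  show "absolute (shift 1 \<phi>)"
    unfolding shift_def by (intro absolute_ren absolute_delta0 assms)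
next
  fix v x and e :: "nat \<Rightarrow> hc" assume v: "v \<in> K" "range e \<subseteq> D v" "x \<notin> D v"
  have "x \<notin> helts (e i)" for i using D_helts[OF v(1,2)] v(3) by blast
  then show "sat UNIV (Iff (Mem 0 1) (Conj (Mem 0 2) (shift 1 \<phi>))) (case_nat x e)"
    by (simp add: hmem_iff numeral_2_eq_2)
next
  fix v and e :: "nat \<Rightarrow> hc" assume v: "v \<in> K" "range e \<subseteq> D v"
  let ?y = "hsep (e 0) (\<lambda>x. sat UNIV \<phi> (case_nat x e))"
  have "?y \<in> D v"
    using v by (intro adm_hsep[OF D_adm] dfn_delta0 assms D_range)
  moreover have "sat UNIV (All (Iff (Mem 0 1) (Conj (Mem 0 2) (shift 1 \<phi>)))) (case_nat ?y e)"
    unfolding sat.simps sat_Iff sat_shift1 by (simp add: hmem_iff numeral_2_eq_2)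
  ultimately show "\<exists>y\<in>D v. sat UNIV (All (Iff (Mem 0 1) (Conj (Mem 0 2) (shift 1 \<phi>)))) (case_nat y e)"
    by blast
qed

lemma valid_strong_collection:
  assumes "delta0 \<phi>"
  shows "valid (strong_collection \<phi>)"
  unfolding strong_collection_def
proof (intro valid_All valid_Impl)
  fix v and e :: "nat \<Rightarrow> hc"
  assume v: "v \<in> K" "range e \<subseteq> D v" and *: "forced (BAll 0 (Ex \<phi>)) v e"
  note abs = absolute_delta0[OF assms]
  have "\<exists>y\<in>D v. sat UNIV \<phi> (case_nat y (case_nat x e))" if x: "x \<in> helts (e 0)" for x
  proof -
    have "x \<in> D v" by (rule D_helts[OF v x])
    then have "forced (Ex \<phi>) v (case_nat x e)"
      using * x v R_refl by (auto simp: BAll_def hmem_iff)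
    then show ?thesis
      using \<open>x \<in> D v\<close> v absoluteD[OF abs v(1)] by auto
  qed
  then obtain b where b: "b \<in> D v"
      "\<And>x. x \<in> helts (e 0) \<Longrightarrow> \<exists>y\<in>helts b. sat UNIV \<phi> (case_nat y (case_nat x e))"
    using adm_collection[OF D_adm[OF v(1)] dfn_delta0[OF assms] v(2) D_range[OF v(2), of 0]]
    by metis
  define b' where "b' = hsep b (\<lambda>y. \<exists>x\<in>helts (e 0). sat UNIV \<phi> (case_nat y (case_nat x e)))"
  \<comment> \<open>Below the quantifier over \<open>x\<close>, index 0 is \<open>x\<close> and
    index 1 is \<open>y\<close>, the reverse of the layout of \<open>\<phi>\<close>;
    \<open>?r\<close> exchanges them.\<close>
  let ?r = "case_nat (1::nat) (case_nat 0 (\<lambda>i. Suc (Suc i)))"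
  have r: "(\<lambda>i. case_nat x (case_nat y e) (?r i)) = case_nat y (case_nat x e)" for x y and e :: "nat \<Rightarrow> hc"
    by (rule ext) (simp split: nat.split)
  have "dfn (\<lambda>e. \<exists>x\<in>helts (e 1). sat UNIV \<phi> (\<lambda>i. case_nat x e (?r i)))"
  proof (rule dfn_bex)
    have "(case_nat (e 0) (\<lambda>i. e (Suc i))) = e" for e :: "nat \<Rightarrow> hc"
      by (rule ext) (simp split: nat.split)
    then show "dfn (\<lambda>e. sat UNIV \<phi> (\<lambda>i. case_nat (e 0) (\<lambda>i. e (Suc i)) (?r i)))"
      using dfn_sat_UNIV[OF assms, of ?r] by simp
  qed
  then have "dfn (\<lambda>e. \<exists>x\<in>helts (e (Suc 0)). sat UNIV \<phi> (\<lambda>i. case_nat x e (?r i)))" by simp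
  from adm_hsep[OF D_adm[OF v(1)] this v(2) b(1)] have "b' \<in> D v"
    unfolding b'_def by (simp add: r)
  let ?\<psi> = "Conj (BAll 1 (BEx 1 (shift 2 \<phi>))) (BAll 0 (BEx 2 (swap (shift 2 \<phi>))))"
  have "sat UNIV ?\<psi> (case_nat b' e)"
    unfolding sat.simps sat_BAll sat_BEx sat_shift2 sat_swap
    using b(2) by (simp add: b'_def numeral_2_eq_2) blast
  moreover have "absolute ?\<psi>"
    unfolding shift_def swap_def by (intro abs_intros absolute_ren abs)
  ultimately have "forced ?\<psi> v (case_nat b' e)"
    using v(2) \<open>b' \<in> D v\<close> absoluteD[OF \<open>absolute ?\<psi>\<close> v(1), of "case_nat b' e"]
    by (simp only: range_case_nat simp_thms)
  with \<open>b' \<in> D v\<close> show "forced (Ex ?\<psi>) v e"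
    unfolding forced.simps(8) by blast
qed

lemma valid_collection:
  assumes "delta0 \<phi>"
  shows "valid (collection \<phi>)"
  using valid_strong_collection[OF assms]
  unfolding collection_def strong_collection_def valid_def forced.simps by blast


lemma dfn_sat_two:
  assumes "delta0 \<psi>"
  shows "dfn (\<lambda>e. sat UNIV \<psi> (\<lambda>i. if i = 0 then e k else if i = 1 then e l else e (s i)))"
proof -
  have "(\<lambda>i. if i = 0 then e k else if i = 1 then e l else e (s i))
      = (\<lambda>i. e (if i = 0 then k else if i = 1 then l else s i))" for e :: "nat \<Rightarrow> hc"
    by auto
  then show ?thesis using dfn_sat_UNIV[OF assms] by simp
qed

text \<open>For each \<open>z\<close> there is a canonical candidate \<open>d z\<close>, the set of
  all \<open>y\<close> in \<open>e 0\<close> related to some \<open>x\<close> in \<open>e 1\<close>;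
  it works whenever the premise holds for \<open>z\<close>. Set-boundedness confines the relevant
  \<open>z\<close> to one set \<open>Z\<close>, and collection along \<open>Z\<close> gathers the
  sets \<open>d z\<close> into \<open>c\<close>.\<close>

lemma valid_subset_collection:
  assumes "delta0 \<psi>" "set_bounded 2 \<psi>"
  shows "valid (subset_collection \<psi>)"
proof -
  let ?P = "BAll 3 (BEx 3 (shift 3 \<psi>))"
  let ?Q = "BEx 1 (Conj (BAll 4 (BEx 1 (shift 2 (shift 3 \<psi>))))
    (BAll 0 (BEx 5 (swap (shift 2 (shift 3 \<psi>))))))"
  \<comment> \<open>The set \<open>c\<close> serves every \<open>z\<close> of the universe, not only
    those in \<open>D v\<close>. Hence it keeps working at later nodes, where the domain is
    larger.\<close>
  have sem: "\<exists>c\<in>D v. \<forall>z. sat UNIV (Impl ?P ?Q) (case_nat z (case_nat c e))"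
    if v: "v \<in> K" "range e \<subseteq> D v" for v and e :: "nat \<Rightarrow> hc"
  proof -
    note N = D_adm[OF v(1)]
    define \<Psi> where "\<Psi> y x z \<longleftrightarrow> sat UNIV \<psi> (case_nat y (case_nat x (case_nat z e)))" for y x z
    define d where "d z = hsep (e 0) (\<lambda>y. \<exists>x\<in>helts (e 1). \<Psi> y x z)" for z
    have P: "sat UNIV ?P (case_nat z (case_nat c e)) \<longleftrightarrow> (\<forall>x\<in>helts (e 1). \<exists>y\<in>helts (e 0). \<Psi> y x z)"
      for z c
      unfolding sat_BAll sat_BEx sat_shift3 \<Psi>_def by (simp add: numeral_3_eq_3)
    have sub: "sat UNIV (shift 2 (shift 3 \<psi>)) (case_nat y (case_nat x (case_nat u (case_nat z (case_nat c e)))))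
        \<longleftrightarrow> \<Psi> y x z" for y x u z c
      unfolding sat_shift2 sat_shift3 \<Psi>_def ..
    have Q: "sat UNIV ?Q (case_nat z (case_nat c e)) \<longleftrightarrow>
        (\<exists>u\<in>helts c. (\<forall>x\<in>helts (e 1). \<exists>y\<in>helts u. \<Psi> y x z) \<and> (\<forall>y\<in>helts u. \<exists>x\<in>helts (e 1). \<Psi> y x z))"
      for z c
      unfolding sat_BAll sat_BEx sat.simps sat_swap sub by (simp add: eval_nat_numeral)
    have suff: "sat UNIV (Impl ?P ?Q) (case_nat z (case_nat c e))"
      if mem: "(\<forall>x\<in>helts (e 1). \<exists>y\<in>helts (e 0). \<Psi> y x z) \<longrightarrow> d z \<in> helts c" for z c
    proof -
      have "sat UNIV ?Q (case_nat z (case_nat c e))"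
        if p: "\<forall>x\<in>helts (e 1). \<exists>y\<in>helts (e 0). \<Psi> y x z"
        unfolding Q
      proof (rule bexI[of _ "d z"])
        show "d z \<in> helts c" using mem p by blast
        show "(\<forall>x\<in>helts (e 1). \<exists>y\<in>helts (d z). \<Psi> y x z) \<and> (\<forall>y\<in>helts (d z). \<exists>x\<in>helts (e 1). \<Psi> y x z)"
          using p unfolding d_def helts_hsep by blast
      qed
      then show ?thesis using P by simp
    qed
    show ?thesis
    \<comment> \<open>If \<open>e 1\<close> is empty, the premise holds for all \<open>z\<close> and
      gives no bound on \<open>z\<close>, but then every \<open>d z\<close> is empty. Otherwise a
      true premise yields an instance of \<open>\<Psi>\<close>, which bounds
      \<open>z\<close>.\<close>
    proof (cases "helts (e 1) = {}")
      case True
      then have "d z = hempty" for z by (auto simp: d_def intro: hc_eqI)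
      moreover have "hset {hempty} \<in> D v" using N by (intro adm_singleton adm_hempty)
      ultimately show ?thesis by (intro bexI[of _ "hset {hempty}"] allI suff) auto
    next
      case False
      obtain t where t: "{\<psi>} \<turnstile> Mem 2 t"
        using assms(2) by (auto simp: set_bounded_def)
      have z_mem: "z \<in> helts (case_nat y (case_nat x (case_nat z e)) t)" if "\<Psi> y x z" for y x z
        using sat_soundness[OF t, of "case_nat y (case_nat x (case_nat z e))" UNIV] that
        by (simp add: \<Psi>_def hmem_iff numeral_2_eq_2)
      have "\<exists>Z\<in>D v. \<forall>x\<in>helts (e 1). \<forall>y\<in>helts (e 0). \<forall>z. \<Psi> y x z \<longrightarrow> z \<in> helts Z"
      proof -
        \<comment> \<open>The bounding variable is \<open>y\<close>, \<open>x\<close>,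
          \<open>z\<close> itself or one from the context. The first two put \<open>z\<close> into
          the union of \<open>e 0\<close> or of \<open>e 1\<close>, the third is impossible by
          irreflexivity of membership, and the last gives the bound directly.\<close>
        consider "t = 0" | "t = 1" | "t = 2" | k where "t = Suc (Suc (Suc k))"
          by (metis One_nat_def not0_implies_Suc numeral_2_eq_2)
        then show ?thesis
        proof cases
          case 1
          then show ?thesis using z_mem N v
            by (intro bexI[of _ "hunion (e 0)"]) (auto intro: adm_hunion D_range)
        next
          case 2
          then show ?thesis using z_mem N v
            by (intro bexI[of _ "hunion (e 1)"]) (auto intro: adm_hunion D_range)
        next
          case 3
          then show ?thesis using z_mem adm_hempty[OF N] helts_irrefl
            by (intro bexI[of _ hempty]) (auto simp: numeral_2_eq_2)
        next
          case 4
          then show ?thesis using z_mem v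
            by (intro bexI[of _ "e k"]) auto
        qed
      qed
      then obtain Z where Z: "Z \<in> D v"
        "\<And>x y z. x \<in> helts (e 1) \<Longrightarrow> y \<in> helts (e 0) \<Longrightarrow> \<Psi> y x z \<Longrightarrow> z \<in> helts Z" by blast
      \<comment> \<open>Index 0 of \<open>f\<close> is a slot for the variable handled by collection
        or separation, so \<open>f (i - 1)\<close> puts \<open>z\<close> at index 2 and the context
        from index 3 on.\<close>
      define S where "S x y f = sat UNIV \<psi> (\<lambda>i. if i = 0 then y else if i = 1 then x else f (i - 1))"
        for x y and f :: "nat \<Rightarrow> hc"
      have S: "S x y (case_nat u (case_nat z e)) \<longleftrightarrow> \<Psi> y x z" for x y z u
      proof -
        have "(\<lambda>i. if i = 0 then y else if i = 1 then x else case_nat u (case_nat z e) (i - 1))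
            = case_nat y (case_nat x (case_nat z e))"
          by (rule ext) (auto split: nat.split)
        then show ?thesis by (simp add: S_def \<Psi>_def)
      qed
      \<comment> \<open>The graph of \<open>d\<close> in bounded form, with \<open>f 2\<close> and
        \<open>f 3\<close> standing for \<open>e 0\<close> and \<open>e 1\<close>.\<close>
      define Rel where "Rel f \<longleftrightarrow> (\<forall>y\<in>helts (f 0). y \<in> helts (f 2) \<and> (\<exists>x\<in>helts (f 3). S x y f)) \<and>
        (\<forall>y\<in>helts (f 2). (\<exists>x\<in>helts (f 3). S x y f) \<longrightarrow> y \<in> helts (f 0))"
        for f
      have R_dfn: "dfn Rel"
        unfolding Rel_def S_def
        by (intro dfn_conj dfn_ball dfn_bex dfn_impl dfn_Mem dfn_sat_two assms)
      have R: "Rel (case_nat u (case_nat z e)) \<longleftrightarrow> u = d z" for u z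
      proof -
        have "u = d z \<longleftrightarrow> helts u = {y \<in> helts (e 0). \<exists>x\<in>helts (e 1). \<Psi> y x z}"
          unfolding helts_inject[symmetric] d_def helts_hsep ..
        then show ?thesis unfolding Rel_def S by (simp add: numeral_2_eq_2 numeral_3_eq_3) blast
      qed
      have d: "d z \<in> D v" if "z \<in> helts Z" for z
      proof -
        have z: "z \<in> D v" by (rule D_trans[OF v(1) that Z(1)])
        let ?T = "\<lambda>f. \<exists>x\<in>helts (f 3). sat UNIV \<psi> (\<lambda>i. if i = 0 then f 0 else if i = 1 then x else f (i - 1))"
        have "dfn ?T"
          by (intro dfn_bex dfn_sat_two assms)
        then have "hsep (e 0) (\<lambda>y. ?T (case_nat y (case_nat z e))) \<in> D v"
          by (intro adm_hsep[OF N]) (use v z in auto)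
        moreover have "?T (case_nat y (case_nat z e)) \<longleftrightarrow> (\<exists>x\<in>helts (e 1). \<Psi> y x z)" for y
          using S[of _ y y z] unfolding S_def by (simp add: numeral_3_eq_3 cong: if_cong)
        ultimately show ?thesis by (simp add: d_def)
      qed
      have "\<exists>u\<in>D v. Rel (case_nat u (case_nat z e))" if "z \<in> helts Z" for z
        unfolding R using d[OF that] by blast
      then obtain c where c: "c \<in> D v" "\<And>z. z \<in> helts Z \<Longrightarrow> \<exists>u\<in>helts c. Rel (case_nat u (case_nat z e))"
        using adm_collection[OF N R_dfn v(2) Z(1)] by blast
      have "d z \<in> helts c" if "\<forall>x\<in>helts (e 1). \<exists>y\<in>helts (e 0). \<Psi> y x z" for z
      proof -
        have "z \<in> helts Z" using False that Z(2) by blast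
        then show ?thesis using c(2) unfolding R by blast
      qed
      then show ?thesis using c(1) suff by blast
    qed
  qed
  have "absolute (Impl ?P ?Q)"
    unfolding shift_def swap_def by (intro abs_intros absolute_ren absolute_delta0 assms)
  show ?thesis
    unfolding subset_collection_def
  proof (intro valid_All)
    show "valid (Ex (All (Impl ?P ?Q)))"
      unfolding valid_def
    proof (intro ballI allI impI)
      fix v and e :: "nat \<Rightarrow> hc" assume v: "v \<in> K" "range e \<subseteq> D v"
      then obtain c where c: "c \<in> D v" "\<forall>z. sat UNIV (Impl ?P ?Q) (case_nat z (case_nat c e))"
        using sem by blast
      have "forced (Impl ?P ?Q) w (case_nat z (case_nat c e))"
        if "w \<in> K" "(v, w) \<in> R" "z \<in> D w" for w z
      proof -
        have "c \<in> D w" "range e \<subseteq> D w" using D_mono v c that range_D_mono by blast+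
        then have "range (case_nat z (case_nat c e)) \<subseteq> D w" using that by simp
        then show ?thesis
          using absoluteD[OF \<open>absolute (Impl ?P ?Q)\<close> that(1)] c(2) by blast
      qed
      then show "forced (Ex (All (Impl ?P ?Q))) v e"
        unfolding forced.simps(7,8) using c(1) by blast
    qed
  qed
qed

section \<open>Markov's principle and choice\<close>

lemma D_hpair_mem:
  assumes "v \<in> K" "range e \<subseteq> D v" "hpair x y \<in> helts (e i)"
  shows "x \<in> D v" "y \<in> D v"
proof -
  have "hpair x y \<in> D v" by (rule D_helts[OF assms])
  then have "hset {x, y} \<in> D v" by (rule D_trans[OF assms(1), rotated]) (simp add: hpair_def)
  then show "x \<in> D v" "y \<in> D v" by (rule D_trans[OF assms(1), rotated], simp)+
qed

lemma absolute_is_binary_seq: "absolute (is_binary_seq f w)"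
  unfolding is_binary_seq_def
proof (intro absolute_Conj absolute_BAll absolute_BEx absolute_Ex absolute_Ex1 abs_intros)
  show "x \<in> D v" if "v \<in> K" "sat UNIV (Conj (Disj (is_empty 0) (is_one 0)) (is_pair 2 1 0)) (case_nat x e)"
    for v e x
    using that adm_hempty[OF D_adm] adm_singleton[OF D_adm] by auto
next
  show "x \<in> D v" if "v \<in> K" "range e \<subseteq> D v" "sat UNIV (pair_in 1 0 (f + 2)) (case_nat x e)" for v e x
    using that D_hpair_mem(2)[of v e] by (auto simp: numeral_2_eq_2)
qed

text \<open>The unbounded quantifiers in the matrix range over components of pairs in the sequence,
  which lie in the domain, so the matrix is absolute. What remains is classical: a total function
  with values 0 and 1 that is not constantly 0 takes the value 1.\<close>

lemma valid_Markov: "valid Markov"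
proof -
  let ?Z = "BAll 1 (Ex (Conj (is_empty 0) (pair_in 1 0 2)))"
  let ?O = "BEx 1 (Ex (Conj (is_one 0) (pair_in 1 0 2)))"
  have "x \<in> D v" if "v \<in> K" "range e \<subseteq> D v" "sat UNIV (Conj \<phi> (pair_in 1 0 2)) (case_nat x e)" for v e x \<phi>
    using that D_hpair_mem(2)[of v e] by (auto simp: numeral_2_eq_2)
  then have "absolute (Impl (is_binary_seq 0 1) (Impl (Neg ?Z) ?O))"
    by (intro absolute_Impl absolute_Neg absolute_BAll absolute_BEx absolute_Ex absolute_Conj
        absolute_is_binary_seq absolute_is_empty absolute_is_one absolute_pair_in) blast+
  moreover have "sat UNIV (Impl (is_binary_seq 0 1) (Impl (Neg ?Z) ?O)) e" for e
    by (simp add: is_binary_seq_def numeral_2_eq_2) (metis hpair_inject)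
  ultimately have "valid (All (Impl (is_binary_seq 0 1) (Impl (Neg ?Z) ?O)))"
    by (intro valid_All valid_absolute)
  then show ?thesis
    unfolding Markov_def by (intro valid_All valid_Impl) (simp only: valid_def)
qed

lemma absolute_choice_premise:
  "absolute (Conj (BAll 0 (Ex (Mem 0 1)))
    (BAll 0 (BAll 1 (Impl (Neg (Eq 1 0)) (Neg (Ex (Conj (Mem 0 2) (Mem 0 1))))))))"
  by (intro absolute_Conj absolute_BAll absolute_Ex absolute_Impl absolute_Neg absolute_atomic)
    (auto simp: hmem_iff dest: D_helts)

lemma absolute_choice_conclusion: "absolute (BAll 1 (Ex1 (Conj (Mem 0 2) (Mem 0 1))))"
  by (intro absolute_Conj absolute_BAll absolute_Ex1 absolute_atomic)
    (auto simp: hmem_iff dest: D_helts)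

text \<open>Premise and conclusion are absolute, so forcing the premise at \<open>v\<close> makes it
  true in \<open>D v\<close>. Choice in this single set supplies \<open>b\<close>, and absoluteness
  turns it back into a forced witness.\<close>

lemma valid_choice_ax: "valid choice_ax"
  unfolding choice_ax_def
proof (intro valid_All valid_Impl)
  let ?A = "Conj (BAll 0 (Ex (Mem 0 1)))
    (BAll 0 (BAll 1 (Impl (Neg (Eq 1 0)) (Neg (Ex (Conj (Mem 0 2) (Mem 0 1)))))))"
  let ?B = "BAll 1 (Ex1 (Conj (Mem 0 2) (Mem 0 1)))"
  fix v and e :: "nat \<Rightarrow> hc"
  assume v: "v \<in> K" "range e \<subseteq> D v" and A: "forced ?A v e"
  have pt: "kripke_adm {()} {((), ())} (\<lambda>_. M)" if "adm M" for M
    by (intro kripke_adm.intro kripke_point) (unfold_locales, use that in simp)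
  have "sat (D v) ?A e"
    using A absoluteD[OF absolute_choice_premise v]
      sat_D_absolute[OF v kripke_adm.absolute_choice_premise[OF pt]] by blast
  moreover have "sat (D v) (Impl ?A (Ex ?B)) e"
  proof -
    have "sat (D v) (All (Impl ?A (Ex ?B))) (\<lambda>i. e (Suc i))"
      using D_adm[OF v(1)] unfolding adm_def choice_ax_def by blast
    moreover have "case_nat (e 0) (\<lambda>i. e (Suc i)) = e"
      by (rule ext) (simp split: nat.split)
    ultimately show ?thesis
      using D_range[OF v(2), of 0] unfolding sat.simps(7) by metis
  qed
  ultimately have "sat (D v) (Ex ?B) e" unfolding sat.simps(6) by (rule rev_mp)
  then obtain b where b: "b \<in> D v" "sat (D v) ?B (case_nat b e)" unfolding sat.simps(8) by blast
  have "range (case_nat b e) \<subseteq> D v" using b(1) v(2) by simp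
  then have "forced ?B v (case_nat b e)"
    using b(2) absoluteD[OF absolute_choice_conclusion v(1), of "case_nat b e"]
      sat_D_absolute[OF v(1) _ kripke_adm.absolute_choice_conclusion[OF pt], of "case_nat b e"]
    by blast
  with b(1) show "forced (Ex ?B) v e" unfolding forced.simps(8) by blast
qed

lemma valid_axioms: "\<phi> \<in> IKP_plus \<union> {Markov, choice_ax} \<Longrightarrow> valid \<phi>"
  unfolding IKP_plus_def IKP_def
  using valid_closures[of "range set_induction"] valid_closures[of "separation ` {\<phi>. delta0 \<phi>}"]
    valid_closures[of "collection ` {\<phi>. delta0 \<phi>}"]
    valid_closures[of "strong_collection ` {\<phi>. delta0 \<phi>}"]
    valid_closures[of "subset_collection ` {\<psi>. delta0 \<psi> \<and> set_bounded 2 \<psi>}"]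
    valid_empty_ax valid_pairing_ax valid_union_ax valid_extensionality_ax valid_infinity_ax
    valid_set_induction valid_separation valid_collection valid_strong_collection
    valid_subset_collection valid_Markov valid_choice_ax
  by blast

end

section \<open>Lists of sets and relations on them\<close>

primrec hlist :: "hc list \<Rightarrow> hc" where
  "hlist [] = hempty"
| "hlist (x # xs) = hpair x (hlist xs)"

lemma hlist_inject [simp]: "hlist xs = hlist ys \<longleftrightarrow> xs = ys"
proof (induction xs arbitrary: ys)
  case Nil
  then show ?case by (cases ys) simp_all
next
  case (Cons x xs)
  then show ?case by (cases ys) simp_all
qed

definition env :: "hc list \<Rightarrow> nat \<Rightarrow> hc" where
  "env xs i = (if i < length xs then xs ! i else hempty)"

lemma env_Cons [simp]: "env (x # xs) = case_nat x (env xs)"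
  by (rule ext) (auto simp: env_def split: nat.split)

lemma range_env: "set xs \<subseteq> N \<Longrightarrow> hempty \<in> N \<Longrightarrow> range (env xs) \<subseteq> N"
  by (auto simp: env_def)

lemma finite_fv: "finite (fv \<phi>)"
proof (induction \<phi>)
  case (All \<phi>)
  have "fv (All \<phi>) = Suc -` fv \<phi>" by auto
  then show ?case using All finite_vimageI[of "fv \<phi>" Suc] by simp
next
  case (Ex \<phi>)
  have "fv (Ex \<phi>) = Suc -` fv \<phi>" by auto
  then show ?case using Ex finite_vimageI[of "fv \<phi>" Suc] by simp
qed simp_all

lemma fv_bound: obtains n where "fv \<phi> \<subseteq> {..<n}"
  using finite_fv[of \<phi>] finite_nat_iff_bounded by blast

lemma case_nat_env_map:
  assumes "fv \<phi> \<subseteq> {..<n}"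
  shows "sat M \<phi> (case_nat x (env (map e [0..<n]))) \<longleftrightarrow> sat M \<phi> (case_nat x e)"
  by (rule sat_cong_fv) (use assms in \<open>auto simp: env_def split: nat.split\<close>)

lemma case_nat_case_nat_env_map:
  assumes "fv \<phi> \<subseteq> {..<n}"
  shows "sat M \<phi> (case_nat y (case_nat x (env (map e [0..<n])))) \<longleftrightarrow> sat M \<phi> (case_nat y (case_nat x e))"
  by (rule sat_cong_fv) (use assms in \<open>auto simp: env_def split: nat.split\<close>)

section \<open>Certified sets\<close>

definition basic_axioms :: fm where
  "basic_axioms = Conj empty_ax (Conj pairing_ax (Conj union_ax (Conj infinity_ax choice_ax)))"

text \<open>\<open>U\<close> collects the lists over \<open>t\<close> and \<open>C\<close> a family of subsets of \<open>U\<close>. With assignments coded as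
  nested pairs, the head being variable \<open>0\<close>, quantification is a projection and the atoms arise from three
  binary relations by prefixing or inserting a dummy variable. This replaces a coding of syntax inside
  the models.\<close>

definition closed_relations :: "hc \<Rightarrow> hc \<Rightarrow> hc \<Rightarrow> bool" where
  "closed_relations t U C \<longleftrightarrow>
    (\<exists>P\<in>helts C. \<forall>e\<in>helts U. e \<notin> helts P) \<and>
    (\<exists>P\<in>helts C. \<forall>x\<in>helts t. \<forall>y\<in>helts t. \<forall>e\<in>helts U. \<forall>f\<in>helts U. \<forall>g\<in>helts U.
      is_hpair f y e \<longrightarrow> is_hpair g x f \<longrightarrow> (g \<in> helts P \<longleftrightarrow> x \<in> helts y)) \<and>
    (\<exists>P\<in>helts C. \<forall>x\<in>helts t. \<forall>y\<in>helts t. \<forall>e\<in>helts U. \<forall>f\<in>helts U. \<forall>g\<in>helts U.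
      is_hpair f y e \<longrightarrow> is_hpair g x f \<longrightarrow> (g \<in> helts P \<longleftrightarrow> y \<in> helts x)) \<and>
    (\<exists>P\<in>helts C. \<forall>x\<in>helts t. \<forall>y\<in>helts t. \<forall>e\<in>helts U. \<forall>f\<in>helts U. \<forall>g\<in>helts U.
      is_hpair f y e \<longrightarrow> is_hpair g x f \<longrightarrow> (g \<in> helts P \<longleftrightarrow> x = y)) \<and>
    (\<forall>A\<in>helts C. \<forall>B\<in>helts C. \<exists>P\<in>helts C. \<forall>e\<in>helts U.
      e \<in> helts P \<longleftrightarrow> (e \<in> helts A \<longrightarrow> e \<in> helts B)) \<and>
    (\<forall>A\<in>helts C. \<exists>P\<in>helts C. \<forall>e\<in>helts U.
      e \<in> helts P \<longleftrightarrow> (\<exists>x\<in>helts t. \<exists>f\<in>helts U. is_hpair f x e \<and> f \<in> helts A)) \<and>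
    (\<forall>A\<in>helts C. \<exists>P\<in>helts C. \<forall>x\<in>helts t. \<forall>e\<in>helts U. \<forall>f\<in>helts U.
      is_hpair f x e \<longrightarrow> (f \<in> helts P \<longleftrightarrow> e \<in> helts A)) \<and>
    (\<forall>A\<in>helts C. \<exists>P\<in>helts C. \<forall>x\<in>helts t. \<forall>y\<in>helts t. \<forall>e\<in>helts U. \<forall>f\<in>helts U. \<forall>g\<in>helts U.
      \<forall>h\<in>helts U. is_hpair f y e \<longrightarrow> is_hpair g x f \<longrightarrow> is_hpair h x e \<longrightarrow> (g \<in> helts P \<longleftrightarrow> h \<in> helts A))"

text \<open>The last two conjuncts are separation and collection for the relations in
  \<open>C\<close>, with a list \<open>e\<close> of parameters behind the variables concerned. The
  assignment \<open>\<lambda>_. t\<close> only fills a slot, as \<open>basic_axioms\<close> is a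
  sentence; its value is one that a bounded formula about \<open>t\<close> can name.\<close>

definition certified :: "hc \<Rightarrow> hc \<Rightarrow> hc \<Rightarrow> bool" where
  "certified t U C \<longleftrightarrow>
    (\<forall>x\<in>helts t. \<forall>y\<in>helts x. y \<in> helts t) \<and>
    sat (helts t) basic_axioms (\<lambda>_. t) \<and>
    (\<exists>e\<in>helts U. \<forall>x\<in>helts e. False) \<and>
    (\<forall>x\<in>helts t. \<forall>e\<in>helts U. \<exists>f\<in>helts U. is_hpair f x e) \<and>
    closed_relations t U C \<and>
    (\<forall>A\<in>helts C. \<forall>a\<in>helts t. \<forall>e\<in>helts U. \<exists>y\<in>helts t. (\<forall>x\<in>helts y. x \<in> helts a) \<and>
      (\<forall>x\<in>helts a. x \<in> helts y \<longleftrightarrow> (\<exists>f\<in>helts U. is_hpair f x e \<and> f \<in> helts A))) \<and>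
    (\<forall>A\<in>helts C. \<forall>a\<in>helts t. \<forall>e\<in>helts U.
      (\<forall>x\<in>helts a. \<exists>y\<in>helts t. \<exists>f\<in>helts U. \<exists>g\<in>helts U.
        is_hpair f x e \<and> is_hpair g y f \<and> g \<in> helts A) \<longrightarrow>
      (\<exists>b\<in>helts t. \<forall>x\<in>helts a. \<exists>y\<in>helts b. \<exists>f\<in>helts U. \<exists>g\<in>helts U.
        is_hpair f x e \<and> is_hpair g y f \<and> g \<in> helts A))"

lemma dfn_certified: "dfn (\<lambda>e. certified (e i) (e j) (e k))"
  unfolding certified_def closed_relations_def
  by (intro dfn_conj dfn_disj dfn_ball dfn_bex dfn_impl dfn_iff dfn_not dfn_Mem dfn_Eq dfn_False
      dfn_is_hpair dfn_relativized)

locale certificate =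
  fixes t U C :: hc
  assumes cert: "certified t U C"
begin

abbreviation "N \<equiv> helts t"

lemma t_trans: "x \<in> helts y \<Longrightarrow> y \<in> N \<Longrightarrow> x \<in> N"
  using cert unfolding certified_def by blast

lemma htrans_N: "htrans N"
  unfolding htrans_def using t_trans by blast

lemma hlist_in_U: "set xs \<subseteq> N \<Longrightarrow> hlist xs \<in> helts U"
proof (induction xs)
  case Nil
  have "\<exists>e\<in>helts U. \<forall>x\<in>helts e. False" using cert unfolding certified_def by (elim conjE)
  then obtain e where "e \<in> helts U" "helts e = {}" by blast
  moreover from this have "e = hempty" by (intro hc_eqI) simp
  ultimately show ?case by simp
next
  case (Cons x xs)
  have "\<forall>x\<in>helts t. \<forall>e\<in>helts U. \<exists>f\<in>helts U. is_hpair f x e"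
    using cert unfolding certified_def by (elim conjE)
  then show ?case using Cons by (auto simp: is_hpair_def)
qed

text \<open>Lists that are too short for the free variables are excluded: there \<open>env\<close> supplies the junk value
  \<open>hempty\<close>, which the relations in \<open>C\<close> do not respect.\<close>

definition representable :: "nat \<Rightarrow> ((nat \<Rightarrow> hc) \<Rightarrow> bool) \<Rightarrow> bool" where
  "representable n Q \<longleftrightarrow>
    (\<exists>P\<in>helts C. \<forall>xs. set xs \<subseteq> N \<longrightarrow> n \<le> length xs \<longrightarrow> (hlist xs \<in> helts P \<longleftrightarrow> Q (env xs)))"

lemma representableE:
  assumes "representable n Q"
  obtains A where "A \<in> helts C"
    "\<And>xs. set xs \<subseteq> N \<Longrightarrow> n \<le> length xs \<Longrightarrow> hlist xs \<in> helts A \<longleftrightarrow> Q (env xs)"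
proof -
  from assms obtain A where A: "A \<in> helts C"
    "\<forall>xs. set xs \<subseteq> N \<longrightarrow> n \<le> length xs \<longrightarrow> (hlist xs \<in> helts A \<longleftrightarrow> Q (env xs))"
    unfolding representable_def by (rule bexE)
  show thesis
  proof (rule that[OF A(1)])
    fix xs assume "set xs \<subseteq> N" "n \<le> length xs"
    with A(2) show "hlist xs \<in> helts A \<longleftrightarrow> Q (env xs)" by blast
  qed
qed

lemma representableI:
  assumes "P \<in> helts C"
    "\<And>xs. set xs \<subseteq> N \<Longrightarrow> n \<le> length xs \<Longrightarrow> hlist xs \<in> helts P \<longleftrightarrow> Q (env xs)"
  shows "representable n Q"
  unfolding representable_def by (rule bexI[OF _ assms(1)]) (intro allI impI assms(2))

lemma representable_cong:
  "(\<And>e. Q e \<longleftrightarrow> Q' e) \<Longrightarrow> representable n Q \<Longrightarrow> representable n Q'"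
  unfolding representable_def by simp

lemma representable_mono: "representable n Q \<Longrightarrow> n \<le> m \<Longrightarrow> representable m Q"
proof -
  assume "representable n Q" and m: "n \<le> m"
  then obtain A where A: "A \<in> helts C" "\<And>xs. set xs \<subseteq> N \<Longrightarrow> n \<le> length xs \<Longrightarrow> hlist xs \<in> helts A \<longleftrightarrow> Q (env xs)"
    by (elim representableE) (rule that)
  show ?thesis by (rule representableI[OF A(1)]) (use A(2) m order_trans in blast)
qed

lemma closed: "closed_relations t U C"
  using cert unfolding certified_def by (elim conjE)

lemma representable_False: "representable n (\<lambda>_. False)"
proof -
  have "\<exists>P\<in>helts C. \<forall>e\<in>helts U. e \<notin> helts P"
    using closed unfolding closed_relations_def by (elim conjE)
  note cl = this
  obtain P where P: "P \<in> helts C" "\<forall>e\<in>helts U. e \<notin> helts P"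
    by (rule bexE[OF cl]) (rule that)
  show ?thesis by (rule representableI[OF P(1)]) (use P(2) hlist_in_U in blast)
qed

lemma representable_impl:
  assumes "representable n Q" "representable n Q'"
  shows "representable n (\<lambda>e. Q e \<longrightarrow> Q' e)"
proof -
  obtain A where A: "A \<in> helts C" "\<And>xs. set xs \<subseteq> N \<Longrightarrow> n \<le> length xs \<Longrightarrow> hlist xs \<in> helts A \<longleftrightarrow> Q (env xs)"
    using assms(1) by (rule representableE) (rule that)
  obtain B where B: "B \<in> helts C" "\<And>xs. set xs \<subseteq> N \<Longrightarrow> n \<le> length xs \<Longrightarrow> hlist xs \<in> helts B \<longleftrightarrow> Q' (env xs)"
    using assms(2) by (rule representableE) (rule that)
  have "\<forall>A\<in>helts C. \<forall>B\<in>helts C. \<exists>P\<in>helts C. \<forall>e\<in>helts U.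
      e \<in> helts P \<longleftrightarrow> (e \<in> helts A \<longrightarrow> e \<in> helts B)"
    using closed unfolding closed_relations_def by (elim conjE)
  note cl = this
  obtain P where P: "P \<in> helts C" "\<forall>e\<in>helts U. e \<in> helts P \<longleftrightarrow> (e \<in> helts A \<longrightarrow> e \<in> helts B)"
    by (rule bexE[OF bspec[OF bspec[OF cl A(1)] B(1)]]) (rule that)
  have "hlist xs \<in> helts P \<longleftrightarrow> (Q (env xs) \<longrightarrow> Q' (env xs))" if "set xs \<subseteq> N" "n \<le> length xs" for xs
    using bspec[OF P(2) hlist_in_U[OF that(1)]] A(2)[OF that] B(2)[OF that] by simp
  with P(1) show ?thesis by (rule representableI)
qed

lemma representable_True: "representable n (\<lambda>_. True)"
  using representable_impl[OF representable_False representable_False] by simp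

lemma representable_not: "representable n Q \<Longrightarrow> representable n (\<lambda>e. \<not> Q e)"
  using representable_impl[OF _ representable_False] by simp

lemma representable_conj:
  "representable n Q \<Longrightarrow> representable n Q' \<Longrightarrow> representable n (\<lambda>e. Q e \<and> Q' e)"
  using representable_not[OF representable_impl[OF _ representable_not[of n Q']], of Q] by simp

lemma representable_disj:
  "representable n Q \<Longrightarrow> representable n Q' \<Longrightarrow> representable n (\<lambda>e. Q e \<or> Q' e)"
  using representable_impl[OF representable_not[of n Q], of Q'] by (simp add: disj_imp)

lemma representable_ex:
  assumes "representable (Suc n) Q"
  shows "representable n (\<lambda>e. \<exists>x\<in>N. Q (case_nat x e))"
proof -
  obtain A where A: "A \<in> helts C" "\<And>xs. set xs \<subseteq> N \<Longrightarrow> Suc n \<le> length xs \<Longrightarrow> hlist xs \<in> helts A \<longleftrightarrow> Q (env xs)"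
    using assms by (rule representableE) (rule that)
  have "\<forall>A\<in>helts C. \<exists>P\<in>helts C. \<forall>e\<in>helts U.
      e \<in> helts P \<longleftrightarrow> (\<exists>x\<in>helts t. \<exists>f\<in>helts U. is_hpair f x e \<and> f \<in> helts A)"
    using closed unfolding closed_relations_def by (elim conjE)
  note cl = this
  obtain P where P: "P \<in> helts C" "\<forall>e\<in>helts U. e \<in> helts P \<longleftrightarrow>
      (\<exists>x\<in>helts t. \<exists>f\<in>helts U. is_hpair f x e \<and> f \<in> helts A)"
    by (rule bexE[OF bspec[OF cl A(1)]]) (rule that)
  have "hlist xs \<in> helts P \<longleftrightarrow> (\<exists>x\<in>N. Q (case_nat x (env xs)))" if xs: "set xs \<subseteq> N" "n \<le> length xs" for xs
  proof -
    have "hpair x (hlist xs) \<in> helts U" if "x \<in> N" for x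
      using hlist_in_U[of "x # xs"] xs(1) that by simp
    then have "hlist xs \<in> helts P \<longleftrightarrow> (\<exists>x\<in>N. hpair x (hlist xs) \<in> helts A)"
      using bspec[OF P(2) hlist_in_U[OF xs(1)]] unfolding is_hpair_def by blast
    moreover have "hpair x (hlist xs) \<in> helts A \<longleftrightarrow> Q (case_nat x (env xs))" if "x \<in> N" for x
      using A(2)[of "x # xs"] xs that by simp
    ultimately show ?thesis by blast
  qed
  with P(1) show ?thesis by (rule representableI)
qed

lemma representable_weaken:
  assumes "representable n Q"
  shows "representable (Suc n) (\<lambda>e. Q (\<lambda>i. e (Suc i)))"
proof -
  obtain A where A: "A \<in> helts C" "\<And>xs. set xs \<subseteq> N \<Longrightarrow> n \<le> length xs \<Longrightarrow> hlist xs \<in> helts A \<longleftrightarrow> Q (env xs)"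
    using assms by (rule representableE) (rule that)
  have "\<forall>A\<in>helts C. \<exists>P\<in>helts C. \<forall>x\<in>helts t. \<forall>e\<in>helts U. \<forall>f\<in>helts U.
      is_hpair f x e \<longrightarrow> (f \<in> helts P \<longleftrightarrow> e \<in> helts A)"
    using closed unfolding closed_relations_def by (elim conjE)
  note cl = this
  obtain P where P: "P \<in> helts C" "\<forall>x\<in>helts t. \<forall>e\<in>helts U. \<forall>f\<in>helts U.
      is_hpair f x e \<longrightarrow> (f \<in> helts P \<longleftrightarrow> e \<in> helts A)"
    by (rule bexE[OF bspec[OF cl A(1)]]) (rule that)
  have "hlist xs \<in> helts P \<longleftrightarrow> Q (\<lambda>i. env xs (Suc i))" if xs: "set xs \<subseteq> N" "Suc n \<le> length xs" for xs
  proof (cases xs)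
    case (Cons x ys)
    have "hlist xs \<in> helts P \<longleftrightarrow> hlist ys \<in> helts A"
      using P(2)[rule_format, of x "hlist ys" "hlist xs"] hlist_in_U[of xs] hlist_in_U[of ys] xs(1)
      by (simp add: is_hpair_def Cons)
    then show ?thesis using A(2)[of ys] xs by (simp add: Cons)
  qed (use xs in simp)
  with P(1) show ?thesis by (rule representableI)
qed

lemma representable_insert:
  assumes "representable (Suc n) Q"
  shows "representable (Suc (Suc n)) (\<lambda>e. Q (case_nat (e 0) (\<lambda>i. e (Suc (Suc i)))))"
proof -
  obtain A where A: "A \<in> helts C" "\<And>xs. set xs \<subseteq> N \<Longrightarrow> Suc n \<le> length xs \<Longrightarrow> hlist xs \<in> helts A \<longleftrightarrow> Q (env xs)"
    using assms by (rule representableE) (rule that)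
  have "\<forall>A\<in>helts C. \<exists>P\<in>helts C. \<forall>x\<in>helts t. \<forall>y\<in>helts t. \<forall>e\<in>helts U. \<forall>f\<in>helts U. \<forall>g\<in>helts U.
      \<forall>h\<in>helts U. is_hpair f y e \<longrightarrow> is_hpair g x f \<longrightarrow> is_hpair h x e \<longrightarrow> (g \<in> helts P \<longleftrightarrow> h \<in> helts A)"
    using closed unfolding closed_relations_def by (elim conjE)
  note cl = this
  obtain P where P: "P \<in> helts C" "\<forall>x\<in>helts t. \<forall>y\<in>helts t. \<forall>e\<in>helts U. \<forall>f\<in>helts U. \<forall>g\<in>helts U.
      \<forall>h\<in>helts U. is_hpair f y e \<longrightarrow> is_hpair g x f \<longrightarrow> is_hpair h x e \<longrightarrow> (g \<in> helts P \<longleftrightarrow> h \<in> helts A)"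
    by (rule bexE[OF bspec[OF cl A(1)]]) (rule that)
  have "hlist xs \<in> helts P \<longleftrightarrow> Q (case_nat (env xs 0) (\<lambda>i. env xs (Suc (Suc i))))"
    if xs: "set xs \<subseteq> N" "Suc (Suc n) \<le> length xs" for xs
  proof -
    obtain x y ys where ys: "xs = x # y # ys"
      using xs(2) by (cases xs; cases "tl xs") auto
    have "hlist xs \<in> helts P \<longleftrightarrow> hlist (x # ys) \<in> helts A"
      using P(2)[rule_format, of x y "hlist ys" "hlist (y # ys)" "hlist xs" "hlist (x # ys)"]
        hlist_in_U[of xs] hlist_in_U[of ys] hlist_in_U[of "x # ys"] hlist_in_U[of "y # ys"] xs(1)
      by (simp add: is_hpair_def ys)
    then show ?thesis using A(2)[of "x # ys"] xs by (simp add: ys)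
  qed
  with P(1) show ?thesis by (rule representableI)
qed

section \<open>Representing atoms and all formulas\<close>

lemma representable_base:
  assumes "\<exists>P\<in>helts C. \<forall>x\<in>helts t. \<forall>y\<in>helts t. \<forall>e\<in>helts U. \<forall>f\<in>helts U. \<forall>g\<in>helts U.
      is_hpair f y e \<longrightarrow> is_hpair g x f \<longrightarrow> (g \<in> helts P \<longleftrightarrow> Q x y)"
  shows "representable 2 (\<lambda>e. Q (e 0) (e 1))"
proof -
  obtain P where P: "P \<in> helts C" "\<forall>x\<in>helts t. \<forall>y\<in>helts t. \<forall>e\<in>helts U. \<forall>f\<in>helts U. \<forall>g\<in>helts U.
      is_hpair f y e \<longrightarrow> is_hpair g x f \<longrightarrow> (g \<in> helts P \<longleftrightarrow> Q x y)"
    using assms by meson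
  have "hlist xs \<in> helts P \<longleftrightarrow> Q (env xs 0) (env xs 1)"
    if xs: "set xs \<subseteq> N" "2 \<le> length xs" for xs
  proof -
    obtain x y ys where ys: "xs = x # y # ys"
      using xs(2) by (cases xs; cases "tl xs") auto
    show ?thesis
      using P(2)[rule_format, of x y "hlist ys" "hlist (y # ys)" "hlist xs"]
        hlist_in_U[of xs] hlist_in_U[of ys] hlist_in_U[of "y # ys"] xs(1)
      by (simp add: is_hpair_def ys)
  qed
  with P(1) show ?thesis by (rule representableI)
qed

lemma representable_far:
  assumes "representable 2 (\<lambda>e. Q (e 0) (e 1))"
  shows "representable (Suc (Suc j)) (\<lambda>e. Q (e 0) (e (Suc j)))"
proof (induction j)
  case 0
  then show ?case using assms by (simp add: numeral_2_eq_2)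
next
  case (Suc j)
  then show ?case using representable_insert[of "Suc j" "\<lambda>e. Q (e 0) (e (Suc j))"] by simp
qed

text \<open>Weakening accounts for a common number of leading variables until one index is 0; the
  other index is then reached by inserting dummies behind the head. This takes both orientations of
  \<open>Q\<close> and its diagonal.\<close>

lemma representable_atom:
  assumes "representable 2 (\<lambda>e. Q (e 0) (e 1))" "representable 2 (\<lambda>e. Q (e 1) (e 0))"
    "representable 1 (\<lambda>e. Q (e 0) (e 0))"
  shows "representable (Suc (max i j)) (\<lambda>e. Q (e i) (e j))"
proof (induction i arbitrary: j)
  case 0
  show ?case
  proof (cases j)
    case (Suc k)
    then show ?thesis using representable_far[OF assms(1), of k] by simp
  qed (use assms(3) in simp)
next
  case (Suc i)
  show ?case
  proof (cases j)
    case 0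
    then show ?thesis using representable_far[of "\<lambda>x y. Q y x" i] assms(2) by simp
  next
    case (Suc k)
    then show ?thesis using representable_weaken[OF Suc.IH[of k]] by simp
  qed
qed

lemma representable_Mem: "representable (Suc (max i j)) (\<lambda>e. e i \<in> helts (e j))"
proof (rule representable_atom)
  show "representable 2 (\<lambda>e. e 0 \<in> helts (e 1))"
    by (rule representable_base) (use closed in \<open>unfold closed_relations_def, elim conjE\<close>)
  show "representable 2 (\<lambda>e. e 1 \<in> helts (e 0))"
    by (rule representable_base) (use closed in \<open>unfold closed_relations_def, elim conjE\<close>)
  show "representable 1 (\<lambda>e. e 0 \<in> helts (e 0))"
    using representable_False helts_irrefl by simp
qed

lemma representable_Eq: "representable (Suc (max i j)) (\<lambda>e. e i = e j)"
proof (rule representable_atom)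
  show *: "representable 2 (\<lambda>e. e 0 = e 1)"
    by (rule representable_base) (use closed in \<open>unfold closed_relations_def, elim conjE\<close>)
  then show "representable 2 (\<lambda>e. e 1 = e 0)" by (simp add: eq_commute)
  show "representable 1 (\<lambda>e. e 0 = e 0)"
    using representable_True by simp
qed

lemma representable_sat: "fv \<phi> \<subseteq> {..<n} \<Longrightarrow> representable n (sat N \<phi>)"
proof (induction \<phi> arbitrary: n)
  case (Mem i j)
  then have "Suc (max i j) \<le> n" by auto
  from representable_mono[OF representable_Mem this] show ?case
    by (rule representable_cong[rotated]) (simp add: hmem_iff)
next
  case (Eq i j)
  then have "Suc (max i j) \<le> n" by auto
  from representable_mono[OF representable_Eq this] show ?case
    by (rule representable_cong[rotated]) (simp add: hmem_iff)
next
  case (All \<phi>)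
  have "fv \<phi> \<subseteq> {..<Suc n}"
  proof
    fix i assume "i \<in> fv \<phi>" then show "i \<in> {..<Suc n}" using All.prems by (cases i) auto
  qed
  then have "representable (Suc n) (\<lambda>e. \<not> sat N \<phi> e)" by (intro representable_not All.IH)
  from representable_not[OF representable_ex[OF this]] show ?case
    by (rule representable_cong[rotated]) simp
next
  case (Ex \<phi>)
  have "fv \<phi> \<subseteq> {..<Suc n}"
  proof
    fix i assume "i \<in> fv \<phi>" then show "i \<in> {..<Suc n}" using Ex.prems by (cases i) auto
  qed
  then have "representable (Suc n) (sat N \<phi>)" by (rule Ex.IH)
  from representable_ex[OF this] show ?case by (rule representable_cong[rotated]) simp
next
  case Fls
  show ?case by (rule representable_cong[OF _ representable_False]) simp
next
  case (Conj \<phi> \<psi>)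
  then have "representable n (\<lambda>e. sat N \<phi> e \<and> sat N \<psi> e)" by (intro representable_conj) auto
  then show ?case by (rule representable_cong[rotated]) simp
next
  case (Disj \<phi> \<psi>)
  then have "representable n (\<lambda>e. sat N \<phi> e \<or> sat N \<psi> e)" by (intro representable_disj) auto
  then show ?case by (rule representable_cong[rotated]) simp
next
  case (Impl \<phi> \<psi>)
  then have "representable n (\<lambda>e. sat N \<phi> e \<longrightarrow> sat N \<psi> e)" by (intro representable_impl) auto
  then show ?case by (rule representable_cong[rotated]) simp
qed

section \<open>Certified sets satisfy bounded separation and collection\<close>

lemma separating_N: "separating N"
  unfolding separating_def
proof (intro allI impI)
  fix P :: "(nat \<Rightarrow> hc) \<Rightarrow> bool" and e :: "nat \<Rightarrow> hc" and a assume "dfn P" and e: "range e \<subseteq> N" and a: "a \<in> N"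
  then obtain \<phi> where \<phi>: "delta0 \<phi>" "\<And>e. sat UNIV \<phi> e \<longleftrightarrow> P e" by (auto simp: dfn_def)
  obtain n where n: "fv \<phi> \<subseteq> {..<n}" by (rule fv_bound)
  \<comment> \<open>Only the first \<open>n\<close> values of the assignment matter to
    \<open>\<phi>\<close>; as a finite list over \<open>N\<close> they are an element of
    \<open>U\<close>.\<close>
  let ?xs = "map e [0..<n]"
  have xs: "set ?xs \<subseteq> N" using e by auto
  obtain A where A: "A \<in> helts C" "\<And>xs. set xs \<subseteq> N \<Longrightarrow> n \<le> length xs \<Longrightarrow> hlist xs \<in> helts A \<longleftrightarrow> sat N \<phi> (env xs)"
    using representable_sat[OF n] by (rule representableE) (rule that)
  \<comment> \<open>Membership in \<open>A\<close> is truth in \<open>N\<close>, whereas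
    \<open>P\<close> speaks of truth in the universe; boundedness of \<open>\<phi>\<close> and
    transitivity of \<open>N\<close> connect the two.\<close>
  have A': "hlist (x # ?xs) \<in> helts A \<longleftrightarrow> P (case_nat x e)" if "x \<in> N" for x
  proof -
    have "hlist (x # ?xs) \<in> helts A \<longleftrightarrow> sat N \<phi> (case_nat x e)"
      using A(2)[of "x # ?xs"] that xs case_nat_env_map[OF n] by simp
    also have "\<dots> \<longleftrightarrow> P (case_nat x e)"
      using sat_delta0_trans[OF \<phi>(1) htrans_N, of "case_nat x e"] \<phi>(2) that e by simp
    finally show ?thesis .
  qed
  have "\<forall>A\<in>helts C. \<forall>a\<in>helts t. \<forall>e\<in>helts U. \<exists>y\<in>helts t. (\<forall>x\<in>helts y. x \<in> helts a) \<and>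
      (\<forall>x\<in>helts a. x \<in> helts y \<longleftrightarrow> (\<exists>f\<in>helts U. is_hpair f x e \<and> f \<in> helts A))"
    using cert unfolding certified_def by (elim conjE)
  note sep = this
  obtain y where y: "y \<in> N" "\<forall>x\<in>helts y. x \<in> helts a"
    "\<forall>x\<in>helts a. x \<in> helts y \<longleftrightarrow> (\<exists>f\<in>helts U. is_hpair f x (hlist ?xs) \<and> f \<in> helts A)"
    by (rule bexE[OF bspec[OF bspec[OF bspec[OF sep A(1)] a] hlist_in_U[OF xs]]]) (elim conjE, rule that)
  have "x \<in> helts y \<longleftrightarrow> P (case_nat x e)" if x: "x \<in> helts a" for x
  proof -
    have xN: "x \<in> N" by (rule t_trans[OF x a])
    have "hlist (x # ?xs) \<in> helts U" by (rule hlist_in_U) (use xN xs in simp)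
    then have "x \<in> helts y \<longleftrightarrow> hlist (x # ?xs) \<in> helts A"
      using bspec[OF y(3) x] unfolding is_hpair_def hlist.simps(2) by blast
    then show ?thesis using A'[OF xN] by simp
  qed
  then have "y = hsep a (\<lambda>x. P (case_nat x e))"
    using y(2) by (intro hc_eqI) auto
  then show "hsep a (\<lambda>x. P (case_nat x e)) \<in> N" using y(1) by simp
qed

text \<open>As for separation, with two variables in front of the parameter list: \<open>y\<close>
  is the head and \<open>x\<close> comes second.\<close>

lemma collecting_N: "collecting N"
  unfolding collecting_def
proof (intro allI impI)
  fix P :: "(nat \<Rightarrow> hc) \<Rightarrow> bool" and e :: "nat \<Rightarrow> hc" and a assume "dfn P" and e: "range e \<subseteq> N" and a: "a \<in> N"
    and prem: "\<forall>x\<in>helts a. \<exists>y\<in>N. P (case_nat y (case_nat x e))"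
  then obtain \<phi> where \<phi>: "delta0 \<phi>" "\<And>e. sat UNIV \<phi> e \<longleftrightarrow> P e" by (auto simp: dfn_def)
  obtain n where n: "fv \<phi> \<subseteq> {..<n}" by (rule fv_bound)
  let ?xs = "map e [0..<n]"
  have xs: "set ?xs \<subseteq> N" using e by auto
  obtain A where A: "A \<in> helts C" "\<And>xs. set xs \<subseteq> N \<Longrightarrow> n \<le> length xs \<Longrightarrow> hlist xs \<in> helts A \<longleftrightarrow> sat N \<phi> (env xs)"
    using representable_sat[OF n] by (rule representableE) (rule that)
  have A': "hlist (y # x # ?xs) \<in> helts A \<longleftrightarrow> P (case_nat y (case_nat x e))" if "x \<in> N" "y \<in> N" for x y
  proof -
    have "hlist (y # x # ?xs) \<in> helts A \<longleftrightarrow> sat N \<phi> (case_nat y (case_nat x e))"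
      using A(2)[of "y # x # ?xs"] that xs case_nat_case_nat_env_map[OF n] by simp
    also have "\<dots> \<longleftrightarrow> P (case_nat y (case_nat x e))"
      using sat_delta0_trans[OF \<phi>(1) htrans_N, of "case_nat y (case_nat x e)"] \<phi>(2) that e by simp
    finally show ?thesis .
  qed
  have rel: "(\<exists>f\<in>helts U. \<exists>g\<in>helts U. is_hpair f x (hlist ?xs) \<and> is_hpair g y f \<and> g \<in> helts A)
      \<longleftrightarrow> P (case_nat y (case_nat x e))" if "x \<in> N" "y \<in> N" for x y
  proof -
    have "hlist (x # ?xs) \<in> helts U" "hlist (y # x # ?xs) \<in> helts U"
      by (rule hlist_in_U, use that xs in simp)+
    then show ?thesis using A'[OF that] unfolding is_hpair_def hlist.simps(2) by blast
  qed
  have "\<forall>A\<in>helts C. \<forall>a\<in>helts t. \<forall>e\<in>helts U.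
      (\<forall>x\<in>helts a. \<exists>y\<in>helts t. \<exists>f\<in>helts U. \<exists>g\<in>helts U.
        is_hpair f x e \<and> is_hpair g y f \<and> g \<in> helts A) \<longrightarrow>
      (\<exists>b\<in>helts t. \<forall>x\<in>helts a. \<exists>y\<in>helts b. \<exists>f\<in>helts U. \<exists>g\<in>helts U.
        is_hpair f x e \<and> is_hpair g y f \<and> g \<in> helts A)"
    using cert unfolding certified_def by (elim conjE)
  note coll = this
  have step: "(\<forall>x\<in>helts a. \<exists>y\<in>helts t. \<exists>f\<in>helts U. \<exists>g\<in>helts U.
        is_hpair f x (hlist ?xs) \<and> is_hpair g y f \<and> g \<in> helts A) \<longrightarrow>
      (\<exists>b\<in>helts t. \<forall>x\<in>helts a. \<exists>y\<in>helts b. \<exists>f\<in>helts U. \<exists>g\<in>helts U.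
        is_hpair f x (hlist ?xs) \<and> is_hpair g y f \<and> g \<in> helts A)"
    by (rule bspec[OF bspec[OF bspec[OF coll A(1)] a] hlist_in_U[OF xs]])
  have "\<forall>x\<in>helts a. \<exists>y\<in>helts t. \<exists>f\<in>helts U. \<exists>g\<in>helts U.
        is_hpair f x (hlist ?xs) \<and> is_hpair g y f \<and> g \<in> helts A"
  proof
    fix x assume x: "x \<in> helts a"
    then obtain y where y: "y \<in> N" "P (case_nat y (case_nat x e))" using prem by blast
    show "\<exists>y\<in>helts t. \<exists>f\<in>helts U. \<exists>g\<in>helts U.
        is_hpair f x (hlist ?xs) \<and> is_hpair g y f \<and> g \<in> helts A"
      by (rule bexI[OF _ y(1)]) (use rel[OF t_trans[OF x a] y(1)] y(2) in blast)
  qed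
  with step obtain b where b: "b \<in> N" "\<forall>x\<in>helts a. \<exists>y\<in>helts b. \<exists>f\<in>helts U. \<exists>g\<in>helts U.
        is_hpair f x (hlist ?xs) \<and> is_hpair g y f \<and> g \<in> helts A"
    by blast
  have "\<forall>x\<in>helts a. \<exists>y\<in>helts b. P (case_nat y (case_nat x e))"
  proof
    fix x assume x: "x \<in> helts a"
    obtain y where y: "y \<in> helts b" "\<exists>f\<in>helts U. \<exists>g\<in>helts U.
        is_hpair f x (hlist ?xs) \<and> is_hpair g y f \<and> g \<in> helts A"
      using bspec[OF b(2) x] by blast
    show "\<exists>y\<in>helts b. P (case_nat y (case_nat x e))"
      by (rule bexI[OF _ y(1)]) (use rel[OF t_trans[OF x a] t_trans[OF y(1) b(1)]] y(2) in blast)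
  qed
  with b(1) show "\<exists>b\<in>N. \<forall>x\<in>helts a. \<exists>y\<in>helts b. P (case_nat y (case_nat x e))" by blast
qed

end

text \<open>Countability of the set of formulas keeps the Skolem hull and the family of definable
  relations countable, hence inside \<open>hc\<close>.\<close>

instance fm :: countable
  by countable_datatype

section \<open>Countable elementary submodels\<close>

definition skolem :: "fm \<Rightarrow> hc list \<Rightarrow> hc" where
  "skolem \<phi> xs = (SOME x. sat UNIV \<phi> (case_nat x (env xs)))"

text \<open>A Skolem hull that is closed under elements as well. All sets in \<open>hc\<close> are
  countable, so the hull is countable and transitive at once and needs no collapse. It starts with
  \<open>hempty\<close> because \<open>env\<close> uses that as default value.\<close>

primrec hull_step :: "hc \<Rightarrow> nat \<Rightarrow> hc set" where
  "hull_step z 0 = {z, hempty}"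
| "hull_step z (Suc k) = hull_step z k \<union> \<Union> (helts ` hull_step z k)
    \<union> (\<Union>\<phi>. skolem \<phi> ` lists (hull_step z k))"

definition hull :: "hc \<Rightarrow> hc set" where
  "hull z = (\<Union>k. hull_step z k)"

lemma countable_hull_step: "countable (hull_step z k)"
proof (induction k)
  case (Suc k)
  have "countable (\<Union> (helts ` hull_step z k))"
    using Suc by (intro countable_UN countable_helts)
  moreover have "countable (\<Union>\<phi>. skolem \<phi> ` lists (hull_step z k))"
    using Suc by (intro countable_UN countable_image countable_lists) simp
  ultimately show ?case using Suc by (simp add: countable_Un)
qed simp

lemma countable_hull: "countable (hull z)"
  unfolding hull_def by (intro countable_UN countable_hull_step) simp

lemma hull_step_mono: "j \<le> k \<Longrightarrow> hull_step z j \<subseteq> hull_step z k"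
  by (induction k rule: nat_induct) (auto simp: le_Suc_eq)

lemma hull_start: "z \<in> hull z" "hempty \<in> hull z"
proof -
  have "{z, hempty} \<subseteq> hull z" unfolding hull_def using UN_upper[of 0 UNIV "hull_step z"] by simp
  then show "z \<in> hull z" "hempty \<in> hull z" by auto
qed

lemma htrans_hull: "htrans (hull z)"
  unfolding htrans_def
proof (intro ballI subsetI)
  fix x y assume "x \<in> hull z" "y \<in> helts x"
  then obtain k where "x \<in> hull_step z k" unfolding hull_def by blast
  with \<open>y \<in> helts x\<close> have "y \<in> hull_step z (Suc k)" by auto
  then show "y \<in> hull z" unfolding hull_def by blast
qed

lemma skolem_hull:
  assumes "set xs \<subseteq> hull z"
  shows "skolem \<phi> xs \<in> hull z"
proof -
  have "\<exists>k. set xs \<subseteq> hull_step z k"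
    using assms
  proof (induction xs)
    case (Cons x xs)
    then obtain k where k: "set xs \<subseteq> hull_step z k" by auto
    obtain j where j: "x \<in> hull_step z j" using Cons.prems unfolding hull_def by auto
    have "x \<in> hull_step z (max j k)" "set xs \<subseteq> hull_step z (max j k)"
      using j k hull_step_mono[of j "max j k" z] hull_step_mono[of k "max j k" z] by auto
    then show ?case by auto
  qed simp
  then obtain k where "xs \<in> lists (hull_step z k)" by auto
  then have "skolem \<phi> xs \<in> hull_step z (Suc k)" by auto
  then show ?thesis unfolding hull_def by blast
qed

text \<open>The Tarski-Vaught condition. The finitely many values of \<open>e\<close> that
  \<open>\<phi>\<close> can see form a list, to which a Skolem function applies.\<close>

lemma hull_witness:
  assumes e: "range e \<subseteq> hull z" and "sat UNIV \<phi> (case_nat x e)"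
  shows "\<exists>y\<in>hull z. sat UNIV \<phi> (case_nat y e)"
proof -
  obtain n where n: "fv \<phi> \<subseteq> {..<n}" by (rule fv_bound)
  let ?xs = "map e [0..<n]"
  have "sat UNIV \<phi> (case_nat x (env ?xs))"
    using assms(2) case_nat_env_map[OF n, of UNIV x e] by simp
  then have "sat UNIV \<phi> (case_nat (skolem \<phi> ?xs) (env ?xs))"
    unfolding skolem_def by (rule someI)
  then have "sat UNIV \<phi> (case_nat (skolem \<phi> ?xs) e)"
    using case_nat_env_map[OF n, of UNIV _ e] by simp
  moreover have "skolem \<phi> ?xs \<in> hull z" by (rule skolem_hull) (use e in auto)
  ultimately show ?thesis by blast
qed

lemma hull_elementary: "range e \<subseteq> hull z \<Longrightarrow> sat (hull z) \<phi> e \<longleftrightarrow> sat UNIV \<phi> e"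
proof (induction \<phi> arbitrary: e)
  case (All \<phi>)
  have "sat (hull z) \<phi> (case_nat x e) \<longleftrightarrow> sat UNIV \<phi> (case_nat x e)" if "x \<in> hull z" for x
    using All that by simp
  moreover have "\<exists>y\<in>hull z. \<not> sat UNIV \<phi> (case_nat y e)" if "\<not> sat UNIV \<phi> (case_nat x e)" for x
    using hull_witness[OF All.prems, of "Neg \<phi>" x] that by simp
  ultimately show ?case by auto
next
  case (Ex \<phi>)
  have "sat (hull z) \<phi> (case_nat x e) \<longleftrightarrow> sat UNIV \<phi> (case_nat x e)" if "x \<in> hull z" for x
    using Ex that by simp
  then show ?case using hull_witness[OF Ex.prems, of \<phi>] by auto
qed auto

section \<open>The true universe\<close>

primrec hnat :: "nat \<Rightarrow> hc" where
  "hnat 0 = hempty"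
| "hnat (Suc n) = hset (insert (hnat n) (helts (hnat n)))"

lemma helts_hsucc [simp]: "helts (hset (insert x (helts y))) = insert x (helts y)"
  by (rule helts_hset) simp

lemma sat_UNIV_infinity: "sat UNIV infinity_ax e"
proof -
  have w: "helts (hset (range hnat)) = range hnat" by (rule helts_hset) simp
  have zero: "\<exists>x\<in>range hnat. x = hempty" by (rule bexI[OF _ rangeI[of hnat 0]]) simp
  have suc: "\<exists>y\<in>range hnat. y = hset (insert x (helts x))" if "x \<in> range hnat" for x
  proof -
    from that obtain n where "x = hnat n" by blast
    then show ?thesis by (intro bexI[OF _ rangeI[of hnat "Suc n"]]) simp
  qed
  have pre: "x = hempty \<or> (\<exists>z\<in>helts x. x = hset (insert z (helts z)))" if "x \<in> range hnat" for x
  proof -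
    from that obtain n where "x = hnat n" by blast
    then show ?thesis by (cases n) simp_all
  qed
  have "sat UNIV (is_omega 0) (case_nat (hset (range hnat)) e)"
    unfolding is_omega_def sat.simps sat_BAll sat_BEx sat_is_empty sat_is_succ
    using zero suc pre unfolding w nat.case One_nat_def by blast
  then show ?thesis unfolding infinity_ax_def sat.simps by blast
qed

lemma disjoint_choice:
  assumes "\<forall>x\<in>helts a. \<exists>y. y \<in> helts x"
    and disj: "\<forall>x\<in>helts a. \<forall>y\<in>helts a. x \<noteq> y \<longrightarrow> \<not> (\<exists>z. z \<in> helts x \<and> z \<in> helts y)"
  shows "\<exists>b. \<forall>x\<in>helts a. \<exists>!z. z \<in> helts b \<and> z \<in> helts x"
proof -
  obtain f where f: "\<forall>x\<in>helts a. f x \<in> helts x" using bchoice[OF assms(1)] by blast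
  let ?b = "hset (f ` helts a)"
  have b: "helts ?b = f ` helts a" by (rule helts_hset) simp
  have "\<exists>!z. z \<in> helts ?b \<and> z \<in> helts x" if x: "x \<in> helts a" for x
  proof (rule ex1I[of _ "f x"])
    show "f x \<in> helts ?b \<and> f x \<in> helts x" using f x by (simp add: b)
  next
    fix z assume z: "z \<in> helts ?b \<and> z \<in> helts x"
    then obtain y where y: "y \<in> helts a" "z = f y" by (auto simp: b)
    then have "x = y" using disj f z x by blast
    then show "z = f x" using y by simp
  qed
  then show ?thesis by blast
qed

lemma sat_UNIV_choice: "sat UNIV choice_ax e"
  unfolding choice_ax_def sat.simps sat_Neg sat_BAll sat_Ex1 hmem_iff numeral_2_eq_2 One_nat_def nat.case
    bex_UNIV ball_UNIV
  by (intro allI impI, elim conjE, rule disjoint_choice)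

lemma fv_basic_axioms: "fv basic_axioms = {}"
  by (auto simp: basic_axioms_def empty_ax_def pairing_ax_def union_ax_def infinity_ax_def
      choice_ax_def is_empty_def is_omega_def is_succ_def BAll_def BEx_def Iff_def Neg_def Ex1_def
      shift_def eval_nat_numeral)

lemma sat_UNIV_basic: "sat UNIV basic_axioms e"
proof -
  have "sat UNIV empty_ax e" by (simp add: empty_ax_def)
  moreover have "sat UNIV pairing_ax e"
  proof -
    have "\<exists>z. \<forall>u. u \<in> helts z \<longleftrightarrow> u = x \<or> u = y" for x y
      by (rule exI[of _ "hset {x, y}"]) simp
    then show ?thesis by (simp add: pairing_ax_def hmem_iff)
  qed
  moreover have "sat UNIV union_ax e"
  proof -
    have "\<exists>z. \<forall>u. u \<in> helts z \<longleftrightarrow> (\<exists>w. w \<in> helts x \<and> u \<in> helts w)" for x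
      by (rule exI[of _ "hunion x"]) auto
    then show ?thesis by (simp add: union_ax_def hmem_iff)
  qed
  ultimately show ?thesis
    unfolding basic_axioms_def using sat_UNIV_infinity sat_UNIV_choice by simp
qed

section \<open>Existence of certified sets\<close>

definition hlists :: "hc set \<Rightarrow> hc" where
  "hlists X = hset (hlist ` lists X)"

definition hrel :: "hc set \<Rightarrow> fm \<Rightarrow> hc" where
  "hrel X \<phi> = hset (hlist ` {xs \<in> lists X. sat X \<phi> (env xs)})"

lemma helts_hlists: "countable X \<Longrightarrow> helts (hlists X) = hlist ` lists X"
  unfolding hlists_def by (intro helts_hset countable_image countable_lists)

lemma helts_hrel: "countable X \<Longrightarrow> helts (hrel X \<phi>) = hlist ` {xs \<in> lists X. sat X \<phi> (env xs)}"
  unfolding hrel_def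
  by (intro helts_hset countable_image countable_subset[OF _ countable_lists[of X]]) auto

lemma hlist_in_hrel:
  "countable X \<Longrightarrow> hlist xs \<in> helts (hrel X \<phi>) \<longleftrightarrow> set xs \<subseteq> X \<and> sat X \<phi> (env xs)"
  by (auto simp: helts_hrel)

locale elementary_hull =
  fixes z :: hc
begin

definition "X = hull z"
definition "U = hlists X"
text \<open>All relations on lists that are definable over \<open>X\<close>, by arbitrary formulas
  and not only bounded ones, so that projection along \<open>X\<close> stays in the family.\<close>

definition "C = hset (range (hrel X))"

lemma countable_X: "countable X"
  unfolding X_def by (rule countable_hull)

lemma X_trans: "x \<in> helts y \<Longrightarrow> y \<in> X \<Longrightarrow> x \<in> X"
  using htrans_hull[of z] unfolding htrans_def X_def by blast

lemma elementary: "range e \<subseteq> X \<Longrightarrow> sat X \<phi> e \<longleftrightarrow> sat UNIV \<phi> e"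
  unfolding X_def by (rule hull_elementary)

lemma env_X: "set xs \<subseteq> X \<Longrightarrow> range (env xs) \<subseteq> X"
  by (rule range_env) (simp_all add: X_def hull_start)

lemma helts_C: "helts C = range (hrel X)"
  unfolding C_def by (rule helts_hset) simp

lemma bex_C: "(\<exists>P\<in>helts C. Q P) \<longleftrightarrow> (\<exists>\<phi>. Q (hrel X \<phi>))"
  unfolding helts_C by blast

lemma ball_C: "(\<forall>P\<in>helts C. Q P) \<longleftrightarrow> (\<forall>\<phi>. Q (hrel X \<phi>))"
  unfolding helts_C by blast

lemma ball_U: "(\<forall>e\<in>helts U. Q e) \<longleftrightarrow> (\<forall>xs. set xs \<subseteq> X \<longrightarrow> Q (hlist xs))"
  unfolding U_def helts_hlists[OF countable_X] by (auto simp: in_lists_conv_set subset_iff)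

lemma bex_U: "(\<exists>e\<in>helts U. Q e) \<longleftrightarrow> (\<exists>xs. set xs \<subseteq> X \<and> Q (hlist xs))"
  unfolding U_def helts_hlists[OF countable_X] by (auto simp: in_lists_conv_set subset_iff)

lemma mem_hrel: "set xs \<subseteq> X \<Longrightarrow> hlist xs \<in> helts (hrel X \<phi>) \<longleftrightarrow> sat X \<phi> (env xs)"
  by (simp add: hlist_in_hrel[OF countable_X])

lemma is_hpair_hlist: "is_hpair (hlist ys) x (hlist xs) \<longleftrightarrow> ys = x # xs"
  unfolding is_hpair_def hlist.simps(2)[symmetric] by (rule hlist_inject)

lemma pair_relation:
  assumes "\<And>x y xs. sat X \<phi> (case_nat x (case_nat y (env xs))) \<longleftrightarrow> Q x y"
  shows "\<exists>P\<in>helts C. \<forall>x\<in>X. \<forall>y\<in>X. \<forall>e\<in>helts U. \<forall>f\<in>helts U. \<forall>g\<in>helts U.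
      is_hpair f y e \<longrightarrow> is_hpair g x f \<longrightarrow> (g \<in> helts P \<longleftrightarrow> Q x y)"
  unfolding bex_C ball_U is_hpair_hlist
  by (rule exI[of _ \<phi>]) (auto simp: mem_hrel[of "_ # _ # _", simplified] assms)

text \<open>Each closure condition is met by an operation on formulas: \<open>Fls\<close>,
  \<open>Impl\<close> and \<open>Ex\<close> for the logical ones, \<open>shift 0\<close> and
  \<open>shift 1\<close> for the two ways of adding a dummy variable, and atoms for the three base
  relations.\<close>

lemma closed: "closed_relations (hset X) U C"
  unfolding closed_relations_def helts_hset[OF countable_X]
proof (intro conjI)
  show "\<exists>P\<in>helts C. \<forall>e\<in>helts U. e \<notin> helts P"
    unfolding bex_C ball_U by (rule exI[of _ Fls]) (simp add: mem_hrel)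
  show "\<forall>A\<in>helts C. \<forall>B\<in>helts C. \<exists>P\<in>helts C. \<forall>e\<in>helts U.
      e \<in> helts P \<longleftrightarrow> (e \<in> helts A \<longrightarrow> e \<in> helts B)"
    unfolding ball_C bex_C ball_U
  proof (intro allI)
    fix \<phi> \<psi>
    show "\<exists>\<chi>. \<forall>xs. set xs \<subseteq> X \<longrightarrow> (hlist xs \<in> helts (hrel X \<chi>) \<longleftrightarrow>
        (hlist xs \<in> helts (hrel X \<phi>) \<longrightarrow> hlist xs \<in> helts (hrel X \<psi>)))"
      by (rule exI[of _ "Impl \<phi> \<psi>"]) (simp add: mem_hrel)
  qed
  show "\<forall>A\<in>helts C. \<exists>P\<in>helts C. \<forall>e\<in>helts U.
      e \<in> helts P \<longleftrightarrow> (\<exists>x\<in>X. \<exists>f\<in>helts U. is_hpair f x e \<and> f \<in> helts A)"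
    unfolding ball_C bex_C ball_U bex_U is_hpair_hlist
  proof (intro allI)
    fix \<phi>
    have "hlist xs \<in> helts (hrel X (Ex \<phi>)) \<longleftrightarrow>
        (\<exists>x\<in>X. \<exists>ys. set ys \<subseteq> X \<and> ys = x # xs \<and> hlist ys \<in> helts (hrel X \<phi>))"
      if xs: "set xs \<subseteq> X" for xs
    proof -
      have "hlist (x # xs) \<in> helts (hrel X \<phi>) \<longleftrightarrow> sat X \<phi> (case_nat x (env xs))" if "x \<in> X" for x
        using mem_hrel[of "x # xs" \<phi>] xs that by simp
      then show ?thesis using mem_hrel[OF xs, of "Ex \<phi>"] xs by auto
    qed
    then show "\<exists>\<chi>. \<forall>xs. set xs \<subseteq> X \<longrightarrow> (hlist xs \<in> helts (hrel X \<chi>) \<longleftrightarrow>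
        (\<exists>x\<in>X. \<exists>ys. set ys \<subseteq> X \<and> ys = x # xs \<and> hlist ys \<in> helts (hrel X \<phi>)))"
      by blast
  qed
  show "\<forall>A\<in>helts C. \<exists>P\<in>helts C. \<forall>x\<in>X. \<forall>e\<in>helts U. \<forall>f\<in>helts U.
      is_hpair f x e \<longrightarrow> (f \<in> helts P \<longleftrightarrow> e \<in> helts A)"
    unfolding ball_C bex_C ball_U is_hpair_hlist
  proof (intro allI)
    fix \<phi>
    have "hlist (x # xs) \<in> helts (hrel X (shift 0 \<phi>)) \<longleftrightarrow> hlist xs \<in> helts (hrel X \<phi>)"
      if "x \<in> X" "set xs \<subseteq> X" for x xs
      using mem_hrel[of "x # xs" "shift 0 \<phi>"] mem_hrel[of xs \<phi>] that by (simp add: shift_def sat_ren)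
    then show "\<exists>\<chi>. \<forall>x\<in>X. \<forall>xs. set xs \<subseteq> X \<longrightarrow> (\<forall>ys. set ys \<subseteq> X \<longrightarrow> ys = x # xs \<longrightarrow>
        (hlist ys \<in> helts (hrel X \<chi>) \<longleftrightarrow> hlist xs \<in> helts (hrel X \<phi>)))"
      by blast
  qed
  show "\<forall>A\<in>helts C. \<exists>P\<in>helts C. \<forall>x\<in>X. \<forall>y\<in>X. \<forall>e\<in>helts U. \<forall>f\<in>helts U. \<forall>g\<in>helts U.
      \<forall>h\<in>helts U. is_hpair f y e \<longrightarrow> is_hpair g x f \<longrightarrow> is_hpair h x e \<longrightarrow> (g \<in> helts P \<longleftrightarrow> h \<in> helts A)"
    unfolding ball_C bex_C ball_U is_hpair_hlist
  proof (intro allI)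
    fix \<phi>
    have "hlist (x # y # xs) \<in> helts (hrel X (shift 1 \<phi>)) \<longleftrightarrow> hlist (x # xs) \<in> helts (hrel X \<phi>)"
      if "x \<in> X" "y \<in> X" "set xs \<subseteq> X" for x y xs
      using mem_hrel[of "x # y # xs" "shift 1 \<phi>"] mem_hrel[of "x # xs" \<phi>] that
      by (simp only: sat_shift1 env_Cons list.set insert_subset simp_thms)
    then show "\<exists>\<chi>. \<forall>x\<in>X. \<forall>y\<in>X. \<forall>xs. set xs \<subseteq> X \<longrightarrow> (\<forall>ys. set ys \<subseteq> X \<longrightarrow> (\<forall>zs. set zs \<subseteq> X \<longrightarrow>
        (\<forall>us. set us \<subseteq> X \<longrightarrow> ys = y # xs \<longrightarrow> zs = x # ys \<longrightarrow> us = x # xs \<longrightarrow>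
        (hlist zs \<in> helts (hrel X \<chi>) \<longleftrightarrow> hlist us \<in> helts (hrel X \<phi>)))))"
      by (intro exI[of _ "shift 1 \<phi>"] ballI allI impI) (simp only:)
  qed
qed (rule pair_relation[of "Mem 0 1"] pair_relation[of "Mem 1 0"] pair_relation[of "Eq 0 1"];
  simp add: hmem_iff)+

text \<open>Existence of the separated set is a first-order statement about \<open>a\<close> and the
  list. It is true in the universe, where every subset of a countable set is a set, and elementarity
  brings a witness into \<open>X\<close>.\<close>

lemma sat_X_separation: "set xs \<subseteq> X \<Longrightarrow> a \<in> X \<Longrightarrow>
  \<exists>y\<in>X. (\<forall>x\<in>helts y. x \<in> helts a) \<and>
    (\<forall>x\<in>helts a. x \<in> helts y \<longleftrightarrow> sat X \<phi> (case_nat x (env xs)))"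
proof -
  assume xs: "set xs \<subseteq> X" and a: "a \<in> X"
  let ?y = "hsep a (\<lambda>x. sat UNIV \<phi> (case_nat x (env xs)))"
  \<comment> \<open>The two shifts make the formula skip the new set and \<open>a\<close>, so that
    \<open>\<phi>\<close> sees \<open>x\<close> followed by the parameter list.\<close>
  let ?\<psi> = "All (Iff (Mem 0 1) (Conj (Mem 0 2) (shift 1 (shift 1 \<phi>))))"
  have s: "sat M (shift 1 (shift 1 \<phi>)) (case_nat x (case_nat y (case_nat u e))) \<longleftrightarrow> sat M \<phi> (case_nat x e)"
    for M x y u e by (simp only: sat_shift1)
  have "sat UNIV ?\<psi> (case_nat ?y (case_nat a (env xs)))"
    unfolding sat.simps sat_Iff s by (simp add: hmem_iff numeral_2_eq_2)
  then have "sat UNIV (Ex ?\<psi>) (case_nat a (env xs))" unfolding sat.simps(8) by blast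
  moreover have "range (case_nat a (env xs)) \<subseteq> X" using a env_X[OF xs] by simp
  ultimately have "sat X (Ex ?\<psi>) (case_nat a (env xs))" using elementary by blast
  then obtain y where y: "y \<in> X"
    "\<forall>x\<in>X. x \<in> helts y \<longleftrightarrow> x \<in> helts a \<and> sat X \<phi> (case_nat x (env xs))"
    unfolding sat.simps sat_Iff s hmem_iff by (auto simp: numeral_2_eq_2)
  show ?thesis
    by (rule bexI[OF _ y(1)]) (use y(2) X_trans[OF _ a] X_trans[OF _ y(1)] in blast)
qed

lemma sat_X_collection:
  assumes xs: "set xs \<subseteq> X" and a: "a \<in> X"
    and prem: "\<forall>x\<in>helts a. \<exists>y\<in>X. sat X \<phi> (case_nat y (case_nat x (env xs)))"
  shows "\<exists>b\<in>X. \<forall>x\<in>helts a. \<exists>y\<in>helts b. sat X \<phi> (case_nat y (case_nat x (env xs)))"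
proof -
  have el: "sat X \<phi> (case_nat y (case_nat x (env xs))) \<longleftrightarrow> sat UNIV \<phi> (case_nat y (case_nat x (env xs)))"
    if "x \<in> X" "y \<in> X" for x y
    using elementary[of "case_nat y (case_nat x (env xs))"] that env_X[OF xs] by simp
  let ?\<psi> = "BAll 1 (BEx 1 (shift 2 (shift 2 \<phi>)))"
  have s: "sat M (shift 2 (shift 2 \<phi>)) (case_nat x (case_nat y (case_nat b (case_nat a e))))
      \<longleftrightarrow> sat M \<phi> (case_nat x (case_nat y e))" for M x y a b e
    by (simp only: sat_shift2)
  have "\<forall>x\<in>helts a. \<exists>y. sat UNIV \<phi> (case_nat y (case_nat x (env xs)))"
    using prem el X_trans[OF _ a] by blast
  \<comment> \<open>The choice function lives outside \<open>X\<close>. Its image is a countable set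
    and witnesses an existence statement in the universe, and only that statement is transferred to
    \<open>X\<close>.\<close>
  then obtain f where f: "\<forall>x\<in>helts a. sat UNIV \<phi> (case_nat (f x) (case_nat x (env xs)))"
    by (rule bchoice[THEN exE]) (rule that)
  have b: "helts (hset (f ` helts a)) = f ` helts a" by (rule helts_hset) simp
  have "sat UNIV ?\<psi> (case_nat (hset (f ` helts a)) (case_nat a (env xs)))"
    unfolding sat_BAll sat_BEx s One_nat_def nat.case b using f by blast
  then have "sat UNIV (Ex ?\<psi>) (case_nat a (env xs))" unfolding sat.simps(8) by blast
  moreover have "range (case_nat a (env xs)) \<subseteq> X" using a env_X[OF xs] by simp
  ultimately have "sat X (Ex ?\<psi>) (case_nat a (env xs))" using elementary by blast
  then obtain b where b: "b \<in> X" "sat X ?\<psi> (case_nat b (case_nat a (env xs)))" by auto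
  have "\<forall>x\<in>X. x \<in> helts a \<longrightarrow> (\<exists>y\<in>X. y \<in> helts b \<and> sat X \<phi> (case_nat y (case_nat x (env xs))))"
    using b(2) unfolding BAll_def BEx_def sat.simps s hmem_iff by simp
  then show ?thesis
    by (intro bexI[OF _ b(1)]) (use X_trans[OF _ a] in blast)
qed

lemma certified_X: "certified (hset X) U C"
  unfolding certified_def helts_hset[OF countable_X]
proof (intro conjI)
  show "\<forall>x\<in>X. \<forall>y\<in>helts x. y \<in> X" using X_trans by blast
  have "sat X basic_axioms (\<lambda>_. hempty)"
    using elementary[of "\<lambda>_. hempty" basic_axioms] sat_UNIV_basic hull_start(2)[of z]
    by (auto simp: X_def)
  then show "sat X basic_axioms (\<lambda>_. hset X)"
    using fv_basic_axioms sat_cong_fv[of basic_axioms "\<lambda>_. hempty" "\<lambda>_. hset X" X] by simp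
  show "\<exists>e\<in>helts U. \<forall>x\<in>helts e. False"
    unfolding bex_U by (rule exI[of _ "[]"]) simp
  show "\<forall>x\<in>X. \<forall>e\<in>helts U. \<exists>f\<in>helts U. is_hpair f x e"
    unfolding ball_U bex_U is_hpair_hlist by auto
  show "closed_relations (hset X) U C" by (rule closed)
  show "\<forall>A\<in>helts C. \<forall>a\<in>X. \<forall>e\<in>helts U. \<exists>y\<in>X. (\<forall>x\<in>helts y. x \<in> helts a) \<and>
      (\<forall>x\<in>helts a. x \<in> helts y \<longleftrightarrow> (\<exists>f\<in>helts U. is_hpair f x e \<and> f \<in> helts A))"
    unfolding ball_C ball_U bex_U is_hpair_hlist
  proof (intro allI ballI impI)
    fix \<phi> a xs assume a: "a \<in> X" and xs: "set xs \<subseteq> X"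
    have "(\<exists>ys. set ys \<subseteq> X \<and> ys = x # xs \<and> hlist ys \<in> helts (hrel X \<phi>)) \<longleftrightarrow> sat X \<phi> (case_nat x (env xs))"
      if "x \<in> helts a" for x
      using mem_hrel[of "x # xs" \<phi>] X_trans[OF that a] xs by auto
    then show "\<exists>y\<in>X. (\<forall>x\<in>helts y. x \<in> helts a) \<and> (\<forall>x\<in>helts a. x \<in> helts y \<longleftrightarrow>
        (\<exists>ys. set ys \<subseteq> X \<and> ys = x # xs \<and> hlist ys \<in> helts (hrel X \<phi>)))"
      using sat_X_separation[OF xs a, of \<phi>] by simp
  qed
  show "\<forall>A\<in>helts C. \<forall>a\<in>X. \<forall>e\<in>helts U.
      (\<forall>x\<in>helts a. \<exists>y\<in>X. \<exists>f\<in>helts U. \<exists>g\<in>helts U.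
        is_hpair f x e \<and> is_hpair g y f \<and> g \<in> helts A) \<longrightarrow>
      (\<exists>b\<in>X. \<forall>x\<in>helts a. \<exists>y\<in>helts b. \<exists>f\<in>helts U. \<exists>g\<in>helts U.
        is_hpair f x e \<and> is_hpair g y f \<and> g \<in> helts A)"
    unfolding ball_C ball_U bex_U is_hpair_hlist
  proof (intro allI ballI impI)
    fix \<phi> a xs assume a: "a \<in> X" and xs: "set xs \<subseteq> X"
    let ?r = "\<lambda>x y. \<exists>ys. set ys \<subseteq> X \<and> (\<exists>zs. set zs \<subseteq> X \<and> ys = x # xs \<and> zs = y # ys \<and>
      hlist zs \<in> helts (hrel X \<phi>))"
    have r: "?r x y \<longleftrightarrow> sat X \<phi> (case_nat y (case_nat x (env xs)))" if "x \<in> X" "y \<in> X" for x y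
      using mem_hrel[of "y # x # xs" \<phi>] that xs by auto
    assume p: "\<forall>x\<in>helts a. \<exists>y\<in>X. ?r x y"
    have "\<forall>x\<in>helts a. \<exists>y\<in>X. sat X \<phi> (case_nat y (case_nat x (env xs)))"
    proof
      fix x assume x: "x \<in> helts a"
      then obtain y where "y \<in> X" "?r x y" using p by blast
      then show "\<exists>y\<in>X. sat X \<phi> (case_nat y (case_nat x (env xs)))"
        using r[OF X_trans[OF x a]] by blast
    qed
    then obtain b where b: "b \<in> X" "\<forall>x\<in>helts a. \<exists>y\<in>helts b. sat X \<phi> (case_nat y (case_nat x (env xs)))"
      using sat_X_collection[OF xs a, of \<phi>] by blast
    show "\<exists>b\<in>X. \<forall>x\<in>helts a. \<exists>y\<in>helts b. ?r x y"
    proof (intro bexI[OF _ b(1)] ballI)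
      fix x assume x: "x \<in> helts a"
      then obtain y where y: "y \<in> helts b" "sat X \<phi> (case_nat y (case_nat x (env xs)))" using b(2) by blast
      show "\<exists>y\<in>helts b. ?r x y"
        by (rule bexI[OF _ y(1)]) (use r[OF X_trans[OF x a] X_trans[OF y(1) b(1)]] y(2) in blast)
    qed
  qed
qed

end

lemma adm_certified:
  assumes "certified t U C"
  shows "adm (helts t)"
proof -
  interpret certificate t U C by unfold_locales (rule assms)
  have "sat (helts t) basic_axioms (\<lambda>_. t)"
    using assms unfolding certified_def by (elim conjE)
  then have "sat (helts t) empty_ax (\<lambda>_. t)" "sat (helts t) pairing_ax (\<lambda>_. t)"
      "sat (helts t) union_ax (\<lambda>_. t)" "sat (helts t) infinity_ax (\<lambda>_. t)"
      "sat (helts t) choice_ax (\<lambda>_. t)"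
    by (simp_all add: basic_axioms_def)
  moreover have "fv empty_ax = {}" "fv pairing_ax = {}" "fv union_ax = {}" "fv infinity_ax = {}"
      "fv choice_ax = {}"
    using fv_basic_axioms by (simp_all add: basic_axioms_def)
  moreover have "sat (helts t) \<phi> e" if "sat (helts t) \<phi> (\<lambda>_. t)" "fv \<phi> = {}" for \<phi> e
    using that sat_cong_fv[of \<phi> e "\<lambda>_. t" "helts t"] by blast
  ultimately show ?thesis
    unfolding adm_def using htrans_N separating_N collecting_N by blast
qed

section \<open>A chain of certified sets\<close>

text \<open>A descending chain of \<open>j\<close> certified sets below \<open>N\<close>. The
  certificates \<open>U\<close> and \<open>C\<close> are required to lie next to \<open>t\<close> in
  the larger set, so that the whole chain is visible from inside \<open>N\<close>.\<close>

primrec level :: "nat \<Rightarrow> hc set \<Rightarrow> bool" where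
  "level 0 N \<longleftrightarrow> True"
| "level (Suc j) N \<longleftrightarrow> (\<exists>t\<in>N. \<exists>U\<in>N. \<exists>C\<in>N. certified t U C \<and> level j (helts t))"

text \<open>The innermost member of the chain is dropped.\<close>

lemma level_antimono: "level (Suc j) N \<Longrightarrow> level j N"
proof (induction j arbitrary: N)
  case (Suc j)
  then obtain t U C where "t \<in> N" "U \<in> N" "C \<in> N" "certified t U C" "level (Suc j) (helts t)"
    by (auto simp del: level.simps(2) simp: level.simps(2)[of "Suc j"])
  then show ?case unfolding level.simps(2)[of j N] using Suc.IH by blast
qed simp

lemma level_le: "level j N \<Longrightarrow> i \<le> j \<Longrightarrow> level i N"
proof (induction j)
  case (Suc j)
  then show ?case using level_antimono[of j N] by (cases "i = Suc j") simp_all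
qed simp

lemma level_exists: "\<exists>t U C. certified t U C \<and> level j (helts t)"
proof (induction j)
  case 0
  interpret elementary_hull hempty .
  show ?case using certified_X by auto
next
  case (Suc j)
  then obtain t U C where c: "certified t U C" "level j (helts t)" by blast
  \<comment> \<open>Taking the set together with its certificate as seed puts all three into the
    next hull, by transitivity.\<close>
  let ?z = "hset {t, U, C}"
  interpret elementary_hull ?z .
  have "?z \<in> X" unfolding X_def by (rule hull_start)
  then have "t \<in> X" "U \<in> X" "C \<in> X" by (auto intro: X_trans[of _ ?z])
  then have "level (Suc j) (helts (hset X))"
    unfolding level.simps helts_hset[OF countable_X] using c by blast
  then show ?case using certified_X by blast
qed

text \<open>Descent along membership: a level in \<open>t\<close> that is too high exhibits a
  certified member of \<open>t\<close> that still has level \<open>j\<close>.\<close>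

lemma level_exact: "\<exists>t. (\<exists>U C. certified t U C) \<and> level j (helts t) \<and> \<not> level (Suc j) (helts t)"
proof -
  obtain t where "(\<exists>U C. certified t U C) \<and> level j (helts t)" using level_exists by blast
  then show ?thesis
  proof (induction t rule: hc_induct)
    case (step t)
    show ?case
    proof (cases "level (Suc j) (helts t)")
      case True
      then obtain s U C where "s \<in> helts t" "certified s U C" "level j (helts s)" by auto
      then show ?thesis using step.IH by blast
    next
      case False
      then show ?thesis using step.prems by blast
    qed
  qed
qed

text \<open>Exactness passes down the chain: if the member \<open>t\<close> of \<open>s\<close> had
  a level that is too high, then so would \<open>s\<close>, since the certificate of
  \<open>t\<close> also lies in \<open>s\<close>.\<close>

lemma level_chain_below:
  assumes "certified s U C" "level m (helts s)" "\<not> level (Suc m) (helts s)"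
  shows "\<exists>M. M m = s \<and> (\<forall>i\<le>m. (\<exists>U C. certified (M i) U C) \<and> level i (helts (M i)) \<and> \<not> level (Suc i) (helts (M i)))
    \<and> (\<forall>i<m. M i \<in> helts (M (Suc i)))"
  using assms
proof (induction m arbitrary: s U C)
  case 0
  then show ?case by (intro exI[of _ "\<lambda>_. s"]) auto
next
  case (Suc m)
  from Suc.prems(2) obtain t V D where t: "t \<in> helts s" "V \<in> helts s" "D \<in> helts s"
      "certified t V D" "level m (helts t)"
    by (auto simp del: level.simps(2) simp: level.simps(2)[of m])
  have "\<not> level (Suc m) (helts t)"
    using Suc.prems(3) t unfolding level.simps(2)[of "Suc m"] by blast
  from Suc.IH[OF t(4,5) this] obtain M where M: "M m = t"
      "\<forall>i\<le>m. (\<exists>U C. certified (M i) U C) \<and> level i (helts (M i)) \<and> \<not> level (Suc i) (helts (M i))"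
      "\<forall>i<m. M i \<in> helts (M (Suc i))" by blast
  let ?M = "M(Suc m := s)"
  have "(\<exists>U C. certified (?M i) U C) \<and> level i (helts (?M i)) \<and> \<not> level (Suc i) (helts (?M i))"
    if "i \<le> Suc m" for i
  proof (cases "i = Suc m")
    case True
    then show ?thesis using Suc.prems by auto
  next
    case False
    then show ?thesis using that M(2) by simp
  qed
  moreover have "?M i \<in> helts (?M (Suc i))" if "i < Suc m" for i
  proof (cases "i = m")
    case True
    then show ?thesis using M(1) t(1) by simp
  next
    case False
    then show ?thesis using that M(3) by simp
  qed
  ultimately show ?case by (intro exI[of _ ?M]) simp
qed

lemma level_chain:
  obtains M where "\<And>i. i \<le> m \<Longrightarrow> adm (helts (M i))"
    "\<And>i j. i \<le> m \<Longrightarrow> level j (helts (M i)) \<longleftrightarrow> j \<le> i"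
    "\<And>i j. i \<le> j \<Longrightarrow> j \<le> m \<Longrightarrow> helts (M i) \<subseteq> helts (M j)"
proof -
  obtain s U C where "certified s U C" "level m (helts s)" "\<not> level (Suc m) (helts s)"
    using level_exact by blast
  from level_chain_below[OF this] obtain M where
    M: "\<forall>i\<le>m. (\<exists>U C. certified (M i) U C) \<and> level i (helts (M i)) \<and> \<not> level (Suc i) (helts (M i))"
    and step: "\<forall>i<m. M i \<in> helts (M (Suc i))" by blast
  have adm: "adm (helts (M i))" if "i \<le> m" for i
    using M that adm_certified by blast
  moreover have "level j (helts (M i)) \<longleftrightarrow> j \<le> i" if "i \<le> m" for i j
    using M that level_le[of j "helts (M i)" "Suc i"] level_le[of i "helts (M i)" j]
    by (metis level_le not_less_eq_eq)
  moreover have "helts (M i) \<subseteq> helts (M j)" if "i \<le> j" "j \<le> m" for i j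
    using that
  proof (induction j)
    case (Suc j)
    show ?case
    proof (cases "i = Suc j")
      case False
      then have "helts (M i) \<subseteq> helts (M j)" using Suc by simp
      moreover have "helts (M j) \<subseteq> helts (M (Suc j))"
        using step Suc.prems adm_trans[OF adm[OF Suc.prems(2)]] by auto
      ultimately show ?thesis by blast
    qed simp
  qed simp
  ultimately show thesis by (rule that)
qed

section \<open>Sentences that measure the level of a domain\<close>

lemma dfn_level: "dfn (\<lambda>e. level j (helts (e k)))"
proof (induction j arbitrary: k)
  case 0
  show ?case by (simp add: dfn_True)
next
  case (Suc j)
  show ?case unfolding level.simps by (intro dfn_bex dfn_conj dfn_certified Suc)
qed

text \<open>Definability only asserts that a bounded formula exists, so one is chosen. Its free
  variables are confined to the three that \<open>tau\<close> is going to bind.\<close>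

definition certified_level :: "nat \<Rightarrow> fm" where
  "certified_level j = (SOME \<phi>. delta0 \<phi> \<and> fv \<phi> \<subseteq> {0, 1, 2} \<and>
    (\<forall>e. sat UNIV \<phi> e \<longleftrightarrow> certified (e 2) (e 1) (e 0) \<and> level j (helts (e 2))))"

lemma fv_ren: "fv (ren r \<phi>) \<subseteq> r ` fv \<phi>"
proof (induction \<phi> arbitrary: r)
  case (All \<phi>)
  show ?case
  proof
    fix i assume "i \<in> fv (ren r (All \<phi>))"
    then have "Suc i \<in> case_nat 0 (\<lambda>i. Suc (r i)) ` fv \<phi>"
      using All[of "case_nat 0 (\<lambda>i. Suc (r i))"] by auto
    then obtain j where "j \<in> fv \<phi>" "Suc i = case_nat 0 (\<lambda>i. Suc (r i)) j" by blast
    then show "i \<in> r ` fv (All \<phi>)" by (cases j) auto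
  qed
next
  case (Ex \<phi>)
  show ?case
  proof
    fix i assume "i \<in> fv (ren r (Ex \<phi>))"
    then have "Suc i \<in> case_nat 0 (\<lambda>i. Suc (r i)) ` fv \<phi>"
      using Ex[of "case_nat 0 (\<lambda>i. Suc (r i))"] by auto
    then obtain j where "j \<in> fv \<phi>" "Suc i = case_nat 0 (\<lambda>i. Suc (r i)) j" by blast
    then show "i \<in> r ` fv (Ex \<phi>)" by (cases j) auto
  qed
qed fastforce+

lemma certified_level:
  "delta0 (certified_level j)" "fv (certified_level j) \<subseteq> {0, 1, 2}"
  "sat UNIV (certified_level j) e \<longleftrightarrow> certified (e 2) (e 1) (e 0) \<and> level j (helts (e 2))"
proof -
  have "dfn (\<lambda>e. certified (e 2) (e 1) (e 0) \<and> level j (helts (e 2)))"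
    by (intro dfn_conj dfn_certified dfn_level)
  then obtain \<phi> where \<phi>: "delta0 \<phi>"
      "\<And>e. sat UNIV \<phi> e \<longleftrightarrow> certified (e 2) (e 1) (e 0) \<and> level j (helts (e 2))"
    by (auto simp: dfn_def)
  \<comment> \<open>Identifying all variables beyond 2 with variable 2 does not affect the meaning,
    since the defined predicate reads only the indices 0, 1 and 2.\<close>
  let ?r = "\<lambda>i. min i (2::nat)"
  have "delta0 (ren ?r \<phi>)" using \<phi>(1) by (rule delta0_ren)
  moreover have "fv (ren ?r \<phi>) \<subseteq> {0, 1, 2}"
    using fv_ren[of ?r \<phi>] by (auto simp: min_def split: if_splits)
  moreover have "sat UNIV (ren ?r \<phi>) e \<longleftrightarrow> certified (e 2) (e 1) (e 0) \<and> level j (helts (e 2))" for e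
    by (simp add: sat_ren \<phi>(2))
  ultimately have "\<exists>\<phi>. delta0 \<phi> \<and> fv \<phi> \<subseteq> {0, 1, 2} \<and>
      (\<forall>e. sat UNIV \<phi> e \<longleftrightarrow> certified (e 2) (e 1) (e 0) \<and> level j (helts (e 2)))" by blast
  from someI_ex[OF this] show "delta0 (certified_level j)" "fv (certified_level j) \<subseteq> {0, 1, 2}"
    "sat UNIV (certified_level j) e \<longleftrightarrow> certified (e 2) (e 1) (e 0) \<and> level j (helts (e 2))"
    unfolding certified_level_def by simp_all
qed

primrec tau :: "nat \<Rightarrow> fm" where
  "tau 0 = Impl Fls Fls"
| "tau (Suc j) = Ex (Ex (Ex (certified_level j)))"

lemma sentence_tau: "sentence (tau j)"
proof (cases j)
  case (Suc k)
  then show ?thesis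
    using certified_level(2)[of k] by (auto simp: sentence_def)
qed (simp add: sentence_def)

context kripke_adm
begin

text \<open>Existential quantifiers are evaluated in the domain of the node itself and their matrix
  is absolute, so forcing \<open>tau j\<close> measures this one domain and ignores later
  nodes.\<close>

lemma forced_tau:
  assumes v: "v \<in> K" "range e \<subseteq> D v"
  shows "forced (tau j) v e \<longleftrightarrow> level j (D v)"
proof (cases j)
  case (Suc k)
  have "forced (certified_level k) v (case_nat C (case_nat U (case_nat t e))) \<longleftrightarrow>
      certified t U C \<and> level k (helts t)" if "t \<in> D v" "U \<in> D v" "C \<in> D v" for t U C
    using absoluteD[OF absolute_delta0[OF certified_level(1)] v(1),
        of "case_nat C (case_nat U (case_nat t e))" k] that v(2) certified_level(3)
    by (simp add: numeral_2_eq_2)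
  then show ?thesis by (simp add: Suc)
qed simp

end

section \<open>Translations\<close>

primrec letters :: "pfm \<Rightarrow> nat set" where
  "letters (Letter p) = {p}"
| "letters PFls = {}"
| "letters (PConj A B) = letters A \<union> letters B"
| "letters (PDisj A B) = letters A \<union> letters B"
| "letters (PImpl A B) = letters A \<union> letters B"

lemma finite_letters: "finite (letters A)"
  by (induction A) simp_all

lemma (in kripke) forced_translate:
  assumes "translation \<sigma>" and "v \<in> K"
    and "\<And>p v. p \<in> letters A \<Longrightarrow> v \<in> K \<Longrightarrow> forced (\<sigma> p) v e \<longleftrightarrow> v \<in> V p"
  shows "forced (translate \<sigma> A) v e \<longleftrightarrow> forces (K, R) V A v"
  using assms(2,3) by (induction A arbitrary: v) simp_all

primrec conj_list :: "fm list \<Rightarrow> fm" where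
  "conj_list [] = Impl Fls Fls"
| "conj_list (\<phi> # \<Phi>) = Conj \<phi> (conj_list \<Phi>)"

lemma (in kripke) forced_conj_list: "forced (conj_list \<Phi>) v e \<longleftrightarrow> (\<forall>\<phi>\<in>set \<Phi>. forced \<phi> v e)"
  by (induction \<Phi>) simp_all

lemma sentence_conj_list: "(\<And>\<phi>. \<phi> \<in> set \<Phi> \<Longrightarrow> sentence \<phi>) \<Longrightarrow> sentence (conj_list \<Phi>)"
  by (induction \<Phi>) (simp_all add: sentence_def)

text \<open>The number \<open>k\<close> codes the set \<open>set_decode k\<close>, and its conjunct
  forbids domains of level exactly \<open>k\<close>. The list stops before \<open>m\<close>, which
  will code the set of all letters concerned.\<close>

definition type_translation :: "nat \<Rightarrow> nat \<Rightarrow> fm" where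
  "type_translation m i =
    conj_list (map (\<lambda>k. Impl (tau k) (tau (Suc k))) (filter (\<lambda>k. i \<notin> set_decode k) [0..<m]))"

lemma translation_type_translation: "translation (type_translation m)"
  unfolding translation_def type_translation_def
proof (intro allI sentence_conj_list)
  fix i \<phi>
  assume "\<phi> \<in> set (map (\<lambda>k. Impl (tau k) (tau (Suc k))) (filter (\<lambda>k. i \<notin> set_decode k) [0..<m]))"
  then obtain k where "\<phi> = Impl (tau k) (tau (Suc k))" by auto
  then show "sentence \<phi>"
    using sentence_tau[of k] sentence_tau[of "Suc k"] by (simp add: sentence_def del: tau.simps)
qed

section \<open>Countermodels and the de Jongh property\<close>

lemma J_subset_prop_logic: "J \<subseteq> prop_logic (extend T J)"
  unfolding prop_logic_def extend_def by (blast intro: proves.Hyp)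

lemma countermodel:
  assumes F: "kripke_frame F" and V: "persistent F V"
    and v0: "v0 \<in> fst F" "\<not> forces F V A v0"
    and J: "\<And>B. B \<in> J \<Longrightarrow> valid_in F B"
    and T: "\<And>\<phi>. \<phi> \<in> T \<Longrightarrow> IKP_plus \<union> {Markov, choice_ax} \<turnstile> \<phi>"
  shows "\<exists>\<sigma>. translation \<sigma> \<and> \<not> extend T J \<turnstile> translate \<sigma> A"
proof -
  obtain K R where KR: "F = (K, R)" by (cases F)
  have R: "R \<subseteq> K \<times> K" "\<And>v. v \<in> K \<Longrightarrow> (v, v) \<in> R"
      "\<And>u v w. (u, v) \<in> R \<Longrightarrow> (v, w) \<in> R \<Longrightarrow> (u, w) \<in> R"
    using F partial_order_onD[of K R] unfolding kripke_frame_def KR refl_on_def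
    by (auto dest: transD)
  have pers: "w \<in> V p" if "(v, w) \<in> R" "v \<in> V p" for p v w
    using V that by (auto simp: persistent_def KR)
  obtain n where n: "letters A \<subseteq> {..<n}"
    using finite_letters[of A] finite_nat_iff_bounded by blast
  define ty where "ty v = set_encode {i. i < n \<and> v \<in> V i}" for v
  define m where "m = set_encode {..<n}"
  have dec: "set_decode (ty v) = {i. i < n \<and> v \<in> V i}" for v
    unfolding ty_def by (rule set_encode_inverse) simp
  \<comment> \<open>Persistence enlarges the set of forced letters, and a larger set has a larger
    binary code; this makes the domains grow along the frame.\<close>
  have ty_mono: "ty v \<le> ty w" if "(v, w) \<in> R" for v w
    by (rule subset_decode_imp_le) (use pers[OF that] in \<open>auto simp: dec\<close>)
  have ty_le: "ty v \<le> m" for v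
    by (rule subset_decode_imp_le) (auto simp: dec m_def)
  obtain M where M: "\<And>i. i \<le> m \<Longrightarrow> adm (helts (M i))"
    "\<And>i j. i \<le> m \<Longrightarrow> level j (helts (M i)) \<longleftrightarrow> j \<le> i"
    "\<And>i j. i \<le> j \<Longrightarrow> j \<le> m \<Longrightarrow> helts (M i) \<subseteq> helts (M j)"
    by (rule level_chain[of m]) (rule that)
  interpret kripke_adm K R "\<lambda>v. helts (M (ty v))"
  proof unfold_locales
    show "(v, v) \<in> R" if "v \<in> K" for v using R(2) that .
    show "(u, w) \<in> R" if "(u, v) \<in> R" "(v, w) \<in> R" for u v w using R(3) that .
    show "helts (M (ty v)) \<subseteq> helts (M (ty w))" if "(v, w) \<in> R" for v w
      using M(3) ty_mono[OF that] ty_le by blast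
    show "adm (helts (M (ty v)))" for v using M(1) ty_le by blast
  qed
  \<comment> \<open>One assignment for all nodes, admissible because \<open>hempty\<close> belongs
    to every domain.\<close>
  let ?e = "\<lambda>_::nat. hempty"
  have e: "range ?e \<subseteq> helts (M (ty v))" for v
    using adm_hempty[OF M(1)[OF ty_le]] by auto
  have letter: "forced (type_translation m i) v ?e \<longleftrightarrow> v \<in> V i" if i: "i < n" and v: "v \<in> K" for i v
  proof -
    have tau: "forced (tau k) w ?e \<longleftrightarrow> k \<le> ty w" if "w \<in> K" for k w
      using forced_tau[OF that e] M(2)[OF ty_le] by simp
    have "forced (type_translation m i) v ?e \<longleftrightarrow>
        (\<forall>k<m. i \<notin> set_decode k \<longrightarrow> (\<forall>w\<in>K. (v, w) \<in> R \<longrightarrow> k \<le> ty w \<longrightarrow> Suc k \<le> ty w))"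
      unfolding type_translation_def forced_conj_list
      by (auto simp: tau simp del: tau.simps)
    \<comment> \<open>The conjunct for \<open>k\<close> can fail only at a \<open>w\<close> with
      \<open>ty w = k\<close>. Together the conjuncts say that no \<open>w\<close> above
      \<open>v\<close> has a type below \<open>m\<close> that omits \<open>i\<close>.\<close>
    also have "\<dots> \<longleftrightarrow> (\<forall>w\<in>K. (v, w) \<in> R \<longrightarrow> (ty w < m \<longrightarrow> i \<in> set_decode (ty w)))"
      by (metis le_antisym le_refl not_less_eq_eq)
    also have "\<dots> \<longleftrightarrow> (\<forall>w\<in>K. (v, w) \<in> R \<longrightarrow> i \<in> set_decode (ty w))"
    proof -
      \<comment> \<open>Type \<open>m\<close> contains every letter below \<open>n\<close>, so the
        restriction to types below \<open>m\<close> disappears.\<close>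
      have "i \<in> set_decode m" using i by (simp add: m_def)
      then show ?thesis using ty_le le_neq_implies_less by metis
    qed
    also have "\<dots> \<longleftrightarrow> v \<in> V i"
      using i v R(2) pers by (auto simp: dec)
    finally show ?thesis .
  qed
  have tr: "translation (type_translation m)" by (rule translation_type_translation)
  have "\<not> extend T J \<turnstile> translate (type_translation m) A"
  proof
    assume prov: "extend T J \<turnstile> translate (type_translation m) A"
    have ax: "forced \<gamma> v0 ?e" if "\<gamma> \<in> extend T J" for \<gamma>
    proof -
      have v0K: "v0 \<in> K" using v0 KR by simp
      from that consider "\<gamma> \<in> T" | \<sigma> B where "\<gamma> = translate \<sigma> B" "translation \<sigma>" "B \<in> J"
        unfolding extend_def by blast
      then show ?thesis
      proof cases
        case 1
        show ?thesis
          by (rule soundness[OF T[OF 1] v0K e]) (use valid_axioms v0K e in \<open>auto simp: valid_def\<close>)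
      next
        case 2
        \<comment> \<open>A translation induces a persistent valuation by forcing. Every
          \<open>B\<close> in \<open>J\<close> is valid in the frame, so it holds under this
          valuation, which means that its translation is forced.\<close>
        let ?V = "\<lambda>p. {w \<in> K. forced (\<sigma> p) w ?e}"
        have "persistent F ?V"
          unfolding persistent_def KR using R(1) forced_mono by auto
        then have "forces F ?V B v0" using J[OF 2(3)] v0 by (simp add: valid_in_def)
        then show ?thesis
          unfolding 2(1) KR by (subst forced_translate[OF 2(2) v0K, of _ _ ?V]) auto
      qed
    qed
    have v0K: "v0 \<in> K" using v0 KR by simp
    have "forced (translate (type_translation m) A) v0 ?e"
      by (rule soundness[OF prov v0K e]) (use ax in blast)
    then have "forces (K, R) V A v0"
      using forced_translate[OF tr v0K, of A ?e V] letter n by blast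
    then show False using v0(2) KR by simp
  qed
  with tr show ?thesis by blast
qed

theorem corollary43:
  fixes T :: "fm set" and J :: "pfm set"
  assumes "\<exists>M. is_ctm M ZFC"
    and "set_theory T"
    and "theorems T \<subseteq> theorems (IKP_plus \<union> {Markov, choice_ax})"
    and "intermediate J"
    and "kripke_complete TYPE('w) J"
  shows "de_jongh_property T J"
proof -
  obtain \<C> :: "'w frame set" where \<C>: "\<forall>F\<in>\<C>. kripke_frame F" "J = {A. \<forall>F\<in>\<C>. valid_in F A}"
    using assms(5) unfolding kripke_complete_def by blast
  have T: "IKP_plus \<union> {Markov, choice_ax} \<turnstile> \<phi>" if "\<phi> \<in> T" for \<phi>
  proof -
    have "\<phi> \<in> theorems T"
      using that assms(2) by (simp add: theorems_def set_theory_def proves.Hyp)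
    then show ?thesis using assms(3) by (auto simp: theorems_def)
  qed
  have "prop_logic (extend T J) \<subseteq> J"
  proof
    fix A assume A: "A \<in> prop_logic (extend T J)"
    show "A \<in> J"
    proof (rule ccontr)
      assume "A \<notin> J"
      \<comment> \<open>One frame of the class refutes \<open>A\<close>. As a member of the class it
        validates all of \<open>J\<close>, so the translated axioms from \<open>J\<close> are forced
        in the model built on it.\<close>
      then obtain F where F: "F \<in> \<C>" "\<not> valid_in F A" using \<C>(2) by blast
      then obtain V v0 where V: "persistent F V" "v0 \<in> fst F" "\<not> forces F V A v0"
        unfolding valid_in_def by blast
      have "\<exists>\<sigma>. translation \<sigma> \<and> \<not> extend T J \<turnstile> translate \<sigma> A"
      proof (rule countermodel[OF _ V])
        show "kripke_frame F" using \<C>(1) F(1) by blast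
        show "valid_in F B" if "B \<in> J" for B using that \<C>(2) F(1) by blast
      qed (rule T)
      then show False using A by (auto simp: prop_logic_def)
    qed
  qed
  then show ?thesis
    unfolding de_jongh_property_def using J_subset_prop_logic by blast
qed

end
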